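(* Let $\mathcal{X}$, $\mathcal{Y}$ be real, separable Hilbert spaces and let $\mu$ be a probability measure supported on $\mathcal{X}$ such that $\mathbb{E}_{x\sim\mu}\|x\|_{\mathcal{X}}^4<\infty$. Suppose $\Psi:\mathcal{X}\to\mathcal{Y}$ is a $\mu$-measurable, globally Lipschitz map. Fix $d_{\mathcal{X}},d_{\mathcal{Y}}\in\mathbb{N}$, $N\ge\max\{d_{\mathcal{X}},d_{\mathcal{Y}}\}$, $\delta\in(0,1)$ and $\tau>0$. Define $M=\sqrt{\mathbb{E}_{x\sim\mu}\|x\|_{\mathcal{X}}^2/\delta}$. Then there exists a constant $c=c(d_{\mathcal{X}},d_{\mathcal{Y}})\ge0$ and a zero-extended stacked neural network $\chi\in\mathcal{M}(d_{\mathcal{X}},d_{\mathcal{Y}};t,r,M)$ (whose weights and biases may depend on the data set $\{x_j\}_{j=1}^N$) with $$t\le c(d_{\mathcal{X}},d_{\mathcal{Y}})\,[\log(M\sqrt{d_{\mathcal{Y}}}/\tau)+1],\qquad r\le c(d_{\mathcal{X}},d_{\mathcal{Y}})\,(\tau/2M)^{-d_{\mathcal{X}}}[\log(M\sqrt{d_{\mathcal{Y}}}/\tau)+1],$$ so that $$\mathbb{E}_{\{x_j\}\sim\mu}\,\mathbb{E}_{x\sim\mu}\big(e_{NN}(x)^2\big)\le C\left(\tau^2+\sqrt{\delta}+\sqrt{\frac{d_{\mathcal{X}}}{N}}+R^{\mu}(V^{\mathcal{X}}_{d_{\mathcal{X}}})+\sqrt{\frac{d_{\mathcal{Y}}}{N}}+R^{\Psi_\sharp\mu}(V^{\mathcal{Y}}_{d_{\mathcal{Y}}})\right),$$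 where $e_{NN}(x)=\|(G_{\mathcal{Y}}\circ\chi\circ F_{\mathcal{X}})(x)-\Psi(x)\|_{\mathcal{Y}}$ and $C>0$ is independent of $d_{\mathcal{X}},d_{\mathcal{Y}},N,\delta$ and $\tau$. Here the outer expectation is over i.i.d. samples $x_1,\dots,x_N\sim\mu$ and the inner one over an independent $x\sim\mu$.
   Context: PCA. Let $\mathcal{H}$ be a real separable Hilbert space and $u_1,\dots,u_N\in\mathcal{H}$ data. The empirical non-centered covariance is $C_N=\frac1N\sum_{j=1}^N u_j\otimes u_j$, with orthonormal eigenvectors $\phi_{1,N},\dots,\phi_{N,N}$ and eigenvalues $\lambda_{1,N}\ge\dots\ge\lambda_{N,N}\ge 0$. For $d\le N$ the PCA encoder of dimension $d$ is $F_{\mathcal{H}}:\mathcal{H}\to\mathbb{R}^d$, $F_{\mathcal{H}}(u)=(\langle u,\phi_{1,N}\rangle,\dots,\langle u,\phi_{d,N}\rangle)^T$, and the PCA decoder is $G_{\mathcal{H}}:\mathbb{R}^d\to\mathcal{H}$, $G_{\mathcal{H}}(s)=\sum_{j=1}^d s_j\phi_{j,N}$. $F_{\mathcal{X}}$ is the encoder with $\mathcal{H}=\mathcal{X}$, $u_j=x_j$, $d=d_{\mathcal{X}}$; $G_{\mathcal{Y}}$ is the decoder with $\mathcal{H}=\mathcal{Y}$, $u_j=y_j=\Psi(x_j)$, $d=d_{\mathcal{Y}}$. Optimal projection spaces. For a probability measure $\nu$ on $\mathcal{H}$ with finite second moment, let $C=\mathbb{E}_{u\sim\nu}[u\otimes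 u]$ be its non-centered covariance, with orthonormal eigenvectors $\phi_1,\phi_2,\dots$ ordered by decreasing eigenvalues $\lambda_1\ge\lambda_2\ge\dots$; the optimal projection space is $V_d=\mathrm{span}\{\phi_1,\dots,\phi_d\}$. The projection error of a subspace $V$ is $R^\nu(V)=\mathbb{E}_{u\sim\nu}\|u-\Pi_Vu\|^2$, with $\Pi_V$ the orthogonal projection onto $V$. $V^{\mathcal{X}}_{d_{\mathcal{X}}}$ is the $d_{\mathcal{X}}$-dimensional optimal projection space for $\mu$ on $\mathcal{X}$, and $V^{\mathcal{Y}}_{d_{\mathcal{Y}}}$ is the $d_{\mathcal{Y}}$-dimensional one for the pushforward $\Psi_\sharp\mu$ on $\mathcal{Y}$. Neural networks. Let $\sigma(s)=\max\{0,s\}$ be the ReLU function, applied entrywise to vectors. For a matrix or vector $W$, $|W|_0$ is its number of nonzero entries. $\mathcal{M}(n;t,r)$ is the set of functions $\chi:\mathbb{R}^n\to\mathbb{R}$ of the form $\chi(s)=W_t\sigma(\cdots\sigma(W_2\sigma(W_1s+b_1)+b_2))+b_t$ with weight matrices $W_1,\dots,W_t$ (not necessarily square) and bias vectors $b_1,\dots,b_t$ satisfying $\sum_{k=1}^t(|W_k|_0+|b_k|_0)\le r$; $t\ge1$ is the number of layers. The stacked networks $\mathcal{M}(n,m;t,r)$ are the maps $\chi=(\chi^{(1)},\dots,\chi^{(m)})^T:\mathbb{R}^n\to\mathbb{R}^m$ with $\chi^{(j)}\in\mathcal{M}(n;t^{(j)},r^{(j)})$, $t^{(j)}\le t$, $r^{(j)}\le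 r$. For $M>0$, the zero-extended stacked networks $\mathcal{M}(n,m;t,r,M)$ are the maps $\chi$ such that for some $\tilde\chi\in\mathcal{M}(n,m;t,r)$, $\chi(s)=\tilde\chi(s)$ for $s\in[-M,M]^n$ and $\chi(s)=0$ for $s\notin[-M,M]^n$.
   Formalization: In the bounds on t and r, log(M√d_Y/τ) is replaced by max(0, log(M√d_Y/τ)), since the printed bound fails for τ ≥ e·M√d_Y (t ≥ 1 is required). E‖x‖² > 0 is assumed, so that M > 0. The constant c is chosen for given spaces X, Y, before μ and Ψ. *)

theory Defs
  imports "HOL-Probability.Probability" "Jordan_Normal_Form.Matrix"
begin

section \<open>Covariance operators, eigenvectors and projection errors\<close>

definition tensor_op :: "'a::real_inner \<Rightarrow> 'a \<Rightarrow> 'a \<Rightarrow> 'a" where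
  "tensor_op u v = (\<lambda>w. inner v w *\<^sub>R u)"

definition empirical_covariance :: "nat \<Rightarrow> (nat \<Rightarrow> 'a::real_inner) \<Rightarrow> 'a \<Rightarrow> 'a" where
  "empirical_covariance N u = (\<lambda>w. (1 / real N) *\<^sub>R (\<Sum>j<N. tensor_op (u j) (u j) w))"

definition covariance ::
  "'a::{real_inner, banach, second_countable_topology} measure \<Rightarrow> 'a \<Rightarrow> 'a" where
  "covariance \<nu> = (\<lambda>w. \<integral>u. tensor_op u u w \<partial>\<nu>)"

text \<open>
  Eigenpairs \<open>(lam i, phi i)\<close> for \<open>i < n\<close>, counted from 0. The number \<open>n\<close> may be \<open>\<infinity>\<close>.
  The last condition says that the list exhausts the nonzero spectrum with multiplicity (for a
  self-adjoint \<open>C\<close>). It is not required that the \<open>phi i\<close> span the whole space: if \<open>C\<close> has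
  infinitely many positive eigenvalues and a kernel, a decreasing enumeration never reaches
  the kernel.
\<close>
definition ordered_eigensystem ::
  "('a::real_inner \<Rightarrow> 'a) \<Rightarrow> enat \<Rightarrow> (nat \<Rightarrow> real) \<Rightarrow> (nat \<Rightarrow> 'a) \<Rightarrow> bool" where
  "ordered_eigensystem C n lam phi \<longleftrightarrow>
     (\<forall>i j. enat i < n \<longrightarrow> enat j < n \<longrightarrow> inner (phi i) (phi j) = (if i = j then 1 else 0)) \<and>
     (\<forall>i. enat i < n \<longrightarrow> C (phi i) = lam i *\<^sub>R phi i) \<and>
     (\<forall>i. enat i < n \<longrightarrow> 0 \<le> lam i) \<and>
     (\<forall>i j. i \<le> j \<longrightarrow> enat j < n \<longrightarrow> lam j \<le> lam i) \<and>
     (\<forall>u. (\<forall>i. enat i < n \<longrightarrow> inner u (phi i) = 0) \<longrightarrow> C u = 0)"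

text \<open>
  \<open>phi 0, \<dots>, phi (d - 1)\<close> are the first \<open>d\<close> members of an ordered eigensystem. For an empirical
  covariance of \<open>N\<close> points the usual length of the system is \<open>N\<close>; leaving it open
  also covers finite-dimensional spaces of dimension between \<open>d\<close> and \<open>N\<close>.
\<close>
definition leading_eigenvectors ::
  "('a::real_inner \<Rightarrow> 'a) \<Rightarrow> nat \<Rightarrow> (nat \<Rightarrow> 'a) \<Rightarrow> bool" where
  "leading_eigenvectors C d phi \<longleftrightarrow>
     (\<exists>n lam. enat d \<le> n \<and> ordered_eigensystem C n lam phi)"

definition optimal_projection_space ::
  "'a::{real_inner, banach, second_countable_topology} measure \<Rightarrow> nat \<Rightarrow> 'a set \<Rightarrow> bool" where
  "optimal_projection_space \<nu> d V \<longleftrightarrow>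
     (\<exists>phi. leading_eigenvectors (covariance \<nu>) d phi \<and> V = span (phi ` {..<d}))"

definition orth_proj :: "'a::real_inner set \<Rightarrow> 'a \<Rightarrow> 'a" where
  "orth_proj V u = (THE p. p \<in> V \<and> (\<forall>v\<in>V. inner (u - p) v = 0))"

definition projection_error :: "'a::real_inner measure \<Rightarrow> 'a set \<Rightarrow> real" where
  "projection_error \<nu> V = (\<integral>u. (norm (u - orth_proj V u))\<^sup>2 \<partial>\<nu>)"

definition pca_encoder :: "nat \<Rightarrow> (nat \<Rightarrow> 'a::real_inner) \<Rightarrow> 'a \<Rightarrow> real Matrix.vec" where
  "pca_encoder d phi u = Matrix.vec d (\<lambda>i. inner u (phi i))"

definition pca_decoder :: "nat \<Rightarrow> (nat \<Rightarrow> 'a::real_inner) \<Rightarrow> real Matrix.vec \<Rightarrow> 'a" where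
  "pca_decoder d phi s = (\<Sum>j<d. vec_index s j *\<^sub>R phi j)"

section \<open>ReLU networks\<close>

type_synonym layer = "real Matrix.mat \<times> real Matrix.vec"

definition relu :: "real \<Rightarrow> real" where
  "relu s = max 0 s"

text \<open>The last layer is affine, without activation.\<close>
fun net_eval :: "layer list \<Rightarrow> real Matrix.vec \<Rightarrow> real Matrix.vec" where
  "net_eval [] s = s"
| "net_eval [(W, b)] s = W *\<^sub>v s + b"
| "net_eval ((W, b) # l # ls) s = net_eval (l # ls) (map_vec relu (W *\<^sub>v s + b))"

text \<open>Consecutive layers fit together to a map from dimension \<open>n\<close> to dimension \<open>m\<close>.\<close>
fun net_dims :: "nat \<Rightarrow> layer list \<Rightarrow> nat \<Rightarrow> bool" where
  "net_dims n [] m \<longleftrightarrow> n = m"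
| "net_dims n ((W, b) # ls) m \<longleftrightarrow>
     W \<in> carrier_mat (dim_row W) n \<and> b \<in> carrier_vec (dim_row W) \<and> net_dims (dim_row W) ls m"

definition nnz_mat :: "real Matrix.mat \<Rightarrow> nat" where
  "nnz_mat W = card {(i, j). i < dim_row W \<and> j < dim_col W \<and> W $$ (i, j) \<noteq> 0}"

definition nnz_vec :: "real Matrix.vec \<Rightarrow> nat" where
  "nnz_vec b = card {i. i < dim_vec b \<and> vec_index b i \<noteq> 0}"

definition net_size :: "layer list \<Rightarrow> nat" where
  "net_size ls = (\<Sum>(W, b)\<leftarrow>ls. nnz_mat W + nnz_vec b)"

text \<open>
  Functions on \<open>\<real>\<^sup>n\<close> are total functions on vectors of arbitrary dimension; only their values on
  \<open>carrier_vec n\<close> matter.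
\<close>
definition relu_nets :: "nat \<Rightarrow> nat \<Rightarrow> nat \<Rightarrow> (real Matrix.vec \<Rightarrow> real) set" where
  "relu_nets n t r =
     {f. \<exists>ls. 1 \<le> t \<and> length ls = t \<and> net_dims n ls 1 \<and> net_size ls \<le> r \<and>
              (\<forall>s\<in>carrier_vec n. f s = vec_index (net_eval ls s) 0)}"

definition stacked_nets ::
  "nat \<Rightarrow> nat \<Rightarrow> nat \<Rightarrow> nat \<Rightarrow> (real Matrix.vec \<Rightarrow> real Matrix.vec) set" where
  "stacked_nets n m t r =
     {f. f \<in> carrier_vec n \<rightarrow> carrier_vec m \<and>
          (\<forall>j<m. \<exists>t'\<le>t. \<exists>r'\<le>r. (\<lambda>s. vec_index (f s) j) \<in> relu_nets n t' r')}"

definition cube :: "nat \<Rightarrow> real \<Rightarrow> real Matrix.vec set" where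
  "cube n M = {s \<in> carrier_vec n. \<forall>i<n. vec_index s i \<in> {-M..M}}"

definition zero_ext_nets ::
  "nat \<Rightarrow> nat \<Rightarrow> nat \<Rightarrow> nat \<Rightarrow> real \<Rightarrow> (real Matrix.vec \<Rightarrow> real Matrix.vec) set" where
  "zero_ext_nets n m t r M =
     {f. \<exists>g\<in>stacked_nets n m t r. \<forall>s\<in>carrier_vec n.
          f s = (if s \<in> cube n M then g s else 0\<^sub>v m)}"

text \<open>Here \<open>phiX\<close>, \<open>phiY\<close> are the eigenvectors of the input and output empirical covariances.\<close>
definition nn_error :: "nat \<Rightarrow> (nat \<Rightarrow> 'x::real_inner) \<Rightarrow> nat \<Rightarrow> (nat \<Rightarrow> 'y::real_inner) \<Rightarrow>
    (real Matrix.vec \<Rightarrow> real Matrix.vec) \<Rightarrow> ('x \<Rightarrow> 'y) \<Rightarrow> 'x \<Rightarrow> real" where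
  "nn_error dX phiX dY phiY f \<Psi> x =
     norm ((pca_decoder dY phiY \<circ> f \<circ> pca_encoder dX phiX) x - \<Psi> x)"

section \<open>Upper expectation\<close>

text \<open>
  Empirical eigenvectors and the network are arbitrary, possibly non-measurable, functions of the
  data. \<open>nn_integral\<close> of a non-measurable function is a lower integral, for which an upper bound
  would say too little, so the expectation over the data is taken as an upper integral. The two
  agree on measurable functions.
\<close>
definition upper_nn_integral :: "'a measure \<Rightarrow> ('a \<Rightarrow> ennreal) \<Rightarrow> ennreal" where
  "upper_nn_integral M f =
     (INF g\<in>{g \<in> borel_measurable M. \<forall>x\<in>space M. f x \<le> g x}. \<integral>\<^sup>+x. g x \<partial>M)"

lemma nn_integral_le_upper: "(\<integral>\<^sup>+x. f x \<partial>M) \<le> upper_nn_integral M f"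
  unfolding upper_nn_integral_def by (auto intro!: INF_greatest nn_integral_mono)

lemma upper_nn_integral_eq:
  assumes "f \<in> borel_measurable M"
  shows "upper_nn_integral M f = (\<integral>\<^sup>+x. f x \<partial>M)"
proof (rule antisym)
  show "upper_nn_integral M f \<le> (\<integral>\<^sup>+x. f x \<partial>M)"
    unfolding upper_nn_integral_def using assms by (intro INF_lower) auto
qed (rule nn_integral_le_upper)

end

theory Submission
  imports Defs
begin

text \<open>
  Write \<open>n\<close>, \<open>m\<close> for the two latent dimensions, and \<open>L\<close> for a Lipschitz constant of \<open>\<Psi>\<close>. On
  inputs whose code lies in the cube, the error splits into three parts: the error of the network
  in latent coordinates, the PCA residual of the input multiplied by \<open>L\<close>, and the PCA residual of
  the output (\<open>nn_error_on_cube\<close>). Outside the cube the network returns \<open>0\<close>, so the error is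
  \<open>norm (\<Psi> x)\<close>; this happens only for \<open>norm x > M\<close>, an event of probability at most \<open>\<delta>\<close>, and the
  fourth moment turns this into the term \<open>sqrt \<delta>\<close> (\<open>nn_error_off_cube\<close>).

  \<^emph>\<open>The network.\<close> Let \<open>f\<close> be \<open>L\<close>-Lipschitz for the \<open>\<ell>\<^sup>1\<close> norm and let \<open>p k\<close> be the points
  of a grid of spacing \<open>h\<close> in the cube. The function \<open>MAX k. f (p k) - L * |x - p k|\<close> never exceeds
  \<open>f\<close>, and the grid point next to \<open>x\<close> shows that it is at most \<open>2 L n h\<close> below. As \<open>- |x - p k|\<close> is
  a minimum of \<open>2 ^ n\<close> affine functions, one for each sign pattern, the approximant is a maximum of
  minima of affine functions. Two ReLU layers halve the number of candidates of such a selection,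
  so the depth is logarithmic and the size linear in the number of grid points
  (\<open>relu_net_max_min\<close>, \<open>lipschitz_relu_approx\<close>). With \<open>h\<close> of order \<open>\<tau> / (n * sqrt m)\<close> this gives the
  stated size (\<open>stacked_network_approx\<close>). It applies for \<open>\<tau> \<le> 2 * M\<close>; for larger \<open>\<tau>\<close> the network
  without any weight is good enough, because \<open>\<tau>\<^sup>2\<close> then exceeds a fixed multiple of the second
  moment of \<open>\<Psi>\<close>.

  \<^emph>\<open>The PCA residuals.\<close> By Pythagoras, the residual of a subspace is small when the energy that
  it captures is large. The leading eigenvectors of the empirical covariance maximise the captured
  energy of the sample among all orthonormal families of the same length (\<open>ky_fan\<close>). Hence the
  excess of their residual over that of a competitor is at most twice the largest deviation
  between sample energy and expected energy. To bound this deviation, the expected energy is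
  written as a mean over a second, independent sample. The difference of the energies of two
  samples is the trace of the difference of two second moment operators on a \<open>d\<close>-dimensional
  space, so that it is at most \<open>sqrt d\<close> times its Hilbert--Schmidt norm
  (\<open>energy_difference_le_gram_gap\<close>). The square of this norm is a polynomial in the inner products
  of the sample points. It does not mention the orthonormal family, it is measurable in the data,
  and its expectation is of order \<open>N\<close>, because the terms of distinct sample points cancel
  (\<open>expected_gram_gap\<close>). This yields the rate \<open>sqrt (d / N)\<close> (\<open>pca_excess_risk\<close>). Measurability of
  the bound is essential: the eigenvectors and the network may depend on the data in any way, and
  the expectation over the data is an upper integral.
\<close>

section \<open>ReLU networks for maxima of minima\<close>

lemma nnz_mat_le_rows:
  assumes "\<And>i. i < dim_row W \<Longrightarrow> card {j. j < dim_col W \<and> W $$ (i, j) \<noteq> 0} \<le> k"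
  shows "nnz_mat W \<le> dim_row W * k"
proof -
  have "{(i, j). i < dim_row W \<and> j < dim_col W \<and> W $$ (i, j) \<noteq> 0}
      = (SIGMA i:{..<dim_row W}. {j. j < dim_col W \<and> W $$ (i, j) \<noteq> 0})"
    by auto
  then have "nnz_mat W = (\<Sum>i<dim_row W. card {j. j < dim_col W \<and> W $$ (i, j) \<noteq> 0})"
    unfolding nnz_mat_def by (simp add: card_SigmaI)
  also have "\<dots> \<le> dim_row W * k"
    using sum_bounded_above[of "{..<dim_row W}" "\<lambda>i. card {j. j < dim_col W \<and> W $$ (i, j) \<noteq> 0}" k] assms
    by simp
  finally show ?thesis .
qed

lemma nnz_mat_le_dims: "nnz_mat W \<le> dim_row W * dim_col W"
proof (rule nnz_mat_le_rows)
  fix i show "card {j. j < dim_col W \<and> W $$ (i, j) \<noteq> 0} \<le> dim_col W"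
    using card_mono[of "{..<dim_col W}" "{j. j < dim_col W \<and> W $$ (i, j) \<noteq> 0}"] by auto
qed

lemma nnz_vec_le_dim: "nnz_vec b \<le> dim_vec b"
  unfolding nnz_vec_def
  using card_mono[of "{..<dim_vec b}" "{i. i < dim_vec b \<and> vec_index b i \<noteq> 0}"] by auto

lemma nnz_vec_zero [simp]: "nnz_vec (0\<^sub>v n) = 0"
proof -
  have "{i. i < dim_vec (0\<^sub>v n :: real Matrix.vec) \<and> vec_index (0\<^sub>v n :: real Matrix.vec) i \<noteq> 0} = {}"
    by auto
  then show ?thesis unfolding nnz_vec_def by (simp only: card.empty)
qed

lemma net_size_simps [simp]:
  "net_size [] = 0"
  "net_size ((W, b) # ls) = nnz_mat W + nnz_vec b + net_size ls"
  "net_size (ls @ ls') = net_size ls + net_size ls'"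
  unfolding net_size_def by auto

lemma net_eval_Cons:
  "ls \<noteq> [] \<Longrightarrow> net_eval ((W, b) # ls) s = net_eval ls (map_vec relu (W *\<^sub>v s + b))"
  by (cases ls) auto

text \<open>
  A selection that a single hidden layer can compute: the maximum of \<open>a\<close> and \<open>b\<close> for \<open>c = 1\<close>, and
  their minimum for \<open>c = - 1\<close>.
\<close>
definition pick :: "real \<Rightarrow> real \<Rightarrow> real \<Rightarrow> real" where
  "pick c a b = a + c * relu (c * (b - a))"

lemma pick_max:
  assumes "\<bar>c\<bar> = 1"
  shows "c * pick c a b = max (c * a) (c * b)"
proof -
  have "c = 1 \<or> c = -1" using assms by auto
  then show ?thesis by (auto simp: pick_def relu_def max_def)
qed

lemma pick_cases: "\<bar>c\<bar> = 1 \<Longrightarrow> pick c a b = a \<or> pick c a b = b"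
  by (auto simp: pick_def relu_def max_def abs_if split: if_splits)

text \<open>
  A round of the tournament compares entry \<open>i\<close> with entry \<open>i + m\<close>. The first matrix produces \<open>v i\<close> and
  \<open>c * (v (i + m) - v i)\<close>. After the activation, the second one adds \<open>c\<close> times the latter to the former.
\<close>
definition compare_mat :: "real \<Rightarrow> nat \<Rightarrow> real Matrix.mat" where
  "compare_mat c m = mat (2 * m) (2 * m) (\<lambda>(i, j).
     if i < m then (if j = i then 1 else 0)
     else (if j = i then c else if j = i - m then - c else 0))"

definition combine_mat :: "real \<Rightarrow> nat \<Rightarrow> real Matrix.mat" where
  "combine_mat c m = mat m (2 * m) (\<lambda>(i, j). if j = i then 1 else if j = i + m then c else 0)"

lemma compare_combine_dims [simp]:
  "dim_row (compare_mat c m) = 2 * m" "dim_col (compare_mat c m) = 2 * m"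
  "dim_row (combine_mat c m) = m" "dim_col (combine_mat c m) = 2 * m"
  by (auto simp: compare_mat_def combine_mat_def)

lemma nnz_compare_mat: "nnz_mat (compare_mat c m) \<le> 4 * m"
proof -
  have "nnz_mat (compare_mat c m) \<le> dim_row (compare_mat c m) * 2"
  proof (rule nnz_mat_le_rows)
    fix i assume "i < dim_row (compare_mat c m)"
    then have "{j. j < dim_col (compare_mat c m) \<and> compare_mat c m $$ (i, j) \<noteq> 0} \<subseteq> {i, i - m}"
      by (auto simp: compare_mat_def split: if_splits)
    from card_mono[OF _ this] show "card {j. j < dim_col (compare_mat c m) \<and> compare_mat c m $$ (i, j) \<noteq> 0} \<le> 2"
      using card_insert_le_m1[of 2 "{i - m}" i] by auto
  qed
  then show ?thesis by simp
qed

lemma nnz_combine_mat: "nnz_mat (combine_mat c m) \<le> 2 * m"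
proof -
  have "nnz_mat (combine_mat c m) \<le> dim_row (combine_mat c m) * 2"
  proof (rule nnz_mat_le_rows)
    fix i assume "i < dim_row (combine_mat c m)"
    then have "{j. j < dim_col (combine_mat c m) \<and> combine_mat c m $$ (i, j) \<noteq> 0} \<subseteq> {i, i + m}"
      by (auto simp: combine_mat_def split: if_splits)
    from card_mono[OF _ this] show "card {j. j < dim_col (combine_mat c m) \<and> combine_mat c m $$ (i, j) \<noteq> 0} \<le> 2"
      using card_insert_le_m1[of 2 "{i + m}" i] by auto
  qed
  then show ?thesis by simp
qed

lemma mult_mat_vec_index_sum:
  assumes "i < dim_row W" "dim_vec v = dim_col W"
  shows "vec_index (W *\<^sub>v v) i = (\<Sum>j<dim_col W. W $$ (i, j) * vec_index v j)"
  using assms by (simp add: scalar_prod_def lessThan_atLeast0)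

lemma compare_mat_mult:
  assumes "v \<in> carrier_vec (2 * m)" "i < m"
  shows "vec_index (compare_mat c m *\<^sub>v v) i = vec_index v i"
    and "vec_index (compare_mat c m *\<^sub>v v) (i + m) = c * (vec_index v (i + m) - vec_index v i)"
proof -
  have d: "dim_vec v = 2 * m" using assms by simp
  have "vec_index (compare_mat c m *\<^sub>v v) i = (\<Sum>j<2*m. compare_mat c m $$ (i, j) * vec_index v j)"
    using assms d mult_mat_vec_index_sum[of i "compare_mat c m" v] by simp
  also have "\<dots> = (\<Sum>j<2*m. if j = i then vec_index v j else 0)"
    using assms(2) by (intro sum.cong) (auto simp: compare_mat_def)
  finally show "vec_index (compare_mat c m *\<^sub>v v) i = vec_index v i"
    using assms by simp
  have "vec_index (compare_mat c m *\<^sub>v v) (i + m)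
      = (\<Sum>j<2*m. compare_mat c m $$ (i + m, j) * vec_index v j)"
    using assms d mult_mat_vec_index_sum[of "i + m" "compare_mat c m" v] by simp
  also have "\<dots> = (\<Sum>j<2*m. (if j = i + m then c * vec_index v j else 0)
      + (if j = i then - c * vec_index v j else 0))"
    using assms(2) by (intro sum.cong) (auto simp: compare_mat_def)
  also have "\<dots> = c * (vec_index v (i + m) - vec_index v i)"
    using assms by (simp add: sum.distrib algebra_simps)
  finally show "vec_index (compare_mat c m *\<^sub>v v) (i + m) = c * (vec_index v (i + m) - vec_index v i)" .
qed

lemma combine_mat_mult:
  assumes "v \<in> carrier_vec (2 * m)" "i < m"
  shows "vec_index (combine_mat c m *\<^sub>v v) i = vec_index v i + c * vec_index v (i + m)"
proof -
  have d: "dim_vec v = 2 * m" using assms by simp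
  have "vec_index (combine_mat c m *\<^sub>v v) i = (\<Sum>j<2*m. combine_mat c m $$ (i, j) * vec_index v j)"
    using assms d mult_mat_vec_index_sum[of i "combine_mat c m" v] by simp
  also have "\<dots> = (\<Sum>j<2*m. (if j = i then vec_index v j else 0)
      + (if j = i + m then c * vec_index v j else 0))"
    using assms(2) by (intro sum.cong) (auto simp: combine_mat_def)
  also have "\<dots> = vec_index v i + c * vec_index v (i + m)"
    using assms by (simp add: sum.distrib)
  finally show ?thesis .
qed

text \<open>
  A tournament among \<open>2 ^ l\<close> blocks of length \<open>K\<close>: the \<open>k\<close>-th entry of the result is selected among
  the \<open>k\<close>-th entries of all blocks. Entries are paired at half the length of the vector, so that
  blocks are paired with blocks, and no index arithmetic is needed within a block.
\<close>
fun tree_layers :: "real \<Rightarrow> nat \<Rightarrow> nat \<Rightarrow> layer list" where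
  "tree_layers c 0 K = []"
| "tree_layers c (Suc l) K =
     (compare_mat c (2 ^ l * K), 0\<^sub>v (2 * (2 ^ l * K))) #
     (combine_mat c (2 ^ l * K), 0\<^sub>v (2 ^ l * K)) # tree_layers c l K"

definition pick_vec :: "real \<Rightarrow> nat \<Rightarrow> real Matrix.vec \<Rightarrow> real Matrix.vec" where
  "pick_vec c m v = Matrix.vec m (\<lambda>i. pick c (vec_index v i) (vec_index v (i + m)))"

fun tree_val :: "real \<Rightarrow> nat \<Rightarrow> nat \<Rightarrow> real Matrix.vec \<Rightarrow> real Matrix.vec" where
  "tree_val c 0 K v = v"
| "tree_val c (Suc l) K v = tree_val c l K (pick_vec c (2 ^ l * K) v)"

lemma length_tree_layers [simp]: "length (tree_layers c l K) = 2 * l"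
  by (induction l) auto

lemma net_size_tree_layers: "net_size (tree_layers c l K) \<le> 6 * (2 ^ l * K)"
proof (induction l)
  case (Suc l)
  then show ?case
    using nnz_compare_mat[of c "2 ^ l * K"] nnz_combine_mat[of c "2 ^ l * K"] by simp
qed auto

lemma net_dims_tree_step:
  assumes "net_dims m ls d"
  shows "net_dims (2 * m) ((compare_mat c m, 0\<^sub>v (2 * m)) # (combine_mat c m, 0\<^sub>v m) # ls) d"
  using assms unfolding net_dims.simps compare_combine_dims
  by (intro conjI carrier_matI zero_carrier_vec) auto

lemma net_dims_tree_layers:
  assumes "net_dims K rest m"
  shows "net_dims (2 ^ l * K) (tree_layers c l K @ rest) m"
proof (induction l)
  case 0
  show ?case using assms by simp
next
  case (Suc l)
  show ?case
    using net_dims_tree_step[OF Suc.IH, of c]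
    unfolding tree_layers.simps append_Cons power_Suc mult.assoc .
qed

text \<open>
  All entries are nonnegative, so the activation leaves the copied entries and the selected
  entries unchanged, and acts only on the differences.
\<close>
lemma tree_step_eval:
  assumes "v \<in> carrier_vec (2 * m)" "\<And>i. i < 2 * m \<Longrightarrow> 0 \<le> vec_index v i" "\<bar>c\<bar> = 1"
  shows "map_vec relu (combine_mat c m *\<^sub>v
           map_vec relu (compare_mat c m *\<^sub>v v + 0\<^sub>v (2 * m)) + 0\<^sub>v m) = pick_vec c m v"
    (is "map_vec relu (_ *\<^sub>v ?u + _) = _")
proof (rule eq_vecI)
  fix i assume "i < dim_vec (pick_vec c m v)"
  then have i: "i < m" by (simp add: pick_vec_def)
  have u: "?u \<in> carrier_vec (2 * m)" by (intro carrier_vecI) simp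
  have "vec_index ?u i = relu (vec_index v i)"
    using i compare_mat_mult(1)[OF assms(1) i] by (simp del: index_mult_mat_vec)
  also have "\<dots> = vec_index v i" using assms(2)[of i] i by (simp add: relu_def)
  finally have 1: "vec_index ?u i = vec_index v i" .
  have 2: "vec_index ?u (i + m) = relu (c * (vec_index v (i + m) - vec_index v i))"
    using i compare_mat_mult(2)[OF assms(1) i] by (simp del: index_mult_mat_vec)
  have *: "vec_index (combine_mat c m *\<^sub>v ?u) i = pick c (vec_index v i) (vec_index v (i + m))"
    unfolding combine_mat_mult[OF u i] 1 2 pick_def ..
  have "0 \<le> pick c (vec_index v i) (vec_index v (i + m))"
    using pick_cases[OF assms(3), of "vec_index v i" "vec_index v (i + m)"]
      assms(2)[of i] assms(2)[of "i + m"] i by auto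
  then have "relu (vec_index (combine_mat c m *\<^sub>v ?u) i) = vec_index (pick_vec c m v) i"
    using i unfolding * by (simp add: pick_vec_def relu_def)
  then show "vec_index (map_vec relu (combine_mat c m *\<^sub>v ?u + 0\<^sub>v m)) i = vec_index (pick_vec c m v) i"
    using i by (simp del: index_mult_mat_vec)
qed (simp add: pick_vec_def)

lemma pick_vec_nonneg:
  assumes "\<And>i. i < 2 * m \<Longrightarrow> 0 \<le> vec_index v i" "\<bar>c\<bar> = 1" "i < m"
  shows "0 \<le> vec_index (pick_vec c m v) i"
  using pick_cases[OF assms(2), of "vec_index v i" "vec_index v (i + m)"]
    assms(1)[of i] assms(1)[of "i + m"] assms(3) by (auto simp: pick_vec_def)

text \<open>
  The layers are followed by \<open>rest\<close> because the activation sits between consecutive layers, and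
  the last layer of a network carries none. Selection is described by a bound and its attainment;
  the factor \<open>c\<close> makes one inequality serve for maxima and minima.
\<close>
lemma tree_layers_eval:
  assumes c: "\<bar>c\<bar> = 1" and "rest \<noteq> []"
    and "v \<in> carrier_vec (2 ^ l * K)" "\<And>i. i < 2 ^ l * K \<Longrightarrow> 0 \<le> vec_index v i"
  shows "net_eval (tree_layers c l K @ rest) v = net_eval rest (tree_val c l K v) \<and>
    tree_val c l K v \<in> carrier_vec K \<and>
    (\<forall>k<K. 0 \<le> vec_index (tree_val c l K v) k \<and>
      (\<forall>s<2 ^ l. c * vec_index v (s * K + k) \<le> c * vec_index (tree_val c l K v) k) \<and>
      (\<exists>s<2 ^ l. vec_index (tree_val c l K v) k = vec_index v (s * K + k)))"
  using assms(3,4)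
proof (induction l arbitrary: v)
  case 0
  have "\<exists>s<2 ^ 0. vec_index v k = vec_index v (s * K + k)" for k
    by (rule exI[of _ 0]) simp
  with 0 show ?case by simp
next
  case (Suc l)
  let ?m = "2 ^ l * K"
  define w where "w = pick_vec c ?m v"
  have v: "v \<in> carrier_vec (2 * ?m)" "\<And>i. i < 2 * ?m \<Longrightarrow> 0 \<le> vec_index v i"
    using Suc.prems by (auto simp: mult.assoc)
  have w: "w \<in> carrier_vec ?m" "\<And>i. i < ?m \<Longrightarrow> 0 \<le> vec_index w i"
    using pick_vec_nonneg[OF v(2) c] by (auto simp: w_def pick_vec_def)
  note IH = Suc.IH[OF w]
  have idx: "s * K + k < ?m" if "s < 2 ^ l" "k < K" for s k
  proof -
    have "s * K + k < Suc s * K" using that by simp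
    also have "\<dots> \<le> ?m" using that by (intro mult_le_mono1) auto
    finally show ?thesis .
  qed
  have step: "net_eval (tree_layers c (Suc l) K @ rest) v = net_eval (tree_layers c l K @ rest) w"
    using assms(2) tree_step_eval[OF v c] by (simp add: net_eval_Cons w_def)
  have tv: "tree_val c (Suc l) K v = tree_val c l K w" by (simp add: w_def)
  have "0 \<le> vec_index (tree_val c l K w) k \<and>
      (\<forall>s<2 ^ Suc l. c * vec_index v (s * K + k) \<le> c * vec_index (tree_val c l K w) k) \<and>
      (\<exists>s<2 ^ Suc l. vec_index (tree_val c l K w) k = vec_index v (s * K + k))" if k: "k < K" for k
  proof (intro conjI allI impI)
    show "0 \<le> vec_index (tree_val c l K w) k" using IH k by blast
  next
    fix s :: nat assume s: "s < 2 ^ Suc l"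
    define s' where "s' = (if s < 2 ^ l then s else s - 2 ^ l)"
    have s': "s' < 2 ^ l" using s by (auto simp: s'_def)
    have "s = s' \<or> s = s' + 2 ^ l" by (auto simp: s'_def)
    then have "vec_index v (s * K + k) \<in> {vec_index v (s' * K + k), vec_index v (s' * K + k + ?m)}"
      by (auto simp: algebra_simps)
    then have "c * vec_index v (s * K + k) \<le> c * vec_index w (s' * K + k)"
      using idx[OF s' k] pick_max[OF c] by (auto simp: pick_vec_def w_def)
    also have "\<dots> \<le> c * vec_index (tree_val c l K w) k"
      using IH k s' by blast
    finally show "c * vec_index v (s * K + k) \<le> c * vec_index (tree_val c l K w) k" .
  next
    obtain s where s: "s < 2 ^ l" "vec_index (tree_val c l K w) k = vec_index w (s * K + k)"
      using IH k by blast
    have "vec_index w (s * K + k) = vec_index v (s * K + k)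
        \<or> vec_index w (s * K + k) = vec_index v (s * K + k + ?m)"
      using idx[OF s(1) k] pick_cases[OF c] by (auto simp: pick_vec_def w_def)
    moreover have "s * K + k + ?m = (s + 2 ^ l) * K + k" by (simp add: algebra_simps)
    moreover have "s < 2 ^ Suc l" "s + 2 ^ l < 2 ^ Suc l" using s by auto
    ultimately show "\<exists>s<2 ^ Suc l. vec_index (tree_val c l K w) k = vec_index v (s * K + k)"
      unfolding s(2) by metis
  qed
  then show ?case unfolding step tv using IH by blast
qed

text \<open>
  The first layer evaluates all affine functions, shifted by \<open>B\<close> so that they are nonnegative on \<open>S\<close>.
  Then come a tournament of minima over \<open>2 ^ l\<close> blocks, a tournament of maxima within the remaining
  block of length \<open>2 ^ q\<close>, and an output layer that removes the shift.
\<close>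
lemma relu_net_max_min:
  fixes w :: "nat \<Rightarrow> nat \<Rightarrow> real" and b :: "nat \<Rightarrow> real" and n :: nat
  defines "leaf \<equiv> \<lambda>x r. (\<Sum>i<n. w r i * vec_index x i) + b r"
  assumes S: "S \<subseteq> carrier_vec n" "\<And>x r. x \<in> S \<Longrightarrow> r < 2 ^ l * 2 ^ q \<Longrightarrow> 0 \<le> leaf x r + B"
  shows "\<exists>g\<in>relu_nets n (2 * l + 2 * q + 2) (2 ^ l * 2 ^ q * (n + 15)). \<forall>x\<in>S. \<exists>m.
    (\<forall>k<2 ^ q. (\<forall>s<2 ^ l. m k \<le> leaf x (s * 2 ^ q + k)) \<and> (\<exists>s<2 ^ l. m k = leaf x (s * 2 ^ q + k))
       \<and> m k \<le> g x) \<and> (\<exists>k<2 ^ q. g x = m k)"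
proof -
  let ?R = "2 ^ l * 2 ^ q :: nat"
  define W where "W = mat ?R n (\<lambda>(r, i). w r i)"
  define a where "a = Matrix.vec ?R (\<lambda>r. b r + B)"
  define fin :: layer where "fin = (mat 1 1 (\<lambda>_. 1), Matrix.vec 1 (\<lambda>_. - B))"
  define ls where "ls = (W, a) # tree_layers (-1) l (2 ^ q) @ tree_layers 1 q 1 @ [fin]"
  define g where "g = (\<lambda>x. vec_index (net_eval ls x) 0)"
  have [simp]: "dim_row W = ?R" "dim_col W = n" "dim_vec a = ?R" by (auto simp: W_def a_def)
  have "net_size ls \<le> ?R * n + ?R + 6 * ?R + 6 * 2 ^ q + 2"
  proof -
    have "nnz_mat W \<le> ?R * n" "nnz_vec a \<le> ?R"
      using nnz_mat_le_dims[of W] nnz_vec_le_dim[of a] by auto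
    moreover have "net_size [fin] \<le> 2"
      using nnz_mat_le_dims[of "fst fin"] nnz_vec_le_dim[of "snd fin"] by (simp add: fin_def)
    ultimately show ?thesis
      using net_size_tree_layers[of "-1" l "2 ^ q"] net_size_tree_layers[of 1 q 1]
      by (simp add: ls_def)
  qed
  also have "\<dots> \<le> ?R * (n + 15)"
  proof -
    have "(2::nat) ^ q \<le> ?R" "1 \<le> ?R" by auto
    then show ?thesis unfolding distrib_left by linarith
  qed
  finally have size: "net_size ls \<le> ?R * (n + 15)" .
  have "net_dims (2 ^ q * 1) (tree_layers 1 q 1 @ [fin]) 1"
    by (rule net_dims_tree_layers) (auto simp: fin_def)
  then have dims: "net_dims n ls 1"
    using net_dims_tree_layers[of "2 ^ q" "tree_layers 1 q 1 @ [fin]" 1 l "-1"]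
    unfolding ls_def net_dims.simps by (intro conjI carrier_matI carrier_vecI) auto
  have "g \<in> relu_nets n (2 * l + 2 * q + 2) (?R * (n + 15))"
    unfolding relu_nets_def using size dims by (auto simp: g_def ls_def intro!: exI[of _ ls])
  moreover have "\<exists>m.
    (\<forall>k<2 ^ q. (\<forall>s<2 ^ l. m k \<le> leaf x (s * 2 ^ q + k)) \<and> (\<exists>s<2 ^ l. m k = leaf x (s * 2 ^ q + k))
       \<and> m k \<le> g x) \<and> (\<exists>k<2 ^ q. g x = m k)" if x: "x \<in> S" for x
  proof -
    define v where "v = Matrix.vec ?R (\<lambda>r. leaf x r + B)"
    have xc: "x \<in> carrier_vec n" using x S by auto
    have v: "map_vec relu (W *\<^sub>v x + a) = v"
    proof (rule eq_vecI)
      fix r assume "r < dim_vec v"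
      then have r: "r < ?R" by (simp add: v_def)
      have "vec_index (W *\<^sub>v x) r = (\<Sum>i<n. w r i * vec_index x i)"
        using r xc by (subst mult_mat_vec_index_sum) (auto simp: W_def)
      then show "vec_index (map_vec relu (W *\<^sub>v x + a)) r = vec_index v r"
        using r S(2)[OF x r] by (simp add: a_def v_def leaf_def relu_def add.assoc del: index_mult_mat_vec)
    qed (simp add: v_def)
    have vc: "v \<in> carrier_vec (2 ^ l * 2 ^ q)" by (simp add: v_def)
    have v0: "\<And>i. i < ?R \<Longrightarrow> 0 \<le> vec_index v i" using S(2)[OF x] by (simp add: v_def)
    define u where "u = tree_val (-1) l (2 ^ q) v"
    have T: "net_eval (tree_layers (-1) l (2 ^ q) @ tree_layers 1 q 1 @ [fin]) v
        = net_eval (tree_layers 1 q 1 @ [fin]) u"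
      "u \<in> carrier_vec (2 ^ q)" "\<And>k. k < 2 ^ q \<Longrightarrow> 0 \<le> vec_index u k"
      "\<And>k s. k < 2 ^ q \<Longrightarrow> s < 2 ^ l \<Longrightarrow> vec_index u k \<le> vec_index v (s * 2 ^ q + k)"
      "\<And>k. k < 2 ^ q \<Longrightarrow> \<exists>s<2 ^ l. vec_index u k = vec_index v (s * 2 ^ q + k)"
      using tree_layers_eval[OF _ _ vc v0, of "-1" "tree_layers 1 q 1 @ [fin]", folded u_def] by auto
    define z where "z = tree_val 1 q 1 u"
    have U: "net_eval (tree_layers 1 q 1 @ [fin]) u = net_eval [fin] z"
      "z \<in> carrier_vec 1"
      "\<And>k. k < 2 ^ q \<Longrightarrow> vec_index u k \<le> vec_index z 0"
      "\<exists>k<2 ^ q. vec_index z 0 = vec_index u k"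
      using tree_layers_eval[of 1 "[fin]" u q 1, folded z_def] T(2,3) by auto
    have idx: "s * 2 ^ q + k < ?R" if "s < 2 ^ l" "k < 2 ^ q" for s k :: nat
    proof -
      have "s * 2 ^ q + k < Suc s * 2 ^ q" using that by simp
      also have "\<dots> \<le> ?R" using that by (intro mult_le_mono1) auto
      finally show ?thesis .
    qed
    have "net_eval ls x = net_eval (tree_layers (-1) l (2 ^ q) @ tree_layers 1 q 1 @ [fin]) v"
      unfolding ls_def v[symmetric] by (rule net_eval_Cons) simp
    also have "\<dots> = net_eval [fin] z" using T(1) U(1) by simp
    finally have g: "g x = vec_index z 0 - B"
      using U(2) by (simp add: g_def fin_def scalar_prod_def)
    have "\<forall>k<2 ^ q. (\<forall>s<2 ^ l. vec_index u k - B \<le> leaf x (s * 2 ^ q + k))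
       \<and> (\<exists>s<2 ^ l. vec_index u k - B = leaf x (s * 2 ^ q + k)) \<and> vec_index u k - B \<le> g x"
    proof (intro allI impI conjI)
      fix k s :: nat assume k: "k < 2 ^ q" and s: "s < 2 ^ l"
      show "vec_index u k - B \<le> leaf x (s * 2 ^ q + k)"
        using T(4)[OF k s] idx[OF s k] by (simp add: v_def)
    next
      fix k :: nat assume k: "k < 2 ^ q"
      show "\<exists>s<2 ^ l. vec_index u k - B = leaf x (s * 2 ^ q + k)"
        using T(5)[OF k] idx k by (auto simp: v_def)
      show "vec_index u k - B \<le> g x" using U(3)[OF k] by (simp add: g)
    qed
    moreover have "\<exists>k<2 ^ q. g x = vec_index u k - B" using U(4) by (auto simp: g)
    ultimately show ?thesis by (intro exI[of _ "\<lambda>k. vec_index u k - B"]) blast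
  qed
  ultimately show ?thesis by blast
qed

section \<open>Approximation of Lipschitz functions\<close>

lemma near_grid_index:
  fixes y :: real
  assumes "0 \<le> y" "y \<le> real m" "0 < m"
  shows "\<exists>d<m. \<bar>y - real d\<bar> \<le> 1"
proof (cases "y < real m")
  case True
  then show ?thesis using assms by (intro exI[of _ "nat \<lfloor>y\<rfloor>"]) (simp; linarith)
next
  case False
  then show ?thesis using assms by (intro exI[of _ "m - 1"]) (simp add: of_nat_diff)
qed

text \<open>
  The approximant is \<open>MAX k. f (pt k) - L * |x - pt k|\<close> with the \<open>\<ell>\<^sup>1\<close> norm, where \<open>pt\<close> enumerates a
  grid with \<open>2 ^ p\<close> points in each direction. It lies below \<open>f\<close> by the Lipschitz condition, and the
  term of a grid point close to \<open>x\<close> is within twice the Lipschitz bound of \<open>f x\<close>.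
\<close>
lemma lipschitz_relu_approx:
  fixes f :: "real Matrix.vec \<Rightarrow> real" and n p :: nat
  assumes M: "0 < M" and L: "0 \<le> L"
    and lip: "\<And>x y. x \<in> carrier_vec n \<Longrightarrow> y \<in> carrier_vec n \<Longrightarrow>
      \<bar>f x - f y\<bar> \<le> L * (\<Sum>i<n. \<bar>vec_index x i - vec_index y i\<bar>)"
  shows "\<exists>g\<in>relu_nets n (2 * n + 2 * (p * n) + 2) (2 ^ n * 2 ^ (p * n) * (n + 15)).
    \<forall>x\<in>cube n M. \<bar>g x - f x\<bar> \<le> 2 * (L * (real n * (2 * M / 2 ^ p)))"
proof -
  define h where "h = 2 * M / 2 ^ p"
  have h: "0 < h" "2 ^ p * h = 2 * M" using M by (auto simp: h_def)
  define q where "q = p * n"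
  define G where "G = {..<n} \<rightarrow>\<^sub>E {..<2 ^ p :: nat}"
  have "finite G" "card G = 2 ^ q"
    by (auto simp: G_def q_def card_PiE power_mult intro!: finite_PiE)
  then obtain \<gamma> :: "nat \<Rightarrow> nat \<Rightarrow> nat" where \<gamma>: "bij_betw \<gamma> {..<2 ^ q} G"
    using ex_bij_betw_nat_finite[of G] by (auto simp: lessThan_atLeast0)
  have "finite (Pow {..<n})" "card (Pow {..<n}) = 2 ^ n" by (auto simp: card_Pow)
  then obtain \<sigma> :: "nat \<Rightarrow> nat set" where \<sigma>: "bij_betw \<sigma> {..<2 ^ n} (Pow {..<n})"
    using ex_bij_betw_nat_finite[of "Pow {..<n}"] by (auto simp: lessThan_atLeast0)
  define pt where "pt k = Matrix.vec n (\<lambda>i. - M + real (\<gamma> k i) * h)" for k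
  \<comment> \<open>\<open>\<sigma>\<close> enumerates the sign patterns: the sign is positive on the set \<open>\<sigma> s\<close>.\<close>
  define sg :: "nat \<Rightarrow> nat \<Rightarrow> real" where "sg s i = (if i \<in> \<sigma> s then 1 else -1)" for s i
  define w where "w r i = - L * sg (r div 2 ^ q) i" for r i
  define b where "b r = f (pt (r mod 2 ^ q))
      + L * (\<Sum>i<n. sg (r div 2 ^ q) i * vec_index (pt (r mod 2 ^ q)) i)" for r
  define B where "B = (\<Sum>k<2 ^ q. \<bar>f (pt k)\<bar>) + L * (real n * (2 * M))"
  define leaf where "leaf x r = (\<Sum>i<n. w r i * vec_index x i) + b r" for x r
  define D where "D x k = (\<Sum>i<n. \<bar>vec_index x i - vec_index (pt k) i\<bar>)" for x k
  have pt_c: "pt k \<in> carrier_vec n" for k by (simp add: pt_def)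
  have pt_cube: "pt k \<in> cube n M" if "k < 2 ^ q" for k
  proof -
    have "\<gamma> k \<in> G" using \<gamma> that by (auto simp: bij_betw_def)
    have "real (\<gamma> k i) * h \<in> {0..2 * M}" if "i < n" for i
    proof -
      have "\<gamma> k i < 2 ^ p" using \<open>\<gamma> k \<in> G\<close> that by (auto simp: G_def)
      then have "real (\<gamma> k i) \<le> real (2 ^ p)" by (simp only: of_nat_le_iff less_imp_le)
      then have "real (\<gamma> k i) \<le> 2 ^ p" by simp
      then have "real (\<gamma> k i) * h \<le> 2 ^ p * h" using h(1) by (intro mult_right_mono) auto
      then have "real (\<gamma> k i) * h \<le> 2 * M" unfolding h(2) .
      moreover have "0 \<le> real (\<gamma> k i) * h" using h(1) by simp
      ultimately show ?thesis by simp
    qed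
    then show ?thesis by (auto simp: cube_def pt_def)
  qed
  have leaf: "leaf x r = f (pt (r mod 2 ^ q))
      - L * (\<Sum>i<n. sg (r div 2 ^ q) i * (vec_index x i - vec_index (pt (r mod 2 ^ q)) i))" for x r
    by (simp add: leaf_def w_def b_def right_diff_distrib sum_subtractf sum_distrib_left
        sum_negf mult.assoc)
  have leaf_ge: "f (pt (r mod 2 ^ q)) - L * D x (r mod 2 ^ q) \<le> leaf x r" for x r
    unfolding leaf D_def using L
    by (intro diff_mono order_refl mult_left_mono sum_mono) (auto simp: sg_def)
  have "\<exists>g\<in>relu_nets n (2 * n + 2 * q + 2) (2 ^ n * 2 ^ q * (n + 15)). \<forall>x\<in>cube n M. \<exists>m.
    (\<forall>k<2 ^ q. (\<forall>s<2 ^ n. m k \<le> leaf x (s * 2 ^ q + k)) \<and> (\<exists>s<2 ^ n. m k = leaf x (s * 2 ^ q + k))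
       \<and> m k \<le> g x) \<and> (\<exists>k<2 ^ q. g x = m k)"
    unfolding leaf_def
  proof (rule relu_net_max_min, unfold leaf_def[symmetric])
    show "cube n M \<subseteq> carrier_vec n" by (auto simp: cube_def)
  next
    fix x and r :: nat assume x: "x \<in> cube n M" and "r < 2 ^ n * 2 ^ q"
    let ?k = "r mod 2 ^ q"
    have k: "?k < 2 ^ q" by simp
    have "D x ?k \<le> (\<Sum>i<n. 2 * M)"
      unfolding D_def
    proof (rule sum_mono)
      fix i assume "i \<in> {..<n}"
      then have "vec_index x i \<in> {-M..M}" "vec_index (pt ?k) i \<in> {-M..M}"
        using x pt_cube[OF k] by (auto simp: cube_def)
      then show "\<bar>vec_index x i - vec_index (pt ?k) i\<bar> \<le> 2 * M" by auto
    qed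
    then have "L * D x ?k \<le> L * (real n * (2 * M))" using L by (intro mult_left_mono) auto
    moreover have "\<bar>f (pt ?k)\<bar> \<le> (\<Sum>k<2 ^ q. \<bar>f (pt k)\<bar>)"
      using k by (intro member_le_sum) auto
    ultimately show "0 \<le> leaf x r + B" using leaf_ge[of r x] by (simp add: B_def)
  qed
  then obtain g where g: "g \<in> relu_nets n (2 * n + 2 * q + 2) (2 ^ n * 2 ^ q * (n + 15))"
    and gm: "\<forall>x\<in>cube n M. \<exists>m.
    (\<forall>k<2 ^ q. (\<forall>s<2 ^ n. m k \<le> leaf x (s * 2 ^ q + k)) \<and> (\<exists>s<2 ^ n. m k = leaf x (s * 2 ^ q + k))
       \<and> m k \<le> g x) \<and> (\<exists>k<2 ^ q. g x = m k)" by (rule bexE)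
  have digits: "(s * 2 ^ q + k) div 2 ^ q = s" "(s * 2 ^ q + k) mod 2 ^ q = k" if "k < 2 ^ q" for s k :: nat
    using that by auto
  have "\<bar>g x - f x\<bar> \<le> 2 * (L * (real n * h))" if x: "x \<in> cube n M" for x
  proof -
    have xc: "x \<in> carrier_vec n" using x by (simp add: cube_def)
    obtain m where m: "\<And>k s. k < 2 ^ q \<Longrightarrow> s < 2 ^ n \<Longrightarrow> m k \<le> leaf x (s * 2 ^ q + k)"
      "\<And>k. k < 2 ^ q \<Longrightarrow> \<exists>s<2 ^ n. m k = leaf x (s * 2 ^ q + k)"
      "\<And>k. k < 2 ^ q \<Longrightarrow> m k \<le> g x" "\<exists>k<2 ^ q. g x = m k"
      using bspec[OF gm x] by blast
    have m_eq: "m k = f (pt k) - L * D x k" if k: "k < 2 ^ q" for k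
    proof (rule antisym)
      \<comment> \<open>The minimum over sign patterns is attained where all signs agree with those of \<open>x - pt k\<close>.\<close>
      have "{i. i < n \<and> vec_index (pt k) i \<le> vec_index x i} \<in> \<sigma> ` {..<2 ^ n}"
        using \<sigma> by (auto simp: bij_betw_def)
      then obtain s where s: "s < 2 ^ n" "\<sigma> s = {i. i < n \<and> vec_index (pt k) i \<le> vec_index x i}"
        by auto
      have "(\<Sum>i<n. sg s i * (vec_index x i - vec_index (pt k) i)) = D x k"
        unfolding D_def by (rule sum.cong) (auto simp: sg_def s(2))
      then have "leaf x (s * 2 ^ q + k) = f (pt k) - L * D x k"
        unfolding leaf digits[OF k] by simp
      then show "m k \<le> f (pt k) - L * D x k" using m(1)[OF k s(1)] by simp
    next
      obtain s where s: "m k = leaf x (s * 2 ^ q + k)" using m(2)[OF k] by blast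
      show "f (pt k) - L * D x k \<le> m k" 
        using leaf_ge[of "s * 2 ^ q + k" x] unfolding digits[OF k] s .
    qed
    have fx: "\<bar>f x - f (pt k)\<bar> \<le> L * D x k" for k
      using lip[OF xc pt_c] by (simp add: D_def)
    obtain k where "k < 2 ^ q" "g x = m k" using m(4) by blast
    then have upper: "g x \<le> f x" using m_eq fx[of k] by (simp add: abs_le_iff)
    have "\<exists>d<2 ^ p. \<bar>vec_index x i - (- M + real d * h)\<bar> \<le> h" if i: "i < n" for i
    proof -
      have xi: "- M \<le> vec_index x i" "vec_index x i \<le> M" using x i by (auto simp: cube_def)
      have "(vec_index x i + M) / h \<le> real (2 ^ p)"
        using xi h by (simp add: pos_divide_le_eq)
      then obtain d where d: "d < 2 ^ p" "\<bar>(vec_index x i + M) / h - real d\<bar> \<le> 1"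
        using near_grid_index[of "(vec_index x i + M) / h" "2 ^ p"] xi h by auto
      have "vec_index x i - (- M + real d * h) = ((vec_index x i + M) / h - real d) * h"
        using h by (simp add: field_simps)
      then have "\<bar>vec_index x i - (- M + real d * h)\<bar> \<le> 1 * h"
        using d(2) h by (simp only: abs_mult) (intro mult_mono, auto)
      then show ?thesis using d(1) by auto
    qed
    then obtain d where d: "\<And>i. i < n \<Longrightarrow> d i < 2 ^ p \<and> \<bar>vec_index x i - (- M + real (d i) * h)\<bar> \<le> h"
      by metis
    have "restrict d {..<n} \<in> \<gamma> ` {..<2 ^ q}"
      using \<gamma> d by (auto simp: bij_betw_def G_def)
    then obtain k where k: "k < 2 ^ q" "\<gamma> k = restrict d {..<n}" by auto
    have "D x k \<le> (\<Sum>i<n. h)"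
      unfolding D_def using d k(2) by (intro sum_mono) (auto simp: pt_def)
    then have "L * D x k \<le> L * (real n * h)" using L by (intro mult_left_mono) auto
    moreover have "f (pt k) - L * D x k \<le> g x" using m(3)[OF k(1)] m_eq[OF k(1)] by simp
    ultimately show ?thesis using upper fx[of k] by (simp add: abs_le_iff)
  qed
  then show ?thesis using g unfolding h_def q_def by blast
qed

text \<open>
  The first summand bounds the depth, as a multiple of \<open>\<Lambda> + 1\<close> in \<open>stacked_network_approx\<close>. The second
  one bounds the number of nonzero weights, as a multiple of \<open>(2 * M / \<tau>) ^ n\<close>. The factor \<open>n + 15\<close> is the number of weights that
  \<open>relu_net_max_min\<close> spends on each leaf.
\<close>
definition net_const :: "nat \<Rightarrow> nat \<Rightarrow> real" where
  "net_const n m = real (2 * n + 2 + 2 * n * (4 * n + 1)) + 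
     2 ^ n * (2 * real n * sqrt (real m)) ^ n * (real n + 15)"

lemma net_const_ge_1: "1 \<le> net_const n m"
proof -
  have "1 \<le> real (2 * n + 2 + 2 * n * (4 * n + 1))" by simp
  moreover have "0 \<le> 2 ^ n * (2 * real n * sqrt (real m)) ^ n * (real n + 15)" by simp
  ultimately show ?thesis unfolding net_const_def by linarith
qed

lemma power_of_two_between:
  fixes y :: real
  assumes "1 \<le> y"
  shows "\<exists>p. y \<le> 2 ^ p \<and> 2 ^ p \<le> 2 * y \<and> real p \<le> 2 * ln y + 1"
proof -
  define p where "p = nat \<lceil>log 2 y\<rceil>"
  have p: "log 2 y \<le> real p" "real p \<le> log 2 y + 1"
    using assms by (auto simp: p_def) 
  have y: "2 powr (log 2 y) = y" using assms by simp
  have "2 powr (log 2 y) \<le> 2 powr real p" using p(1) by simp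
  then have 1: "y \<le> 2 ^ p" unfolding y by (simp add: powr_realpow)
  have "2 powr real p \<le> 2 powr (log 2 y + 1)" using p(2) by simp
  then have 2: "2 ^ p \<le> 2 * y" unfolding powr_add y by (simp add: powr_realpow)
  have "1 / ln 2 \<le> (2 :: real)" using ln2_ge_two_thirds by (simp add: field_simps)
  then have "1 / ln 2 * ln y \<le> 2 * ln y" using assms by (intro mult_right_mono) auto
  then have "log 2 y \<le> 2 * ln y" by (simp add: log_def)
  then show ?thesis using 1 2 p(2) by (intro exI[of _ p]) simp
qed

text \<open>
  The grid is chosen with \<open>2 ^ p\<close> between \<open>y\<close> and \<open>2 * y\<close> for \<open>y = 2 * M * n * sqrt m / \<tau>\<close>, which makes
  the spacing \<open>2 * M / 2 ^ p\<close> at most \<open>\<tau> / (n * sqrt m)\<close>. The condition \<open>\<tau> \<le> 2 * M\<close> ensures \<open>1 \<le> y\<close>.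
  Depth and size depend on neither \<open>L\<close> nor the functions \<open>h\<close>, so they can be fixed before the data
  are seen.
\<close>
lemma stacked_network_approx:
  fixes n m :: nat and M \<tau> :: real
  defines "\<Lambda> \<equiv> max 0 (ln (M * sqrt (real m) / \<tau>))"
  assumes n: "1 \<le> n" and m: "1 \<le> m" and M: "0 < M" and \<tau>: "0 < \<tau>" "\<tau> \<le> 2 * M"
  shows "\<exists>t r. real t \<le> net_const n m * (\<Lambda> + 1) \<and>
    real r \<le> net_const n m * (\<tau> / (2 * M)) powr (- real n) * (\<Lambda> + 1) \<and>
    (\<forall>L h. 0 \<le> L \<longrightarrow>
      (\<forall>j<m. \<forall>x\<in>carrier_vec n. \<forall>y\<in>carrier_vec n.
         \<bar>h j x - h j y\<bar> \<le> L * (\<Sum>i<n. \<bar>vec_index x i - vec_index y i\<bar>)) \<longrightarrow>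
      (\<exists>g\<in>zero_ext_nets n m t r M.
         (\<forall>x\<in>cube n M. \<forall>j<m. \<bar>vec_index (g x) j - h j x\<bar> \<le> 2 * L * \<tau> / sqrt (real m)) \<and>
         (\<forall>x\<in>carrier_vec n - cube n M. g x = 0\<^sub>v m)))"
proof -
  define y where "y = 2 * M * real n * sqrt (real m) / \<tau>"
  have \<Lambda>: "0 \<le> \<Lambda>" "ln (M * sqrt (real m) / \<tau>) \<le> \<Lambda>" by (auto simp: \<Lambda>_def)
  have sm: "1 \<le> sqrt (real m)" using m by simp
  have n1: "1 \<le> real n" using n by simp
  have y1: "1 \<le> y"
  proof -
    have "\<tau> * 1 \<le> 2 * M * (real n * sqrt (real m))"
      using \<tau> M mult_mono[OF n1 sm] by (intro mult_mono) auto
    then show ?thesis using \<tau>(1) by (simp add: y_def field_simps)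
  qed
  obtain p where p: "y \<le> 2 ^ p" "2 ^ p \<le> 2 * y" "real p \<le> 2 * ln y + 1"
    using power_of_two_between[OF y1] by blast
  define t where "t = 2 * n + 2 * (p * n) + 2"
  define r where "r = 2 ^ n * 2 ^ (p * n) * (n + 15)"
  have "ln y = ln (2 * real n) + ln (M * sqrt (real m) / \<tau>)"
    using n1 sm M \<tau>(1) unfolding y_def by (subst ln_mult_pos[symmetric]) (auto simp: field_simps)
  also have "\<dots> \<le> 2 * real n + \<Lambda>"
    using \<Lambda>(2) ln_bound[of "2 * real n"] n1 by simp
  finally have p_le: "real p \<le> 4 * real n + 2 * \<Lambda> + 1" using p(3) by simp
  have t_le: "real t \<le> real (2 * n + 2 + 2 * n * (4 * n + 1)) * (\<Lambda> + 1)"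
  proof -
    have "4 * real n + 2 * \<Lambda> + 1 \<le> (4 * real n + 1) * (\<Lambda> + 1)"
    proof -
      have "2 * \<Lambda> \<le> (4 * real n) * \<Lambda>" using n1 \<Lambda>(1) by (intro mult_right_mono) linarith+
      moreover have "(4 * real n + 1) * (\<Lambda> + 1) = 4 * real n * \<Lambda> + 4 * real n + \<Lambda> + 1"
        by (simp add: algebra_simps)
      ultimately show ?thesis using \<Lambda>(1) by linarith
    qed
    then have "real p \<le> (4 * real n + 1) * (\<Lambda> + 1)" using p_le by linarith
    then have "2 * real n * real p \<le> 2 * real n * ((4 * real n + 1) * (\<Lambda> + 1))"
      by (intro mult_left_mono) auto
    moreover have "2 * real n + 2 \<le> (2 * real n + 2) * (\<Lambda> + 1)"
      using \<Lambda>(1) by (simp add: mult_le_cancel_left1)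
    ultimately have "2 * real n + 2 + 2 * real n * real p
        \<le> (2 * real n + 2) * (\<Lambda> + 1) + 2 * real n * ((4 * real n + 1) * (\<Lambda> + 1))"
      by linarith
    moreover have "real t = 2 * real n + 2 + 2 * real n * real p"
      by (simp add: t_def)
    ultimately show ?thesis by (simp add: algebra_simps)
  qed
  define K where "K = 2 ^ n * (2 * real n * sqrt (real m)) ^ n * (real n + 15)"
  have K: "0 \<le> K" by (simp add: K_def)
  define Z where "Z = (\<tau> / (2 * M)) powr (- real n)"
  have Z: "Z = (2 * M / \<tau>) ^ n"
  proof -
    have "0 < \<tau> / (2 * M)" using \<tau>(1) M by simp
    then have "Z = inverse ((\<tau> / (2 * M)) ^ n)" by (simp add: Z_def powr_minus powr_realpow)
    then show ?thesis by (simp flip: power_inverse)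
  qed
  have Z1: "1 \<le> Z" unfolding Z using \<tau> M by (intro one_le_power) simp
  have r_le: "real r \<le> K * Z"
  proof -
    have "(2::real) ^ (p * n) = (2 ^ p) ^ n" by (rule power_mult)
    also have "\<dots> \<le> (2 * y) ^ n" using p(2) by (intro power_mono) auto
    also have "2 * y = (2 * real n * sqrt (real m)) * (2 * M / \<tau>)" by (simp add: y_def)
    finally have "(2::real) ^ (p * n) \<le> (2 * real n * sqrt (real m)) ^ n * Z"
      unfolding Z power_mult_distrib by simp
    then have "2 ^ n * (2::real) ^ (p * n) * (real n + 15)
        \<le> 2 ^ n * ((2 * real n * sqrt (real m)) ^ n * Z) * (real n + 15)"
      by (intro mult_right_mono mult_left_mono) auto
    then show ?thesis by (simp add: r_def K_def mult_ac)
  qed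
  have "real t \<le> net_const n m * (\<Lambda> + 1)"
  proof -
    have "real (2 * n + 2 + 2 * n * (4 * n + 1)) * (\<Lambda> + 1) \<le> net_const n m * (\<Lambda> + 1)"
      using K \<Lambda>(1) unfolding net_const_def K_def by (intro mult_right_mono) auto
    then show ?thesis using t_le by linarith
  qed
  moreover have "real r \<le> net_const n m * Z * (\<Lambda> + 1)"
  proof -
    have "K \<le> net_const n m" unfolding net_const_def K_def by simp
    then have "K * Z \<le> net_const n m * Z" using Z1 by (intro mult_right_mono) auto
    also have "\<dots> \<le> net_const n m * Z * (\<Lambda> + 1)"
      using Z1 \<Lambda>(1) net_const_ge_1[of n m]
        mult_left_mono[of 1 "\<Lambda> + 1" "net_const n m * Z"] by simp
    finally show ?thesis using r_le by linarith
  qed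
  moreover have "\<exists>g\<in>zero_ext_nets n m t r M.
         (\<forall>x\<in>cube n M. \<forall>j<m. \<bar>vec_index (g x) j - h j x\<bar> \<le> 2 * L * \<tau> / sqrt (real m)) \<and>
         (\<forall>x\<in>carrier_vec n - cube n M. g x = 0\<^sub>v m)"
    if L: "0 \<le> L" and lip: "\<forall>j<m. \<forall>x\<in>carrier_vec n. \<forall>y\<in>carrier_vec n.
         \<bar>h j x - h j y\<bar> \<le> L * (\<Sum>i<n. \<bar>vec_index x i - vec_index y i\<bar>)" for L h
  proof -
    have "\<exists>g\<in>relu_nets n t r. \<forall>x\<in>cube n M. \<bar>g x - h j x\<bar> \<le> 2 * (L * (real n * (2 * M / 2 ^ p)))"
      if "j < m" for j
      unfolding t_def r_def using lip that by (intro lipschitz_relu_approx[OF M L]) auto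
    then obtain f where f: "\<And>j. j < m \<Longrightarrow> f j \<in> relu_nets n t r"
      "\<And>j x. j < m \<Longrightarrow> x \<in> cube n M \<Longrightarrow> \<bar>f j x - h j x\<bar> \<le> 2 * (L * (real n * (2 * M / 2 ^ p)))"
      by metis
    define s where "s x = Matrix.vec m (\<lambda>j. f j x)" for x
    define g where "g x = (if x \<in> cube n M then s x else 0\<^sub>v m)" for x
    have "s \<in> stacked_nets n m t r"
      unfolding stacked_nets_def using f(1) by (auto simp: s_def)
    then have "g \<in> zero_ext_nets n m t r M"
      unfolding zero_ext_nets_def by (auto simp: g_def)
    moreover have "\<bar>vec_index (g x) j - h j x\<bar> \<le> 2 * L * \<tau> / sqrt (real m)"
      if "x \<in> cube n M" "j < m" for x j
    proof -
      have "2 * M * real n * sqrt (real m) \<le> \<tau> * 2 ^ p"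
        using p(1) \<tau>(1) by (simp add: y_def field_simps)
      then have "real n * (2 * M / 2 ^ p) \<le> \<tau> / sqrt (real m)"
        using sm by (simp add: field_simps)
      then have "2 * (L * (real n * (2 * M / 2 ^ p))) \<le> 2 * (L * (\<tau> / sqrt (real m)))"
        using L by (intro mult_left_mono) auto
      then show ?thesis using f(2)[OF that(2,1)] that by (simp add: g_def s_def)
    qed
    moreover have "\<forall>x\<in>carrier_vec n - cube n M. g x = 0\<^sub>v m" by (simp add: g_def)
    ultimately show ?thesis by blast
  qed
  ultimately show ?thesis unfolding Z_def by blast
qed

text \<open>
  For \<open>\<tau> > 2 * M\<close> the admissible size may be below \<open>1\<close>, which leaves no nonzero weight.
\<close>
lemma zero_net: "(\<lambda>_. 0\<^sub>v m) \<in> zero_ext_nets n m 1 0 M"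
proof -
  define ls :: "layer list" where "ls = [(0\<^sub>m 1 n, 0\<^sub>v 1)]"
  have "nnz_mat (0\<^sub>m 1 n) \<le> dim_row (0\<^sub>m 1 n :: real Matrix.mat) * 0"
  proof (rule nnz_mat_le_rows)
    fix i assume "i < dim_row (0\<^sub>m 1 n :: real Matrix.mat)"
    then have "{j. j < dim_col (0\<^sub>m 1 n :: real Matrix.mat) \<and> (0\<^sub>m 1 n :: real Matrix.mat) $$ (i, j) \<noteq> 0} = {}"
      by auto
    then show "card {j. j < dim_col (0\<^sub>m 1 n :: real Matrix.mat) \<and> (0\<^sub>m 1 n :: real Matrix.mat) $$ (i, j) \<noteq> 0} \<le> 0"
      by (simp only: card.empty)
  qed
  then have "net_size ls = 0" by (simp add: ls_def)
  moreover have "net_dims n ls 1" by (simp add: ls_def)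
  moreover have "vec_index (net_eval ls s) 0 = 0" if "s \<in> carrier_vec n" for s
    using that by (simp add: ls_def scalar_prod_def)
  ultimately have "(\<lambda>_. 0) \<in> relu_nets n 1 0"
    unfolding relu_nets_def by (auto intro!: exI[of _ ls] simp: ls_def)
  then have "(\<lambda>s. vec_index (0\<^sub>v m) j) \<in> relu_nets n 1 0" if "j < m" for j using that by simp
  then have "\<forall>j<m. \<exists>t'\<le>1. \<exists>r'\<le>0. (\<lambda>s. vec_index (0\<^sub>v m) j) \<in> relu_nets n t' r'" by blast
  then have "(\<lambda>_. 0\<^sub>v m) \<in> stacked_nets n m 1 0"
    unfolding stacked_nets_def by (intro CollectI conjI) auto
  then show ?thesis unfolding zero_ext_nets_def by auto
qed

section \<open>Orthonormal families\<close>

definition orthonormal_family :: "nat \<Rightarrow> (nat \<Rightarrow> 'a::real_inner) \<Rightarrow> bool" where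
  "orthonormal_family d \<phi> \<longleftrightarrow> (\<forall>i<d. \<forall>j<d. inner (\<phi> i) (\<phi> j) = (if i = j then 1 else 0))"

text \<open>
  For an orthonormal family, the squared length of the projection of \<open>u\<close> onto its span.
\<close>
definition energy :: "nat \<Rightarrow> (nat \<Rightarrow> 'a::real_inner) \<Rightarrow> 'a \<Rightarrow> real" where
  "energy d \<phi> u = (\<Sum>i<d. (inner u (\<phi> i))\<^sup>2)"

definition proj_on :: "nat \<Rightarrow> (nat \<Rightarrow> 'a::real_inner) \<Rightarrow> 'a \<Rightarrow> 'a" where
  "proj_on d \<phi> u = (\<Sum>i<d. inner u (\<phi> i) *\<^sub>R \<phi> i)"

lemma orthonormal_familyD:
  "orthonormal_family d \<phi> \<Longrightarrow> i < d \<Longrightarrow> j < d \<Longrightarrow> inner (\<phi> i) (\<phi> j) = (if i = j then 1 else 0)"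
  by (simp add: orthonormal_family_def)

lemma inner_combination:
  assumes "orthonormal_family d \<phi>" "j < d"
  shows "inner (\<Sum>i<d. a i *\<^sub>R \<phi> i) (\<phi> j) = a j"
proof -
  have "inner (\<Sum>i<d. a i *\<^sub>R \<phi> i) (\<phi> j) = (\<Sum>i<d. if i = j then a i else 0)"
    unfolding inner_sum_left
    by (rule sum.cong) (auto simp: orthonormal_familyD[OF assms(1) _ assms(2)])
  then show ?thesis using assms(2) by simp
qed

lemma norm_combination:
  assumes "orthonormal_family d \<phi>"
  shows "(norm (\<Sum>i<d. a i *\<^sub>R \<phi> i))\<^sup>2 = (\<Sum>i<d. (a i)\<^sup>2)"
proof -
  have "(norm (\<Sum>i<d. a i *\<^sub>R \<phi> i))\<^sup>2 = (\<Sum>j<d. a j * inner (\<Sum>i<d. a i *\<^sub>R \<phi> i) (\<phi> j))"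
    unfolding power2_norm_eq_inner
    using inner_sum_right[of "\<Sum>i<d. a i *\<^sub>R \<phi> i" "\<lambda>i. a i *\<^sub>R \<phi> i" "{..<d}"] by simp
  also have "\<dots> = (\<Sum>i<d. (a i)\<^sup>2)"
    by (rule sum.cong) (auto simp: inner_combination[OF assms] power2_eq_square)
  finally show ?thesis .
qed

lemma inner_proj_on:
  "orthonormal_family d \<phi> \<Longrightarrow> j < d \<Longrightarrow> inner (proj_on d \<phi> u) (\<phi> j) = inner u (\<phi> j)"
  unfolding proj_on_def by (rule inner_combination)

lemma inner_residual:
  "orthonormal_family d \<phi> \<Longrightarrow> j < d \<Longrightarrow> inner (u - proj_on d \<phi> u) (\<phi> j) = 0"
  by (simp add: inner_diff_left inner_proj_on)

lemma norm_residual: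
  assumes "orthonormal_family d \<phi>"
  shows "(norm (u - proj_on d \<phi> u))\<^sup>2 = (norm u)\<^sup>2 - energy d \<phi> u"
proof -
  have "inner u (proj_on d \<phi> u) = energy d \<phi> u"
    by (simp add: proj_on_def energy_def inner_sum_right power2_eq_square)
  moreover have "(norm (proj_on d \<phi> u))\<^sup>2 = energy d \<phi> u"
    unfolding proj_on_def energy_def by (rule norm_combination[OF assms])
  ultimately show ?thesis
    by (simp add: power2_norm_eq_inner inner_diff_left inner_diff_right inner_commute)
qed

lemma energy_nonneg: "0 \<le> energy d \<phi> u"
  by (simp add: energy_def sum_nonneg)

lemma bessel: "orthonormal_family d \<phi> \<Longrightarrow> energy d \<phi> u \<le> (norm u)\<^sup>2"
  using norm_residual[of d \<phi> u] zero_le_power2[of "norm (u - proj_on d \<phi> u)"] by linarith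

lemma proj_on_mem_span: "proj_on d \<phi> u \<in> span (\<phi> ` {..<d})"
  unfolding proj_on_def by (intro span_sum span_scale span_base) auto

lemma orth_proj_span:
  assumes "orthonormal_family d \<phi>"
  shows "orth_proj (span (\<phi> ` {..<d})) u = proj_on d \<phi> u"
  unfolding orth_proj_def
proof (rule the_equality)
  have ortho: "inner (u - proj_on d \<phi> u) v = 0" if "v \<in> span (\<phi> ` {..<d})" for v
    using that
  proof (induction rule: span_induct_alt)
    case (step c x y)
    then show ?case using inner_residual[OF assms, of _ u] by (auto simp: inner_add_right)
  qed simp
  then show "proj_on d \<phi> u \<in> span (\<phi> ` {..<d}) \<and> (\<forall>v\<in>span (\<phi> ` {..<d}). inner (u - proj_on d \<phi> u) v = 0)"
    using proj_on_mem_span by blast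
  fix p assume p: "p \<in> span (\<phi> ` {..<d}) \<and> (\<forall>v\<in>span (\<phi> ` {..<d}). inner (u - p) v = 0)"
  define q where "q = proj_on d \<phi> u - p"
  have q: "q \<in> span (\<phi> ` {..<d})" using p proj_on_mem_span span_diff unfolding q_def by blast
  have "inner q q = inner (u - p) q - inner (u - proj_on d \<phi> u) q"
    by (simp add: q_def inner_diff_left)
  also have "\<dots> = 0" using p q ortho[OF q] by simp
  finally show "p = proj_on d \<phi> u" by (simp add: q_def)
qed

lemma norm_proj_on_le: 
  assumes "orthonormal_family d \<phi>" shows "norm (proj_on d \<phi> u) \<le> norm u"
proof -
  have "(norm (proj_on d \<phi> u))\<^sup>2 = energy d \<phi> u"
    unfolding proj_on_def energy_def by (rule norm_combination[OF assms])
  then have "(norm (proj_on d \<phi> u))\<^sup>2 \<le> (norm u)\<^sup>2" using bessel[OF assms, of u] by simp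
  then show ?thesis by (rule power2_le_imp_le) simp
qed

lemma proj_on_diff: "proj_on d \<phi> u - proj_on d \<phi> v = proj_on d \<phi> (u - v)"
  by (simp add: proj_on_def inner_diff_left scaleR_diff_left sum_subtractf)

lemma abs_inner_orthonormal_le:
  assumes "orthonormal_family d \<phi>" "i < d"
  shows "\<bar>inner u (\<phi> i)\<bar> \<le> norm u"
proof -
  have "norm (\<phi> i) = 1" using orthonormal_familyD[OF assms(1,2,2)] by (simp add: norm_eq_sqrt_inner)
  then show ?thesis using Cauchy_Schwarz_ineq2[of u "\<phi> i"] by simp
qed

section \<open>Energies and the Gram form\<close>

text \<open>
  Gram--Schmidt, one vector of \<open>S\<close> at a time.
\<close>
lemma orthonormal_extension:
  fixes \<phi> :: "nat \<Rightarrow> 'a::real_inner"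
  assumes "finite S" "orthonormal_family d \<phi>"
  shows "\<exists>m \<psi>. d \<le> m \<and> orthonormal_family m \<psi> \<and> (\<forall>i<d. \<psi> i = \<phi> i) \<and> (\<forall>u\<in>S. proj_on m \<psi> u = u)"
  using assms(1)
proof (induction S)
  case empty
  show ?case using assms(2) by (intro exI[of _ d] exI[of _ \<phi>]) auto
next
  case (insert v S)
  then obtain m \<psi> where m: "d \<le> m" "orthonormal_family m \<psi>" "\<forall>i<d. \<psi> i = \<phi> i"
    "\<And>u. u \<in> S \<Longrightarrow> proj_on m \<psi> u = u" by blast
  define r where "r = v - proj_on m \<psi> v"
  show ?case
  proof (cases "r = 0")
    case True
    then show ?thesis using m by (intro exI[of _ m] exI[of _ \<psi>]) (auto simp: r_def)
  next
    case False
    define e where "e = r /\<^sub>R norm r"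
    define \<psi>' where "\<psi>' = \<psi>(m := e)"
    have re: "inner r (\<psi> i) = 0" if "i < m" for i
      using inner_residual[OF m(2) that] by (simp add: r_def)
    have ee: "inner e e = 1" "inner (\<psi> i) e = 0" "inner e (\<psi> i) = 0" if "i < m" for i
      using False re[OF that]
      by (auto simp: e_def inner_commute power2_norm_eq_inner[symmetric] power2_eq_square)
    have e1: "inner e e = 1"
      using False by (simp add: e_def power2_norm_eq_inner[symmetric] power2_eq_square)
    have on: "orthonormal_family (Suc m) \<psi>'"
      unfolding orthonormal_family_def
      using ee e1 by (auto simp: \<psi>'_def less_Suc_eq orthonormal_familyD[OF m(2)])
    have proj': "proj_on (Suc m) \<psi>' u = proj_on m \<psi> u + inner u e *\<^sub>R e" for u
      unfolding proj_on_def by (simp add: \<psi>'_def)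
    have pe: "inner (proj_on m \<psi> u) e = 0" for u
      using ee by (simp add: proj_on_def inner_sum_left)
    have "proj_on (Suc m) \<psi>' u = u" if "u \<in> S" for u
      using pe[of u] m(4)[OF that] by (simp add: proj')
    moreover have "proj_on (Suc m) \<psi>' v = v"
    proof -
      have v: "v = proj_on m \<psi> v + norm r *\<^sub>R e" using False by (simp add: e_def r_def)
      have "inner v e = norm r" by (subst v) (simp add: inner_add_left pe e1)
      then show ?thesis using v by (simp add: proj')
    qed
    moreover have "\<forall>i<d. \<psi>' i = \<phi> i" using m(1,3) by (auto simp: \<psi>'_def)
    ultimately have "d \<le> Suc m \<and> orthonormal_family (Suc m) \<psi>' \<and> (\<forall>i<d. \<psi>' i = \<phi> i)
        \<and> (\<forall>u\<in>insert v S. proj_on (Suc m) \<psi>' u = u)"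
      using m(1) on by simp
    then show ?thesis by blast
  qed
qed

text \<open>
  The left-hand side is the squared Hilbert--Schmidt norm of the operator \<open>\<Sum>a\<in>A. c a * u a \<otimes> u a\<close>.
  On the right, it is the sum of the squared entries of the matrix of this operator in an orthonormal
  family that spans all \<open>u a\<close> and starts with the given one.
\<close>
lemma gram_form_expansion:
  fixes u :: "'i \<Rightarrow> 'a::real_inner" and c :: "'i \<Rightarrow> real"
  assumes "finite A" "orthonormal_family d \<phi>"
  shows "\<exists>m \<psi>. d \<le> m \<and> orthonormal_family m \<psi> \<and> (\<forall>i<d. \<psi> i = \<phi> i) \<and>
    (\<Sum>a\<in>A. \<Sum>b\<in>A. c a * c b * (inner (u a) (u b))\<^sup>2)
      = (\<Sum>i<m. \<Sum>j<m. (\<Sum>a\<in>A. c a * inner (u a) (\<psi> i) * inner (u a) (\<psi> j))\<^sup>2)"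
proof -
  obtain m \<psi> where m: "d \<le> m" "orthonormal_family m \<psi>" "\<forall>i<d. \<psi> i = \<phi> i"
    "\<And>a. a \<in> A \<Longrightarrow> proj_on m \<psi> (u a) = u a"
    using orthonormal_extension[of "u ` A" d \<phi>] assms by auto
  have inner_eq: "inner (u a) (u b) = (\<Sum>i<m. inner (u a) (\<psi> i) * inner (u b) (\<psi> i))"
    if "a \<in> A" for a b
  proof -
    have "inner (u a) (u b) = inner (proj_on m \<psi> (u a)) (u b)" using m(4)[OF that] by simp
    also have "\<dots> = (\<Sum>i<m. inner (u a) (\<psi> i) * inner (u b) (\<psi> i))"
      unfolding proj_on_def inner_sum_left by (rule sum.cong) (simp_all add: inner_commute)
    finally show ?thesis .
  qed
  let ?f = "\<lambda>i j a b. c a * c b * (inner (u a) (\<psi> i) * inner (u b) (\<psi> i))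
    * (inner (u a) (\<psi> j) * inner (u b) (\<psi> j))"
  have "(\<Sum>i<m. \<Sum>j<m. (\<Sum>a\<in>A. c a * inner (u a) (\<psi> i) * inner (u a) (\<psi> j))\<^sup>2) = (\<Sum>i<m. \<Sum>j<m. \<Sum>a\<in>A. \<Sum>b\<in>A. ?f i j a b)"
    unfolding power2_eq_square sum_product by (simp add: mult_ac)
  also have "\<dots> = (\<Sum>i<m. \<Sum>a\<in>A. \<Sum>j<m. \<Sum>b\<in>A. ?f i j a b)"
    by (intro sum.cong refl sum.swap)
  also have "\<dots> = (\<Sum>a\<in>A. \<Sum>i<m. \<Sum>j<m. \<Sum>b\<in>A. ?f i j a b)"
    by (rule sum.swap)
  also have "\<dots> = (\<Sum>a\<in>A. \<Sum>i<m. \<Sum>b\<in>A. \<Sum>j<m. ?f i j a b)"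
    by (intro sum.cong refl sum.swap)
  also have "\<dots> = (\<Sum>a\<in>A. \<Sum>b\<in>A. \<Sum>i<m. \<Sum>j<m. ?f i j a b)"
    by (intro sum.cong refl sum.swap)
  also have "\<dots> = (\<Sum>a\<in>A. \<Sum>b\<in>A. c a * c b * (inner (u a) (u b))\<^sup>2)"
  proof (intro sum.cong refl)
    fix a b assume "a \<in> A"
    show "(\<Sum>i<m. \<Sum>j<m. ?f i j a b) = c a * c b * (inner (u a) (u b))\<^sup>2"
      unfolding inner_eq[OF \<open>a \<in> A\<close>, of b] power2_eq_square sum_product
      by (simp add: sum_distrib_left mult.assoc)
  qed
  finally show ?thesis using m(1,2,3) by (intro exI[of _ m] exI[of _ \<psi>]) simp
qed

lemma gram_form_nonneg:
  fixes u :: "'i \<Rightarrow> 'a::real_inner" and c :: "'i \<Rightarrow> real"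
  assumes "finite A"
  shows "0 \<le> (\<Sum>a\<in>A. \<Sum>b\<in>A. c a * c b * (inner (u a) (u b))\<^sup>2)"
proof -
  have "orthonormal_family 0 (\<lambda>_. 0 :: 'a)" by (simp add: orthonormal_family_def)
  from gram_form_expansion[OF assms this, of c u]
  obtain m :: nat and \<psi> where "(\<Sum>a\<in>A. \<Sum>b\<in>A. c a * c b * (inner (u a) (u b))\<^sup>2)
      = (\<Sum>i<m. \<Sum>j<m. (\<Sum>a\<in>A. c a * inner (u a) (\<psi> i) * inner (u a) (\<psi> j))\<^sup>2)"
    by blast
  then show ?thesis by (simp only: sum_nonneg zero_le_power2)
qed

text \<open>
  The sum on the left is a sum of \<open>d\<close> diagonal entries of the matrix in \<open>gram_form_expansion\<close>, so the
  bound is Cauchy--Schwarz.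
\<close>
lemma energy_sum_le_gram_form:
  fixes u :: "'i \<Rightarrow> 'a::real_inner" and c :: "'i \<Rightarrow> real"
  assumes "finite A" "orthonormal_family d \<phi>"
  shows "(\<Sum>a\<in>A. c a * energy d \<phi> (u a))\<^sup>2
    \<le> real d * (\<Sum>a\<in>A. \<Sum>b\<in>A. c a * c b * (inner (u a) (u b))\<^sup>2)"
proof -
  obtain m \<psi> where m: "d \<le> m" "\<forall>i<d. \<psi> i = \<phi> i"
    and gram: "(\<Sum>a\<in>A. \<Sum>b\<in>A. c a * c b * (inner (u a) (u b))\<^sup>2)
      = (\<Sum>i<m. \<Sum>j<m. (\<Sum>a\<in>A. c a * inner (u a) (\<psi> i) * inner (u a) (\<psi> j))\<^sup>2)"
    using gram_form_expansion[OF assms] by blast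
  define T where "T i j = (\<Sum>a\<in>A. c a * inner (u a) (\<psi> i) * inner (u a) (\<psi> j))" for i j
  have "(\<Sum>a\<in>A. c a * energy d \<phi> (u a)) = (\<Sum>i<d. T i i)"
    unfolding energy_def T_def sum_distrib_left
    by (subst sum.swap) (use m(2) in \<open>auto simp: power2_eq_square mult.assoc intro!: sum.cong\<close>)
  then have "(\<Sum>a\<in>A. c a * energy d \<phi> (u a))\<^sup>2 = (\<Sum>i<d. 1 * T i i)\<^sup>2" by simp
  also have "\<dots> \<le> (\<Sum>i<d. 1\<^sup>2) * (\<Sum>i<d. (T i i)\<^sup>2)" by (rule Cauchy_Schwarz_ineq_sum)
  also have "\<dots> \<le> real d * (\<Sum>i<m. \<Sum>j<m. (T i j)\<^sup>2)"
  proof -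
    have "(\<Sum>i<d. (T i i)\<^sup>2) \<le> (\<Sum>i<m. (T i i)\<^sup>2)" using m(1) by (intro sum_mono2) auto
    also have "\<dots> \<le> (\<Sum>i<m. \<Sum>j<m. (T i j)\<^sup>2)"
      by (intro sum_mono member_le_sum) auto
    finally show ?thesis by (simp add: mult_left_mono)
  qed
  finally show ?thesis unfolding gram T_def .
qed

section \<open>Variational principle for leading eigenvectors\<close>

lemma summable_orthogonal:
  fixes f :: "nat \<Rightarrow> 'a::{real_inner, banach}"
  assumes orth: "\<And>i j. i \<noteq> j \<Longrightarrow> inner (f i) (f j) = 0"
    and sq: "summable (\<lambda>i. (norm (f i))\<^sup>2)"
  shows "summable f"
  unfolding summable_Cauchy
proof (intro allI impI)
  fix e :: real assume "0 < e"
  then have "0 < e\<^sup>2" by simp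
  then obtain N where N: "\<And>m n. m \<ge> N \<Longrightarrow> norm (\<Sum>i\<in>{m..<n}. (norm (f i))\<^sup>2) < e\<^sup>2"
    using iffD1[OF summable_Cauchy sq] by blast
  have "norm (sum f {m..<n}) < e" if "m \<ge> N" for m n
  proof -
    have "(norm (sum f {m..<n}))\<^sup>2 = (\<Sum>i\<in>{m..<n}. (norm (f i))\<^sup>2)"
    proof -
      have "(norm (sum f {m..<n}))\<^sup>2 = (\<Sum>i\<in>{m..<n}. \<Sum>j\<in>{m..<n}. inner (f j) (f i))"
        unfolding power2_norm_eq_inner inner_sum_left inner_sum_right ..
      also have "\<dots> = (\<Sum>i\<in>{m..<n}. \<Sum>j\<in>{m..<n}. if j = i then (norm (f i))\<^sup>2 else 0)"
        by (intro sum.cong refl) (auto simp: orth power2_norm_eq_inner)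
      finally show ?thesis by simp
    qed
    also have "\<dots> < e\<^sup>2" using N[OF that, of n] by (simp add: sum_nonneg)
    finally show ?thesis using \<open>0 < e\<close> by (auto intro: power2_less_imp_less)
  qed
  then show "\<exists>N. \<forall>m\<ge>N. \<forall>n. norm (sum f {m..<n}) < e" by blast
qed

lemma ordered_eigensystemD:
  assumes "ordered_eigensystem C n lam \<phi>"
  shows "\<And>i j. enat i < n \<Longrightarrow> enat j < n \<Longrightarrow> inner (\<phi> i) (\<phi> j) = (if i = j then 1 else 0)"
    and "\<And>i. enat i < n \<Longrightarrow> C (\<phi> i) = lam i *\<^sub>R \<phi> i"
    and "\<And>i. enat i < n \<Longrightarrow> 0 \<le> lam i"
    and "\<And>i j. i \<le> j \<Longrightarrow> enat j < n \<Longrightarrow> lam j \<le> lam i"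
    and "\<And>u. (\<And>i. enat i < n \<Longrightarrow> inner u (\<phi> i) = 0) \<Longrightarrow> C u = 0"
  using assms unfolding ordered_eigensystem_def by blast+

text \<open>
  Expand the part of \<open>r\<close> in the closed span of all \<open>\<phi> k\<close> as a series, which converges by
  completeness. The rest is orthogonal to the whole system and is annihilated by \<open>C\<close>. Thus the form
  is \<open>\<Sum>k. lam k * (inner r (\<phi> k))\<^sup>2\<close>, where only \<open>k \<ge> d\<close> contributes and \<open>lam k \<le> lam (d - 1)\<close>.
\<close>
lemma rayleigh_tail:
  fixes C :: "'a::{real_inner, banach} \<Rightarrow> 'a"
  assumes C: "bounded_linear C"
    and es: "ordered_eigensystem C n lam \<phi>" and d: "0 < d" "enat d \<le> n"
    and r: "\<And>k. k < d \<Longrightarrow> inner r (\<phi> k) = 0"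
  shows "inner r (C r) \<le> lam (d - 1) * (norm r)\<^sup>2"
proof -
  note E = ordered_eigensystemD[OF es]
  \<comment> \<open>Coefficients beyond a finite length \<open>n\<close> are set to 0, so that finite and infinite systems are treated alike.\<close>
  define a where "a k = (if enat k < n then inner r (\<phi> k) else 0)" for k
  define f where "f k = a k *\<^sub>R \<phi> k" for k
  have a_sq: "(\<Sum>k\<in>K. (a k)\<^sup>2) \<le> (norm r)\<^sup>2" if "finite K" for K
  proof -
    define s where "s = (\<Sum>k\<in>K. f k)"
    have s_phi: "inner s (\<phi> k) = a k" if "k \<in> K" "enat k < n" for k
    proof -
      have "inner s (\<phi> k) = (\<Sum>i\<in>K. if i = k then a i else 0)"
        unfolding s_def inner_sum_left
        by (rule sum.cong) (use that in \<open>auto simp: f_def a_def E(1)\<close>)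
      then show ?thesis using that \<open>finite K\<close> by simp
    qed
    have rs: "inner r s = (\<Sum>k\<in>K. (a k)\<^sup>2)"
      unfolding s_def inner_sum_right
      by (rule sum.cong) (auto simp: f_def a_def power2_eq_square)
    have "inner s s = (\<Sum>k\<in>K. a k * inner s (\<phi> k))"
      using inner_sum_right[of s f K] unfolding s_def[symmetric] by (simp add: f_def)
    also have "\<dots> = (\<Sum>k\<in>K. (a k)\<^sup>2)"
      by (rule sum.cong) (auto simp: s_phi power2_eq_square a_def)
    finally have ss: "inner s s = (\<Sum>k\<in>K. (a k)\<^sup>2)" .
    have "0 \<le> inner (r - s) (r - s)" by simp
    then show ?thesis
      by (simp add: inner_diff_left inner_diff_right rs ss inner_commute[of s r] power2_norm_eq_inner)
  qed
  have norm_phi: "norm (\<phi> k) = 1" if "enat k < n" for k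
    using E(1)[OF that that] by (simp add: norm_eq_sqrt_inner)
  have f_sq: "(norm (f k))\<^sup>2 = (a k)\<^sup>2" for k
    by (cases "enat k < n") (auto simp: f_def a_def norm_phi)
  have summ_a: "summable (\<lambda>k. (a k)\<^sup>2)"
    using a_sq by (intro summableI_nonneg_bounded[where x = "(norm r)\<^sup>2"]) auto
  have "summable f"
  proof (rule summable_orthogonal)
    show "inner (f i) (f j) = 0" if "i \<noteq> j" for i j
      using that by (auto simp: f_def a_def E(1))
  qed (simp add: f_sq summ_a)
  then have f: "f sums (\<Sum>k. f k)" by (rule summable_sums)
  define s where "s = (\<Sum>k. f k)"
  have "inner (r - s) (\<phi> k) = 0" if "enat k < n" for k
  proof -
    have "(\<lambda>i. inner (f i) (\<phi> k)) sums inner s (\<phi> k)"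
      using f bounded_linear.sums[OF bounded_linear_inner_left] unfolding s_def by blast
    moreover have "(\<lambda>i. inner (f i) (\<phi> k)) = (\<lambda>i. if i = k then a i else 0)"
      using that by (auto simp: f_def a_def E(1))
    ultimately have "inner s (\<phi> k) = a k" using sums_unique2[OF _ sums_single[of k a]] by simp
    then show ?thesis using that by (simp add: inner_diff_left a_def)
  qed
  then have "C (r - s) = 0" by (rule E(5))
  then have Cr: "C r = C s" using linear_diff[OF bounded_linear.linear[OF C], of r s] by simp
  have "(\<lambda>k. inner r (C (f k))) sums inner r (C s)"
    using f bounded_linear.sums[OF bounded_linear_compose[OF bounded_linear_inner_right C]]
    unfolding s_def by blast
  moreover have "(\<lambda>k. inner r (C (f k))) = (\<lambda>k. lam k * (a k)\<^sup>2)"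
    by (auto simp: f_def a_def linear_scale[OF bounded_linear.linear[OF C]] E(2) power2_eq_square)
  ultimately have sums: "(\<lambda>k. lam k * (a k)\<^sup>2) sums inner r (C r)" by (simp add: Cr)
  have lam0: "0 \<le> lam (d - 1)" using E(3)[of "d - 1"] d
    by (metis Suc_diff_1 enat_ord_simps(2) lessI order_less_le_trans)
  have "inner r (C r) \<le> (\<Sum>k. lam (d - 1) * (a k)\<^sup>2)"
    unfolding sums_unique[OF sums]
  proof (rule suminf_le[OF _ sums_summable[OF sums] summable_mult[OF summ_a]])
    show "lam k * (a k)\<^sup>2 \<le> lam (d - 1) * (a k)\<^sup>2" for k
    proof (cases "k < d \<or> \<not> enat k < n")
      case True
      then have "a k = 0" using r by (auto simp: a_def)
      then show ?thesis by simp
    next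
      case False
      then show ?thesis using E(4)[of "d - 1" k] by (intro mult_right_mono) auto
    qed
  qed
  also have "\<dots> = lam (d - 1) * (\<Sum>k. (a k)\<^sup>2)" by (rule suminf_mult[OF summ_a])
  also have "\<dots> \<le> lam (d - 1) * (norm r)\<^sup>2"
    using lam0 a_sq by (intro mult_left_mono suminf_le_const[OF summ_a]) auto
  finally show ?thesis .
qed

lemma leading_orthonormal: "leading_eigenvectors C d \<phi> \<Longrightarrow> orthonormal_family d \<phi>"
  unfolding leading_eigenvectors_def orthonormal_family_def
  by (metis enat_ord_simps(2) order_less_le_trans ordered_eigensystemD(1))

text \<open>
  Ky Fan's maximum principle. With \<open>l = lam (d - 1)\<close>, the form of a vector is at most
  \<open>(\<Sum>k<d. (lam k - l) * (inner v (\<phi> k))\<^sup>2) + l * (norm v)\<^sup>2\<close>. Sum this over \<open>\<psi>\<close>: the weights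
  \<open>lam k - l\<close> are nonnegative, and by Bessel's inequality for \<open>\<psi>\<close> the squared coefficients of each
  \<open>\<phi> k\<close> sum to at most 1.
\<close>
lemma ky_fan:
  fixes C :: "'a::{real_inner, banach} \<Rightarrow> 'a"
  assumes C: "bounded_linear C" and sym: "\<And>u v. inner (C u) v = inner u (C v)"
    and lead: "leading_eigenvectors C d \<phi>" and \<psi>: "orthonormal_family d \<psi>"
  shows "(\<Sum>i<d. inner (\<psi> i) (C (\<psi> i))) \<le> (\<Sum>i<d. inner (\<phi> i) (C (\<phi> i)))"
proof (cases "d = 0")
  case False
  then have d: "0 < d" by simp
  obtain n lam where es: "enat d \<le> n" "ordered_eigensystem C n lam \<phi>"
    using lead unfolding leading_eigenvectors_def by blast
  note E = ordered_eigensystemD[OF es(2)]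
  have \<phi>: "orthonormal_family d \<phi>" by (rule leading_orthonormal[OF lead])
  have n: "enat k < n" if "k < d" for k
    using es(1) that by (meson enat_ord_simps(2) order_less_le_trans)
  define l where "l = lam (d - 1)"
  have l: "l \<le> lam k" if "k < d" for k
    unfolding l_def using E(4)[of k "d - 1"] n[of "d - 1"] that by auto
  have one: "inner v (C v) \<le> (\<Sum>k<d. (lam k - l) * (inner v (\<phi> k))\<^sup>2) + l * (norm v)\<^sup>2" for v
  proof -
    define p where "p = proj_on d \<phi> v"
    define r where "r = v - p"
    have r\<phi>: "inner r (\<phi> k) = 0" if "k < d" for k
      using inner_residual[OF \<phi> that] by (simp add: r_def p_def)
    have "C p = (\<Sum>k<d. inner v (\<phi> k) *\<^sub>R lam k *\<^sub>R \<phi> k)"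
      unfolding p_def proj_on_def linear_sum[OF bounded_linear.linear[OF C]]
      by (rule sum.cong) (auto simp: linear_scale[OF bounded_linear.linear[OF C]] E(2)[OF n])
    then have Cp: "inner u (C p) = (\<Sum>k<d. lam k * inner v (\<phi> k) * inner u (\<phi> k))" for u
      by (simp add: inner_sum_right mult_ac)
    have pk: "inner p (\<phi> k) = inner v (\<phi> k)" if "k < d" for k
      using inner_proj_on[OF \<phi> that] by (simp add: p_def)
    have pCp: "inner p (C p) = (\<Sum>k<d. lam k * (inner v (\<phi> k))\<^sup>2)"
      unfolding Cp by (rule sum.cong) (auto simp: pk power2_eq_square mult_ac)
    have rCp: "inner r (C p) = 0" unfolding Cp by (rule sum.neutral) (simp add: r\<phi>)
    have "v = p + r" by (simp add: r_def)
    then have "inner v (C v) = inner p (C p) + inner r (C p) + inner p (C r) + inner r (C r)"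
      by (simp add: linear_add[OF bounded_linear.linear[OF C]] inner_add_left inner_add_right)
    also have "inner p (C r) = inner r (C p)" by (metis sym inner_commute)
    also have "inner r (C r) \<le> l * (norm r)\<^sup>2"
      unfolding l_def by (rule rayleigh_tail[OF C es(2) d es(1) r\<phi>])
    also have "(norm r)\<^sup>2 = (norm v)\<^sup>2 - (\<Sum>k<d. (inner v (\<phi> k))\<^sup>2)"
      unfolding r_def p_def norm_residual[OF \<phi>] energy_def ..
    finally show ?thesis
      by (simp add: rCp pCp left_diff_distrib right_diff_distrib sum_subtractf sum_distrib_left)
  qed
  have "(\<Sum>i<d. inner (\<psi> i) (C (\<psi> i))) \<le> (\<Sum>i<d. (\<Sum>k<d. (lam k - l) * (inner (\<psi> i) (\<phi> k))\<^sup>2) + l)"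
  proof (rule sum_mono)
    fix i assume "i \<in> {..<d}"
    then have "(norm (\<psi> i))\<^sup>2 = 1"
      using orthonormal_familyD[OF \<psi>] by (simp add: power2_norm_eq_inner)
    then show "inner (\<psi> i) (C (\<psi> i)) \<le> (\<Sum>k<d. (lam k - l) * (inner (\<psi> i) (\<phi> k))\<^sup>2) + l"
      using one[of "\<psi> i"] by simp
  qed
  also have "\<dots> = (\<Sum>k<d. (lam k - l) * energy d \<psi> (\<phi> k)) + real d * l"
  proof -
    have "(\<Sum>i<d. \<Sum>k<d. (lam k - l) * (inner (\<psi> i) (\<phi> k))\<^sup>2)
        = (\<Sum>k<d. (lam k - l) * energy d \<psi> (\<phi> k))"
      by (subst sum.swap) (simp add: energy_def sum_distrib_left inner_commute)
    then show ?thesis by (simp add: sum.distrib)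
  qed
  also have "\<dots> \<le> (\<Sum>k<d. (lam k - l) * 1) + real d * l"
  proof (intro add_right_mono sum_mono mult_left_mono)
    fix k assume "k \<in> {..<d}"
    then have k: "k < d" by simp
    show "energy d \<psi> (\<phi> k) \<le> 1"
      using bessel[OF \<psi>, of "\<phi> k"] orthonormal_familyD[OF \<phi> k k] by (simp add: power2_norm_eq_inner)
    show "0 \<le> lam k - l" using l[OF k] by simp
  qed
  also have "\<dots> = (\<Sum>k<d. lam k)" by (simp add: sum_subtractf)
  also have "\<dots> = (\<Sum>i<d. inner (\<phi> i) (C (\<phi> i)))"
    by (rule sum.cong) (auto simp: E(1,2)[OF n] n)
  finally show ?thesis .
qed simp

lemma bounded_linear_empirical_covariance: "bounded_linear (empirical_covariance N u)"
  unfolding empirical_covariance_def tensor_op_def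
  by (intro bounded_linear_intros bounded_linear_compose[OF bounded_linear_scaleR_right]
      bounded_linear_sum bounded_linear_compose[OF bounded_linear_scaleR_left]) 

lemma inner_empirical_covariance:
  "inner v (empirical_covariance N u w) = (\<Sum>j<N. inner (u j) v * inner (u j) w) / real N"
  unfolding empirical_covariance_def tensor_op_def
  by (simp add: inner_sum_right inner_commute sum_divide_distrib mult.commute)

lemma empirical_energy_le:
  fixes u :: "nat \<Rightarrow> 'a::{real_inner, banach}"
  assumes "leading_eigenvectors (empirical_covariance N u) d \<phi>" "orthonormal_family d \<psi>" "0 < N"
  shows "(\<Sum>j<N. energy d \<psi> (u j)) \<le> (\<Sum>j<N. energy d \<phi> (u j))"
proof -
  have eq: "(\<Sum>i<d. inner (\<theta> i) (empirical_covariance N u (\<theta> i))) = (\<Sum>j<N. energy d \<theta> (u j)) / real N"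
    for \<theta> :: "nat \<Rightarrow> 'a"
    unfolding inner_empirical_covariance energy_def sum_divide_distrib[symmetric]
    by (subst sum.swap) (simp add: power2_eq_square)
  have "(\<Sum>i<d. inner (\<psi> i) (empirical_covariance N u (\<psi> i)))
      \<le> (\<Sum>i<d. inner (\<phi> i) (empirical_covariance N u (\<phi> i)))"
  proof (rule ky_fan[OF bounded_linear_empirical_covariance _ assms(1,2)])
    show "inner (empirical_covariance N u v) w = inner v (empirical_covariance N u w)" for v w
      by (subst inner_commute) (simp add: inner_empirical_covariance mult.commute)
  qed
  then show ?thesis using assms(3) by (simp add: eq divide_le_cancel)
qed

section \<open>Expected excess risk of empirical PCA\<close>

lemma nn_integral_PiM_component:
  assumes "prob_space \<mu>" "i \<in> I" and [measurable]: "f \<in> borel_measurable \<mu>"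
  shows "(\<integral>\<^sup>+\<omega>. f (\<omega> i) \<partial>Pi\<^sub>M I (\<lambda>_. \<mu>)) = (\<integral>\<^sup>+x. f x \<partial>\<mu>)"
proof -
  have [measurable]: "(\<lambda>\<omega>. \<omega> i) \<in> Pi\<^sub>M I (\<lambda>_. \<mu>) \<rightarrow>\<^sub>M \<mu>"
    using assms(2) by (rule measurable_component_singleton)
  show ?thesis
    using nn_integral_distr[of "\<lambda>\<omega>. \<omega> i" "Pi\<^sub>M I (\<lambda>_. \<mu>)" \<mu> f]
    by (simp add: distr_PiM_component[OF assms(1,2)])
qed

text \<open>
  Two distinct coordinates of an i.i.d. sample are independent.
\<close>
lemma nn_integral_PiM_pair:
  assumes \<mu>: "prob_space \<mu>" and I: "finite I" "i \<in> I" "j \<in> I" "i \<noteq> j"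
    and f[measurable]: "(\<lambda>(x, y). f x y) \<in> borel_measurable (\<mu> \<Otimes>\<^sub>M \<mu>)"
  shows "(\<integral>\<^sup>+\<omega>. f (\<omega> i) (\<omega> j) \<partial>Pi\<^sub>M I (\<lambda>_. \<mu>)) = (\<integral>\<^sup>+x. \<integral>\<^sup>+y. f x y \<partial>\<mu> \<partial>\<mu>)"
proof -
  interpret \<mu>: prob_space \<mu> by fact
  interpret P: product_sigma_finite "\<lambda>_. \<mu>" by unfold_locales
  define J where "J = I - {i}"
  have J: "finite J" "i \<notin> J" "j \<in> J" "insert i J = I" using I by (auto simp: J_def)
  have [measurable]: "(\<lambda>\<omega>. \<omega> k) \<in> Pi\<^sub>M (insert i J) (\<lambda>_. \<mu>) \<rightarrow>\<^sub>M \<mu>" if "k \<in> I" for k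
    using that J(4) by (intro measurable_component_singleton) auto
  have "(\<lambda>\<omega>. f (\<omega> i) (\<omega> j)) \<in> borel_measurable (Pi\<^sub>M (insert i J) (\<lambda>_. \<mu>))"
    using I(2,3) by measurable
  from P.product_nn_integral_insert_rev[OF J(1,2) this]
  have "(\<integral>\<^sup>+\<omega>. f (\<omega> i) (\<omega> j) \<partial>Pi\<^sub>M I (\<lambda>_. \<mu>))
      = (\<integral>\<^sup>+y. \<integral>\<^sup>+\<omega>. f y (\<omega> j) \<partial>Pi\<^sub>M J (\<lambda>_. \<mu>) \<partial>\<mu>)"
    using I(4) by (simp add: J(4))
  also have "\<dots> = (\<integral>\<^sup>+x. \<integral>\<^sup>+y. f x y \<partial>\<mu> \<partial>\<mu>)"
  proof (rule nn_integral_cong)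
    fix y assume "y \<in> space \<mu>"
    then have "(\<lambda>x. f y x) \<in> borel_measurable \<mu>" by measurable
    then show "(\<integral>\<^sup>+\<omega>. f y (\<omega> j) \<partial>Pi\<^sub>M J (\<lambda>_. \<mu>)) = (\<integral>\<^sup>+x. f y x \<partial>\<mu>)"
      by (rule nn_integral_PiM_component[OF \<mu> J(3)])
  qed
  finally show ?thesis .
qed

text \<open>
  The squared Hilbert--Schmidt norm of \<open>(\<Sum>j<N. u j \<otimes> u j) - (\<Sum>j<N. v j \<otimes> v j)\<close>, expressed by inner
  products, which makes it a measurable function of the points.
\<close>
definition gram_gap :: "nat \<Rightarrow> (nat \<Rightarrow> 'a::real_inner) \<Rightarrow> (nat \<Rightarrow> 'a) \<Rightarrow> real" where
  "gram_gap N u v = (\<Sum>j<N. \<Sum>k<N. (inner (u j) (u k))\<^sup>2) + (\<Sum>j<N. \<Sum>k<N. (inner (v j) (v k))\<^sup>2)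
     - 2 * (\<Sum>j<N. \<Sum>k<N. (inner (u j) (v k))\<^sup>2)"

lemma sum_two_samples:
  fixes f :: "nat + nat \<Rightarrow> real"
  shows "(\<Sum>a\<in>{..<N} <+> {..<N}. f a) = (\<Sum>j<N. f (Inl j)) + (\<Sum>j<N. f (Inr j))"
  by (subst sum.Plus) (auto simp: comp_def)

lemma gram_gap_eq_form:
  fixes u v :: "nat \<Rightarrow> 'a::real_inner" and N :: nat
  defines "A \<equiv> {..<N} <+> {..<N}" and "c \<equiv> case_sum (\<lambda>_. 1) (\<lambda>_. - 1)" and "w \<equiv> case_sum u v"
  shows "gram_gap N u v = (\<Sum>a\<in>A. \<Sum>b\<in>A. c a * c b * (inner (w a) (w b))\<^sup>2)"
proof -
  have "(\<Sum>j<N. \<Sum>k<N. (inner (v j) (u k))\<^sup>2) = (\<Sum>j<N. \<Sum>k<N. (inner (u j) (v k))\<^sup>2)"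
    by (subst sum.swap) (simp add: inner_commute)
  then show ?thesis
    unfolding A_def sum_two_samples gram_gap_def
    by (simp add: c_def w_def sum.distrib sum_negf sum_subtractf)
qed

lemma gram_gap_nonneg: "0 \<le> gram_gap N u v"
  unfolding gram_gap_eq_form by (rule gram_form_nonneg) simp

lemma energy_difference_le_gram_gap:
  assumes "orthonormal_family d \<phi>"
  shows "((\<Sum>j<N. energy d \<phi> (u j)) - (\<Sum>j<N. energy d \<phi> (v j)))\<^sup>2 \<le> real d * gram_gap N u v"
proof -
  let ?A = "{..<N} <+> {..<N}" and ?c = "case_sum (\<lambda>_. 1) (\<lambda>_. - 1) :: nat + nat \<Rightarrow> real"
  have "(\<Sum>a\<in>?A. ?c a * energy d \<phi> (case_sum u v a)) = (\<Sum>j<N. energy d \<phi> (u j)) - (\<Sum>j<N. energy d \<phi> (v j))"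
    unfolding sum_two_samples by (simp add: sum_negf)
  then show ?thesis
    using energy_sum_le_gram_form[OF _ assms, of ?A ?c "case_sum u v"]
    unfolding gram_gap_eq_form by simp
qed

lemma measurable_energy [measurable]:
  fixes U :: "'x \<Rightarrow> 'h::{real_inner, second_countable_topology}"
  assumes [measurable]: "U \<in> borel_measurable \<mu>"
  shows "(\<lambda>x. energy d \<phi> (U x)) \<in> borel_measurable \<mu>"
  unfolding energy_def by measurable

lemma integrable_norm_sq:
  fixes U :: "'x \<Rightarrow> 'h::{real_inner, second_countable_topology}"
  assumes "prob_space \<mu>" "U \<in> borel_measurable \<mu>" "integrable \<mu> (\<lambda>x. norm (U x) ^ 4)"
  shows "integrable \<mu> (\<lambda>x. (norm (U x))\<^sup>2)"
proof -
  interpret prob_space \<mu> by fact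
  note [measurable] = assms(2)
  have le: "t\<^sup>2 \<le> 1 + t ^ 4" for t :: real
  proof -
    have "0 \<le> (t\<^sup>2 - 1 / 2)\<^sup>2" by simp
    then show ?thesis by (simp add: power2_eq_square field_simps power4_eq_xxxx)
  qed
  show ?thesis
    by (rule Bochner_Integration.integrable_bound[of _ "\<lambda>x. 1 + norm (U x) ^ 4"])
      (use assms(3) le in \<open>auto simp: abs_of_nonneg\<close>)
qed

lemma integrable_energy:
  fixes U :: "'x \<Rightarrow> 'h::{real_inner, second_countable_topology}"
  assumes "U \<in> borel_measurable \<mu>" "integrable \<mu> (\<lambda>x. (norm (U x))\<^sup>2)" "orthonormal_family d \<phi>"
  shows "integrable \<mu> (\<lambda>x. energy d \<phi> (U x))"
  by (rule Bochner_Integration.integrable_bound[OF assms(2)])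
    (use assms(1) bessel[OF assms(3)] in \<open>auto simp: energy_nonneg abs_of_nonneg\<close>)

text \<open>
  The expected energy is the mean energy of an independent sample \<open>ys\<close>, and the absolute value moves
  inside the integral. The right-hand side is the same for all orthonormal families of length \<open>d\<close>,
  which is what allows \<open>\<phi>\<close> to depend on the sample.
\<close>
lemma ghost_sample_deviation:
  fixes U :: "'x \<Rightarrow> 'h::{real_inner, second_countable_topology}" and \<mu> :: "'x measure"
  defines "P \<equiv> \<lambda>N::nat. Pi\<^sub>M {..<N} (\<lambda>_. \<mu>)"
  assumes \<mu>: "prob_space \<mu>" and U: "U \<in> borel_measurable \<mu>"
    and int: "integrable \<mu> (\<lambda>x. (norm (U x))\<^sup>2)" and \<phi>: "orthonormal_family d \<phi>"
  shows "ennreal \<bar>(\<Sum>j<N. energy d \<phi> (u j)) - real N * (\<integral>x. energy d \<phi> (U x) \<partial>\<mu>)\<bar>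
    \<le> (\<integral>\<^sup>+ys. ennreal (sqrt (real d * gram_gap N u (\<lambda>j. U (ys j)))) \<partial>P N)"
proof -
  interpret P: prob_space "P N" unfolding P_def by (rule prob_space_PiM) (rule \<mu>)
  note [measurable] = U
  have comp[measurable]: "(\<lambda>ys. ys j) \<in> P N \<rightarrow>\<^sub>M \<mu>" if "j < N" for j
    unfolding P_def using that by (intro measurable_component_singleton) auto
  have dist: "distr (P N) \<mu> (\<lambda>ys. ys j) = \<mu>" if "j < N" for j
    unfolding P_def using that by (intro distr_PiM_component \<mu>) auto
  let ?E = "\<integral>x. energy d \<phi> (U x) \<partial>\<mu>"
  note ie = integrable_energy[OF U int \<phi>]
  have ij: "integrable (P N) (\<lambda>ys. energy d \<phi> (U (ys j)))" "(\<integral>ys. energy d \<phi> (U (ys j)) \<partial>P N) = ?E"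
    if "j < N" for j
  proof -
    have m: "(\<lambda>x. energy d \<phi> (U x)) \<in> borel_measurable \<mu>" by measurable
    show "integrable (P N) (\<lambda>ys. energy d \<phi> (U (ys j)))"
      using integrable_distr_eq[OF comp[OF that] m] ie by (simp add: dist[OF that])
    show "(\<integral>ys. energy d \<phi> (U (ys j)) \<partial>P N) = ?E"
      using integral_distr[OF comp[OF that] m] by (simp add: dist[OF that])
  qed
  define g where "g ys = (\<Sum>j<N. energy d \<phi> (u j)) - (\<Sum>j<N. energy d \<phi> (U (ys j)))" for ys
  have g_int: "integrable (P N) g" unfolding g_def using ij(1) by (intro Bochner_Integration.integrable_diff Bochner_Integration.integrable_sum) auto
  have "(\<integral>ys. g ys \<partial>P N) = (\<Sum>j<N. energy d \<phi> (u j)) - real N * ?E"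
  proof -
    have "(\<integral>ys. g ys \<partial>P N) = (\<integral>ys. (\<Sum>j<N. energy d \<phi> (u j)) \<partial>P N) - (\<integral>ys. (\<Sum>j<N. energy d \<phi> (U (ys j))) \<partial>P N)"
      unfolding g_def using ij(1) by (intro Bochner_Integration.integral_diff) auto
    also have "(\<integral>ys. (\<Sum>j<N. energy d \<phi> (U (ys j))) \<partial>P N) = (\<Sum>j<N. \<integral>ys. energy d \<phi> (U (ys j)) \<partial>P N)"
      using ij(1) by (intro Bochner_Integration.integral_sum) auto
    finally show ?thesis using ij(2) by (simp add: P.prob_space)
  qed
  then have "ennreal \<bar>(\<Sum>j<N. energy d \<phi> (u j)) - real N * ?E\<bar> \<le> (\<integral>\<^sup>+ys. ennreal \<bar>g ys\<bar> \<partial>P N)"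
    using integral_norm_bound_ennreal[OF g_int] by simp
  also have "\<dots> \<le> (\<integral>\<^sup>+ys. ennreal (sqrt (real d * gram_gap N u (\<lambda>j. U (ys j)))) \<partial>P N)"
    unfolding g_def
    by (intro nn_integral_mono ennreal_leI real_le_rsqrt) (simp add: energy_difference_le_gram_gap[OF \<phi>])
  finally show ?thesis .
qed

lemma measurable_gram_gap [measurable]:
  fixes U :: "'x \<Rightarrow> 'h::{real_inner, second_countable_topology}"
  assumes [measurable]: "U \<in> borel_measurable \<mu>"
  shows "(\<lambda>(xs, ys). gram_gap N (\<lambda>j. U (xs j)) (\<lambda>j. U (ys j)))
    \<in> borel_measurable (Pi\<^sub>M {..<N} (\<lambda>_. \<mu>) \<Otimes>\<^sub>M Pi\<^sub>M {..<N} (\<lambda>_. \<mu>))"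
proof -
  have [measurable]: "(\<lambda>ys. ys j) \<in> Pi\<^sub>M {..<N} (\<lambda>_. \<mu>) \<rightarrow>\<^sub>M \<mu>" if "j \<in> {..<N}" for j
    using that by (rule measurable_component_singleton)
  show ?thesis unfolding gram_gap_def by measurable
qed

text \<open>
  Let \<open>\<kappa>\<close> be the expected squared inner product of two independent points. The pairs within each
  sample contribute at most \<open>N\<^sup>2 * \<kappa> + N * m\<close>, the excess over \<open>N\<^sup>2 * \<kappa>\<close> coming from the diagonal. The
  mixed pairs contribute exactly \<open>- 2 * N\<^sup>2 * \<kappa>\<close>. The cancellation is done in the form
  \<open>gap + mixed = within + within\<close>, because the extended nonnegative reals have no negative numbers.
\<close>
lemma expected_gram_gap:
  fixes U :: "'x \<Rightarrow> 'h::{real_inner, second_countable_topology}" and \<mu> :: "'x measure"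
  defines "P \<equiv> \<lambda>N::nat. Pi\<^sub>M {..<N} (\<lambda>_. \<mu>)"
  assumes \<mu>: "prob_space \<mu>" and U: "U \<in> borel_measurable \<mu>"
    and m: "(\<integral>\<^sup>+x. ennreal (norm (U x) ^ 4) \<partial>\<mu>) \<le> ennreal m" "0 \<le> m"
  shows "(\<integral>\<^sup>+xs. \<integral>\<^sup>+ys. ennreal (gram_gap N (\<lambda>j. U (xs j)) (\<lambda>j. U (ys j))) \<partial>P N \<partial>P N)
    \<le> ennreal (2 * real N * m)"
proof -
  interpret \<mu>: prob_space \<mu> by fact
  interpret P: prob_space "P N" unfolding P_def by (rule prob_space_PiM) (rule \<mu>)
  note [measurable] = U
  have comp[measurable]: "(\<lambda>ys. ys j) \<in> P N \<rightarrow>\<^sub>M \<mu>" if "j \<in> {..<N}" for j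
    unfolding P_def using that by (rule measurable_component_singleton)
  define h where "h x y = ennreal ((inner (U x) (U y))\<^sup>2)" for x y
  have h[measurable]: "(\<lambda>(x, y). h x y) \<in> borel_measurable (\<mu> \<Otimes>\<^sub>M \<mu>)" unfolding h_def by measurable
  define \<kappa> where "\<kappa> = (\<integral>\<^sup>+x. \<integral>\<^sup>+y. h x y \<partial>\<mu> \<partial>\<mu>)"
  have h_le: "h x y \<le> ennreal (norm (U x) ^ 4) + ennreal (norm (U y) ^ 4)" for x y
  proof -
    have "(inner (U x) (U y))\<^sup>2 \<le> (norm (U x) * norm (U y))\<^sup>2"
      using power_mono[OF Cauchy_Schwarz_ineq2 abs_ge_zero, of "U x" "U y" 2] by simp
    also have "\<dots> \<le> norm (U x) ^ 4 + norm (U y) ^ 4"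
    proof -
      have "A * B \<le> A\<^sup>2 + B\<^sup>2" if "0 \<le> A" "0 \<le> B" for A B :: real
      proof -
        have "0 \<le> (A - B)\<^sup>2" "0 \<le> A * B" using that by simp_all
        then show ?thesis unfolding power2_diff by linarith
      qed
      from this[of "(norm (U x))\<^sup>2" "(norm (U y))\<^sup>2"] show ?thesis
        by (simp add: power_mult_distrib flip: power_mult)
    qed
    finally have "h x y \<le> ennreal (norm (U x) ^ 4 + norm (U y) ^ 4)"
      unfolding h_def by (rule ennreal_leI)
    also have "\<dots> = ennreal (norm (U x) ^ 4) + ennreal (norm (U y) ^ 4)"
      by (rule ennreal_plus) auto
    finally show ?thesis .
  qed
  have \<kappa>: "\<kappa> \<le> ennreal (2 * m)"
  proof -
    have "\<kappa> \<le> (\<integral>\<^sup>+x. \<integral>\<^sup>+y. ennreal (norm (U x) ^ 4) + ennreal (norm (U y) ^ 4) \<partial>\<mu> \<partial>\<mu>)"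
      unfolding \<kappa>_def by (intro nn_integral_mono h_le)
    also have "\<dots> = (\<integral>\<^sup>+x. ennreal (norm (U x) ^ 4) \<partial>\<mu>) + (\<integral>\<^sup>+y. ennreal (norm (U y) ^ 4) \<partial>\<mu>)"
      by (simp add: nn_integral_add \<mu>.emeasure_space_1)
    also have "\<dots> \<le> ennreal m + ennreal m" using m(1) by (intro add_mono)
    also have "\<dots> = ennreal (2 * m)" using m(2) by (simp flip: ennreal_plus)
    finally show ?thesis .
  qed
  have hm[measurable]: "(\<lambda>xs. h (xs j) (xs k)) \<in> borel_measurable (P N)"
    if "j \<in> {..<N}" "k \<in> {..<N}" for j k
    using that unfolding h_def by measurable
  have diag: "(\<integral>\<^sup>+xs. h (xs j) (xs k) \<partial>P N) \<le> \<kappa> + (if j = k then ennreal m else 0)"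
    if "j \<in> {..<N}" "k \<in> {..<N}" for j k
  proof (cases "j = k")
    case True
    have "(\<integral>\<^sup>+xs. h (xs j) (xs j) \<partial>P N) = (\<integral>\<^sup>+x. h x x \<partial>\<mu>)"
      unfolding P_def using \<mu> that(1)
      by (rule nn_integral_PiM_component[where f = "\<lambda>x. h x x"]) (unfold h_def, measurable)
    also have "\<dots> = (\<integral>\<^sup>+x. ennreal (norm (U x) ^ 4) \<partial>\<mu>)"
      by (simp add: h_def power2_norm_eq_inner[symmetric] flip: power_mult)
    finally show ?thesis using True m(1) by (simp add: add_increasing)
  next
    case False
    have "(\<integral>\<^sup>+xs. h (xs j) (xs k) \<partial>P N) = \<kappa>"
      unfolding P_def \<kappa>_def using \<mu> _ that False h by (rule nn_integral_PiM_pair) simp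
    then show ?thesis using False by simp
  qed
  have self: "(\<integral>\<^sup>+xs. (\<Sum>j<N. \<Sum>k<N. h (xs j) (xs k)) \<partial>P N) \<le> of_nat N * of_nat N * \<kappa> + of_nat N * ennreal m"
  proof -
    have "(\<integral>\<^sup>+xs. (\<Sum>j<N. \<Sum>k<N. h (xs j) (xs k)) \<partial>P N) = (\<Sum>j<N. \<Sum>k<N. \<integral>\<^sup>+xs. h (xs j) (xs k) \<partial>P N)"
      by (simp add: nn_integral_sum hm)
    also have "\<dots> \<le> (\<Sum>j<N. \<Sum>k<N. \<kappa> + (if j = k then ennreal m else 0))"
      by (intro sum_mono diag)
    also have "\<dots> = of_nat N * of_nat N * \<kappa> + of_nat N * ennreal m"
      by (simp add: sum.distrib mult.assoc distrib_left)
    finally show ?thesis .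
  qed
  have cross: "(\<integral>\<^sup>+xs. \<integral>\<^sup>+ys. h (xs j) (ys k) \<partial>P N \<partial>P N) = \<kappa>" if "j \<in> {..<N}" "k \<in> {..<N}" for j k
  proof -
    have "(\<integral>\<^sup>+xs. \<integral>\<^sup>+ys. h (xs j) (ys k) \<partial>P N \<partial>P N) = (\<integral>\<^sup>+xs. \<integral>\<^sup>+y. h (xs j) y \<partial>\<mu> \<partial>P N)"
      unfolding P_def using \<mu> that(2)
      by (intro nn_integral_cong nn_integral_PiM_component) (unfold h_def, measurable)
    also have "\<dots> = \<kappa>"
      unfolding P_def \<kappa>_def using \<mu> that(1)
      by (rule nn_integral_PiM_component[where f = "\<lambda>x. \<integral>\<^sup>+y. h x y \<partial>\<mu>"]) measurable
    finally show ?thesis .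
  qed
  let ?g = "\<lambda>xs ys. ennreal (gram_gap N (\<lambda>j. U (xs j)) (\<lambda>j. U (ys j)))"
  let ?c = "\<lambda>xs ys. 2 * (\<Sum>j<N. \<Sum>k<N. h (xs j) (ys k))"
  let ?s = "\<lambda>xs. \<Sum>j<N. \<Sum>k<N. h (xs j) (xs k)"
  have pt: "?g xs ys + ?c xs ys = ?s xs + ?s ys" for xs ys
  proof -
    have "?c xs ys = ennreal (2 * (\<Sum>j<N. \<Sum>k<N. (inner (U (xs j)) (U (ys k)))\<^sup>2))"
      by (simp add: h_def sum_nonneg ennreal_mult sum_ennreal)
    moreover have "?s zs = ennreal (\<Sum>j<N. \<Sum>k<N. (inner (U (zs j)) (U (zs k)))\<^sup>2)" for zs
      by (simp add: h_def sum_nonneg sum_ennreal)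
    ultimately show ?thesis
      using gram_gap_nonneg[of N "\<lambda>j. U (xs j)" "\<lambda>j. U (ys j)"]
      by (simp add: sum_nonneg gram_gap_def flip: ennreal_plus)
  qed
  have gm[measurable]: "(\<lambda>(xs, ys). ?g xs ys) \<in> borel_measurable (P N \<Otimes>\<^sub>M P N)"
    unfolding P_def by measurable
  have hc[measurable]: "(\<lambda>(xs, ys). h (xs j) (ys k)) \<in> borel_measurable (P N \<Otimes>\<^sub>M P N)"
    if "j \<in> {..<N}" "k \<in> {..<N}" for j k
    using that unfolding h_def by measurable
  have cm[measurable]: "(\<lambda>(xs, ys). ?c xs ys) \<in> borel_measurable (P N \<Otimes>\<^sub>M P N)"
    unfolding h_def by measurable
  have sm[measurable]: "?s \<in> borel_measurable (P N)" unfolding h_def by measurable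
  let ?G = "\<integral>\<^sup>+xs. \<integral>\<^sup>+ys. ?g xs ys \<partial>P N \<partial>P N"
  have c_int: "(\<integral>\<^sup>+xs. \<integral>\<^sup>+ys. ?c xs ys \<partial>P N \<partial>P N) = 2 * (of_nat N * of_nat N * \<kappa>)"
  proof -
    have "(\<integral>\<^sup>+xs. \<integral>\<^sup>+ys. ?c xs ys \<partial>P N \<partial>P N)
      = 2 * (\<Sum>j<N. \<Sum>k<N. \<integral>\<^sup>+xs. \<integral>\<^sup>+ys. h (xs j) (ys k) \<partial>P N \<partial>P N)"
    proof -
      have hy[measurable]: "(\<lambda>ys. h x (ys k)) \<in> borel_measurable (P N)" if "k \<in> {..<N}" for x k
        using that unfolding h_def by measurable
      have hxy[measurable]: "(\<lambda>xs. \<integral>\<^sup>+ys. h (xs j) (ys k) \<partial>P N) \<in> borel_measurable (P N)"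
        if "j \<in> {..<N}" "k \<in> {..<N}" for j k
        using that by measurable
      show ?thesis
        by (simp add: nn_integral_cmult nn_integral_sum hy hxy)
    qed
    also have "\<dots> = 2 * (\<Sum>j<N. \<Sum>k<N. \<kappa>)"
      using cross by (intro arg_cong[where f = "\<lambda>x. 2 * x"] sum.cong refl) auto
    finally show ?thesis by (simp add: mult.assoc)
  qed
  have "?G + 2 * (of_nat N * of_nat N * \<kappa>) = (\<integral>\<^sup>+xs. \<integral>\<^sup>+ys. ?g xs ys + ?c xs ys \<partial>P N \<partial>P N)"
    unfolding c_int[symmetric]
    by (subst nn_integral_add[symmetric], measurable, intro nn_integral_cong nn_integral_add[symmetric]) measurable
  also have "\<dots> = (\<integral>\<^sup>+xs. ?s xs \<partial>P N) + (\<integral>\<^sup>+ys. ?s ys \<partial>P N)"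
    unfolding pt by (simp add: nn_integral_add P.emeasure_space_1)
  also have "\<dots> \<le> (of_nat N * of_nat N * \<kappa> + of_nat N * ennreal m)
      + (of_nat N * of_nat N * \<kappa> + of_nat N * ennreal m)"
    by (intro add_mono self)
  also have "\<dots> = 2 * (of_nat N * of_nat N * \<kappa>) + ennreal (2 * real N * m)"
  proof -
    have 1: "of_nat N * ennreal m + of_nat N * ennreal m = ennreal (2 * real N * m)"
      using m(2) by (simp add: ennreal_of_nat_eq_real_of_nat flip: ennreal_mult' ennreal_plus)
    have 2: "(a + e) + (a + e) = 2 * a + (e + e)" for a e :: ennreal
      unfolding mult_2 by (simp only: ac_simps)
    show ?thesis unfolding 2 1 ..
  qed
  finally have "?G + 2 * (of_nat N * of_nat N * \<kappa>) \<le> 2 * (of_nat N * of_nat N * \<kappa>) + ennreal (2 * real N * m)" .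
  \<comment> \<open>Cancellation requires a finite summand.\<close>
  moreover have "2 * (of_nat N * of_nat N * \<kappa>) \<noteq> \<top>"
  proof -
    have "\<kappa> \<noteq> \<top>" using le_less_trans[OF \<kappa> ennreal_less_top] by simp
    then show ?thesis by (simp add: ennreal_mult_eq_top_iff ennreal_of_nat_eq_real_of_nat)
  qed
  ultimately show ?thesis by (simp add: add.commute[of ?G] ennreal_add_left_cancel_le)
qed

text \<open>
  Jensen's inequality in the elementary form \<open>sqrt q \<le> q / (2 * s) + s / 2\<close>, with \<open>s\<close> the bound to be
  proved.
\<close>
lemma expected_sqrt_gram_gap:
  fixes U :: "'x \<Rightarrow> 'h::{real_inner, second_countable_topology}" and \<mu> :: "'x measure"
  defines "P \<equiv> \<lambda>N::nat. Pi\<^sub>M {..<N} (\<lambda>_. \<mu>)"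
  assumes \<mu>: "prob_space \<mu>" and U: "U \<in> borel_measurable \<mu>"
    and m: "(\<integral>\<^sup>+x. ennreal (norm (U x) ^ 4) \<partial>\<mu>) \<le> ennreal m" "0 < m" and N: "0 < N"
  shows "(\<integral>\<^sup>+xs. \<integral>\<^sup>+ys. ennreal (sqrt (gram_gap N (\<lambda>j. U (xs j)) (\<lambda>j. U (ys j)))) \<partial>P N \<partial>P N)
    \<le> ennreal (sqrt (2 * real N * m))"
proof -
  interpret P: prob_space "P N" unfolding P_def by (rule prob_space_PiM) (rule \<mu>)
  define s where "s = sqrt (2 * real N * m)"
  have s: "0 < s" "s * s = 2 * real N * m" using m(2) N by (auto simp: s_def)
  let ?q = "\<lambda>xs ys. gram_gap N (\<lambda>j. U (xs j)) (\<lambda>j. U (ys j))"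
  have gm[measurable]: "(\<lambda>(xs, ys). ?q xs ys) \<in> borel_measurable (P N \<Otimes>\<^sub>M P N)"
    unfolding P_def by (rule measurable_gram_gap[OF U])
  have am_gm: "sqrt q \<le> 1 / (2 * s) * q + s / 2" if "0 \<le> q" for q
  proof -
    have "0 \<le> (sqrt q - s)\<^sup>2" by simp
    also have "\<dots> = q + s * s - 2 * s * sqrt q"
      using that by (simp add: power2_diff) (simp add: power2_eq_square)
    finally have "2 * s * sqrt q \<le> q + s * s" by simp
    then show ?thesis using s(1) by (simp add: field_simps)
  qed
  have "ennreal (sqrt (?q xs ys)) \<le> ennreal (1 / (2 * s)) * ennreal (?q xs ys) + ennreal (s / 2)" for xs ys
  proof -
    have "ennreal (sqrt (?q xs ys)) \<le> ennreal (1 / (2 * s) * ?q xs ys + s / 2)"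
      by (rule ennreal_leI[OF am_gm[OF gram_gap_nonneg]])
    also have "\<dots> = ennreal (1 / (2 * s)) * ennreal (?q xs ys) + ennreal (s / 2)"
    proof -
      have c: "0 \<le> 1 / (2 * s)" "0 \<le> s / 2" using s(1) by auto
      show ?thesis
        unfolding ennreal_plus[OF mult_nonneg_nonneg[OF c(1) gram_gap_nonneg] c(2)] ennreal_mult'[OF c(1)] ..
    qed
    finally show ?thesis .
  qed
  then have "(\<integral>\<^sup>+xs. \<integral>\<^sup>+ys. ennreal (sqrt (?q xs ys)) \<partial>P N \<partial>P N)
      \<le> (\<integral>\<^sup>+xs. \<integral>\<^sup>+ys. ennreal (1 / (2 * s)) * ennreal (?q xs ys) + ennreal (s / 2) \<partial>P N \<partial>P N)"
    by (intro nn_integral_mono)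
  also have "\<dots> = ennreal (1 / (2 * s)) * (\<integral>\<^sup>+xs. \<integral>\<^sup>+ys. ennreal (?q xs ys) \<partial>P N \<partial>P N) + ennreal (s / 2)"
  proof -
    have "(\<integral>\<^sup>+ys. ennreal (1 / (2 * s)) * ennreal (?q xs ys) + ennreal (s / 2) \<partial>P N)
        = ennreal (1 / (2 * s)) * (\<integral>\<^sup>+ys. ennreal (?q xs ys) \<partial>P N) + ennreal (s / 2)"
      if "xs \<in> space (P N)" for xs
    proof -
      have [measurable]: "(\<lambda>ys. ?q xs ys) \<in> borel_measurable (P N)"
        using measurable_Pair2[OF gm that] by simp
      show ?thesis by (simp add: nn_integral_add nn_integral_cmult P.emeasure_space_1)
    qed
    then have "(\<integral>\<^sup>+xs. \<integral>\<^sup>+ys. ennreal (1 / (2 * s)) * ennreal (?q xs ys) + ennreal (s / 2) \<partial>P N \<partial>P N)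
        = (\<integral>\<^sup>+xs. ennreal (1 / (2 * s)) * (\<integral>\<^sup>+ys. ennreal (?q xs ys) \<partial>P N) + ennreal (s / 2) \<partial>P N)"
      by (intro nn_integral_cong)
    also have "\<dots> = ennreal (1 / (2 * s)) * (\<integral>\<^sup>+xs. \<integral>\<^sup>+ys. ennreal (?q xs ys) \<partial>P N \<partial>P N) + ennreal (s / 2)"
    proof -
      have [measurable]: "(\<lambda>xs. \<integral>\<^sup>+ys. ennreal (?q xs ys) \<partial>P N) \<in> borel_measurable (P N)"
        by (rule P.borel_measurable_nn_integral) measurable
      show ?thesis by (simp add: nn_integral_add nn_integral_cmult P.emeasure_space_1)
    qed
    finally show ?thesis .
  qed
  also have "\<dots> \<le> ennreal (1 / (2 * s)) * ennreal (2 * real N * m) + ennreal (s / 2)"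
    unfolding P_def using m(2)
    by (intro add_right_mono mult_left_mono expected_gram_gap[OF \<mu> U m(1)]) auto
  also have "\<dots> = ennreal (1 / (2 * s) * (s * s) + s / 2)"
    using s(1) by (subst ennreal_plus) (auto simp: s(2)[symmetric] ennreal_mult'[symmetric])
  also have "1 / (2 * s) * (s * s) + s / 2 = s" using s(1) by (simp add: field_simps)
  finally show ?thesis by (simp add: s_def)
qed

text \<open>
  Both residuals are \<open>E (norm U)\<^sup>2\<close> minus a captured energy, so their difference is a difference of
  expected energies. Replacing these by the energies of the sample costs two deviations, each bounded
  by \<open>ghost_sample_deviation\<close>, and the difference of the sample energies has the right sign by
  \<open>empirical_energy_le\<close>. The majorant \<open>G\<close> is chosen before \<open>\<phi>\<close> and is measurable, whereas \<open>\<phi>\<close> may depend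
  on the sample in any way.
\<close>
lemma pca_excess_risk:
  fixes U :: "'x \<Rightarrow> 'h::{real_inner, banach, second_countable_topology}" and \<mu> :: "'x measure"
  defines "P \<equiv> \<lambda>N::nat. Pi\<^sub>M {..<N} (\<lambda>_. \<mu>)"
  assumes \<mu>: "prob_space \<mu>" and U: "U \<in> borel_measurable \<mu>"
    and U4: "integrable \<mu> (\<lambda>x. norm (U x) ^ 4)"
    and m: "(\<integral>x. norm (U x) ^ 4 \<partial>\<mu>) \<le> m" "0 < m" and N: "0 < N"
  shows "\<exists>G. G \<in> borel_measurable (P N) \<and>
    (\<integral>\<^sup>+xs. G xs \<partial>P N) \<le> ennreal (2 * sqrt (2 * m) * sqrt (real d / real N)) \<and>
    (\<forall>xs \<phi> \<psi>. xs \<in> space (P N) \<longrightarrow>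
      leading_eigenvectors (empirical_covariance N (\<lambda>j. U (xs j))) d \<phi> \<longrightarrow> orthonormal_family d \<psi> \<longrightarrow>
      (\<integral>\<^sup>+x. ennreal ((norm (U x - proj_on d \<phi> (U x)))\<^sup>2) \<partial>\<mu>)
        \<le> ennreal (\<integral>x. (norm (U x - proj_on d \<psi> (U x)))\<^sup>2 \<partial>\<mu>) + G xs)"
proof -
  interpret \<mu>: prob_space \<mu> by fact
  interpret P: prob_space "P N" unfolding P_def by (rule prob_space_PiM) (rule \<mu>)
  note [measurable] = U
  let ?q = "\<lambda>xs ys. gram_gap N (\<lambda>j. U (xs j)) (\<lambda>j. U (ys j))"
  have gm[measurable]: "(\<lambda>(xs, ys). ?q xs ys) \<in> borel_measurable (P N \<Otimes>\<^sub>M P N)"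
    unfolding P_def by (rule measurable_gram_gap[OF U])
  define I where "I xs = (\<integral>\<^sup>+ys. ennreal (sqrt (?q xs ys)) \<partial>P N)" for xs
  have [measurable]: "I \<in> borel_measurable (P N)"
    unfolding I_def by (rule P.borel_measurable_nn_integral) measurable
  define b where "b = 2 * sqrt (real d) / real N"
  have b: "0 \<le> b" by (simp add: b_def)
  define G where "G xs = ennreal b * I xs" for xs
  have U2: "integrable \<mu> (\<lambda>x. (norm (U x))\<^sup>2)" by (rule integrable_norm_sq[OF \<mu> U U4])
  have "(\<integral>\<^sup>+x. ennreal (norm (U x) ^ 4) \<partial>\<mu>) \<le> ennreal m"
    using nn_integral_eq_integral[OF U4] m(1) by (simp add: ennreal_leI)
  then have "(\<integral>\<^sup>+xs. I xs \<partial>P N) \<le> ennreal (sqrt (2 * real N * m))"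
    unfolding I_def P_def using m(2) N by (intro expected_sqrt_gram_gap[OF \<mu> U]) auto
  then have "(\<integral>\<^sup>+xs. G xs \<partial>P N) \<le> ennreal b * ennreal (sqrt (2 * real N * m))"
    unfolding G_def by (simp add: nn_integral_cmult mult_left_mono)
  also have "\<dots> = ennreal (b * sqrt (2 * real N * m))" using b by (rule ennreal_mult'[symmetric])
  also have "b * sqrt (2 * real N * m) = 2 * sqrt (2 * m) * sqrt (real d / real N)"
  proof -
    have "real N = sqrt (real N) * sqrt (real N)" by simp
    then show ?thesis using N unfolding b_def
      by (simp add: real_sqrt_mult real_sqrt_divide field_simps)
  qed
  finally have G_int: "(\<integral>\<^sup>+xs. G xs \<partial>P N) \<le> ennreal (2 * sqrt (2 * m) * sqrt (real d / real N))" .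
  have main: "(\<integral>\<^sup>+x. ennreal ((norm (U x - proj_on d \<phi> (U x)))\<^sup>2) \<partial>\<mu>)
        \<le> ennreal (\<integral>x. (norm (U x - proj_on d \<psi> (U x)))\<^sup>2 \<partial>\<mu>) + G xs"
    if xs: "xs \<in> space (P N)"
      and lead: "leading_eigenvectors (empirical_covariance N (\<lambda>j. U (xs j))) d \<phi>"
      and \<psi>: "orthonormal_family d \<psi>" for xs \<phi> \<psi>
  proof -
    note \<phi> = leading_orthonormal[OF lead]
    define E where "E \<theta> = (\<integral>x. energy d \<theta> (U x) \<partial>\<mu>)" for \<theta>
    define S where "S \<theta> = (\<Sum>j<N. energy d \<theta> (U (xs j)))" for \<theta>
    define R where "R \<theta> = (\<integral>x. (norm (U x - proj_on d \<theta> (U x)))\<^sup>2 \<partial>\<mu>)" for \<theta>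
    have R: "R \<theta> = (\<integral>x. (norm (U x))\<^sup>2 \<partial>\<mu>) - E \<theta>"
        "(\<integral>\<^sup>+x. ennreal ((norm (U x - proj_on d \<theta> (U x)))\<^sup>2) \<partial>\<mu>) = ennreal (R \<theta>)"
      if "orthonormal_family d \<theta>" for \<theta>
    proof -
      note ie = integrable_energy[OF U U2 that]
      show "R \<theta> = (\<integral>x. (norm (U x))\<^sup>2 \<partial>\<mu>) - E \<theta>"
        unfolding R_def E_def norm_residual[OF that] by (rule Bochner_Integration.integral_diff[OF U2 ie])
      have "integrable \<mu> (\<lambda>x. (norm (U x - proj_on d \<theta> (U x)))\<^sup>2)"
        unfolding norm_residual[OF that] by (rule Bochner_Integration.integrable_diff[OF U2 ie])
      then show "(\<integral>\<^sup>+x. ennreal ((norm (U x - proj_on d \<theta> (U x)))\<^sup>2) \<partial>\<mu>) = ennreal (R \<theta>)"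
        unfolding R_def by (rule nn_integral_eq_integral) simp
    qed
    have dev: "ennreal \<bar>S \<theta> - real N * E \<theta>\<bar> \<le> ennreal (sqrt (real d)) * I xs"
      if "orthonormal_family d \<theta>" for \<theta>
    proof -
      have [measurable]: "(\<lambda>ys. ?q xs ys) \<in> borel_measurable (P N)"
        using measurable_Pair2[OF gm xs] by simp
      have "ennreal \<bar>S \<theta> - real N * E \<theta>\<bar> \<le> (\<integral>\<^sup>+ys. ennreal (sqrt (real d * ?q xs ys)) \<partial>P N)"
        unfolding S_def E_def P_def by (rule ghost_sample_deviation[OF \<mu> U U2 that])
      also have "\<dots> = ennreal (sqrt (real d)) * I xs"
        unfolding I_def real_sqrt_mult
        by (simp add: ennreal_mult' nn_integral_cmult)
      finally show ?thesis .
    qed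
    have "S \<psi> \<le> S \<phi>" unfolding S_def by (rule empirical_energy_le[OF lead \<psi> N])
    then have "real N * (E \<psi> - E \<phi>) \<le> \<bar>S \<psi> - real N * E \<psi>\<bar> + \<bar>S \<phi> - real N * E \<phi>\<bar>"
      by (simp add: right_diff_distrib)
    then have "E \<psi> - E \<phi> \<le> (1 / real N) * (\<bar>S \<psi> - real N * E \<psi>\<bar> + \<bar>S \<phi> - real N * E \<phi>\<bar>)"
      using N by (simp add: field_simps)
    then have "R \<phi> \<le> R \<psi> + (1 / real N) * (\<bar>S \<psi> - real N * E \<psi>\<bar> + \<bar>S \<phi> - real N * E \<phi>\<bar>)"
      using R(1)[OF \<phi>] R(1)[OF \<psi>] by simp
    then have "ennreal (R \<phi>) \<le> ennreal (R \<psi> + (1 / real N) * (\<bar>S \<psi> - real N * E \<psi>\<bar> + \<bar>S \<phi> - real N * E \<phi>\<bar>))"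
      by (rule ennreal_leI)
    also have "\<dots> = ennreal (R \<psi>) + ennreal (1 / real N) *
        (ennreal \<bar>S \<psi> - real N * E \<psi>\<bar> + ennreal \<bar>S \<phi> - real N * E \<phi>\<bar>)"
    proof -
      have "ennreal (r + c * (v + w)) = ennreal r + ennreal c * (ennreal v + ennreal w)"
        if "0 \<le> r" "0 \<le> c" "0 \<le> v" "0 \<le> w" for r c v w
        unfolding ennreal_plus[OF that(3,4), symmetric] ennreal_mult'[OF that(2), symmetric]
        using that by (intro ennreal_plus) auto
      then show ?thesis by (simp only: R_def integral_nonneg abs_ge_zero zero_le_power2
          zero_le_divide_1_iff of_nat_0_le_iff Bochner_Integration.integral_nonneg)
    qed
    also have "\<dots> \<le> ennreal (R \<psi>) + ennreal (1 / real N) *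
        (ennreal (sqrt (real d)) * I xs + ennreal (sqrt (real d)) * I xs)"
      by (intro add_left_mono mult_left_mono add_mono dev \<phi> \<psi>) simp
    also have "ennreal (1 / real N) * (ennreal (sqrt (real d)) * I xs + ennreal (sqrt (real d)) * I xs) = G xs"
    proof -
      have "ennreal b = ennreal (1 / real N) * (2 * ennreal (sqrt (real d)))"
        by (simp add: b_def flip: ennreal_mult' ennreal_numeral)
      then show ?thesis by (simp add: G_def mult_2[symmetric] mult.assoc)
    qed
    finally show ?thesis unfolding R(2)[OF \<phi>] unfolding R_def .
  qed
  have "G \<in> borel_measurable (P N)" unfolding G_def by measurable
  with G_int main show ?thesis by blast
qed

section \<open>Error for a fixed sample\<close>

text \<open>
  The Lipschitz condition with respect to the \<open>\<ell>\<^sup>1\<close> norm that \<open>lipschitz_relu_approx\<close> asks for.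
\<close>
lemma latent_map_lipschitz:
  fixes \<Psi> :: "'x::real_inner \<Rightarrow> 'y::real_inner"
  assumes lip: "L-lipschitz_on UNIV \<Psi>" and \<phi>: "orthonormal_family n \<phi>"
    and \<psi>: "orthonormal_family m \<psi>" "j < m"
  shows "\<bar>inner (\<Psi> (pca_decoder n \<phi> s)) (\<psi> j) - inner (\<Psi> (pca_decoder n \<phi> s')) (\<psi> j)\<bar>
    \<le> L * (\<Sum>i<n. \<bar>vec_index s i - vec_index s' i\<bar>)"
proof -
  let ?a = "pca_decoder n \<phi> s" and ?b = "pca_decoder n \<phi> s'"
  have L: "0 \<le> L" using lip by (rule lipschitz_on_nonneg)
  have one: "norm (\<phi> i) = 1" if "i < n" for i
    using orthonormal_familyD[OF \<phi> that that] by (simp add: norm_eq_sqrt_inner)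
  have "\<bar>inner (\<Psi> ?a) (\<psi> j) - inner (\<Psi> ?b) (\<psi> j)\<bar> \<le> norm (\<Psi> ?a - \<Psi> ?b)"
    using abs_inner_orthonormal_le[OF \<psi>, of "\<Psi> ?a - \<Psi> ?b"] by (simp add: inner_diff_left)
  also have "\<dots> \<le> L * norm (?a - ?b)"
    using lipschitz_onD[OF lip, of ?a ?b] by (simp add: dist_norm)
  also have "norm (?a - ?b) \<le> (\<Sum>i<n. \<bar>vec_index s i - vec_index s' i\<bar>)"
  proof -
    have "?a - ?b = (\<Sum>i<n. (vec_index s i - vec_index s' i) *\<^sub>R \<phi> i)"
      by (simp add: pca_decoder_def scaleR_diff_left sum_subtractf)
    also have "norm \<dots> \<le> (\<Sum>i<n. norm ((vec_index s i - vec_index s' i) *\<^sub>R \<phi> i))"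
      by (rule norm_sum)
    also have "\<dots> = (\<Sum>i<n. \<bar>vec_index s i - vec_index s' i\<bar>)"
      by (rule sum.cong) (auto simp: one)
    finally show ?thesis .
  qed
  finally show ?thesis using L by (simp add: mult_left_mono)
qed

text \<open>
  With \<open>z = \<Psi> (P x)\<close>, where \<open>P\<close> and \<open>Q\<close> are the projections onto the spans of \<open>\<phi>\<close> and \<open>\<psi>\<close>, the error is
  \<open>(decoded network - Q z) + Q (z - \<Psi> x) + (Q (\<Psi> x) - \<Psi> x)\<close>. The first part sums \<open>m\<close> coordinate errors,
  which explains the accuracy \<open>\<tau> / sqrt m\<close> of each coordinate, and the second part is at most
  \<open>L * norm (x - P x)\<close>. The factor 3 comes from squaring a sum of three terms.
\<close>
lemma nn_error_on_cube:
  fixes \<Psi> :: "'x::real_inner \<Rightarrow> 'y::real_inner"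
  assumes lip: "L-lipschitz_on UNIV \<Psi>" and \<phi>: "orthonormal_family n \<phi>" and \<psi>: "orthonormal_family m \<psi>"
    and m: "1 \<le> m" and \<tau>: "0 < \<tau>"
    and approx: "\<And>j. j < m \<Longrightarrow> \<bar>vec_index (g (pca_encoder n \<phi> x)) j
        - inner (\<Psi> (pca_decoder n \<phi> (pca_encoder n \<phi> x))) (\<psi> j)\<bar> \<le> 2 * L * \<tau> / sqrt (real m)"
  shows "(nn_error n \<phi> m \<psi> g \<Psi> x)\<^sup>2 \<le> 12 * L\<^sup>2 * \<tau>\<^sup>2
    + 3 * L\<^sup>2 * (norm (x - proj_on n \<phi> x))\<^sup>2 + 3 * (norm (\<Psi> x - proj_on m \<psi> (\<Psi> x)))\<^sup>2"
proof -
  have L: "0 \<le> L" using lip by (rule lipschitz_on_nonneg)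
  define s where "s = pca_encoder n \<phi> x"
  have dec: "pca_decoder n \<phi> s = proj_on n \<phi> x"
    by (simp add: s_def pca_decoder_def pca_encoder_def proj_on_def)
  define z where "z = \<Psi> (proj_on n \<phi> x)"
  define a where "a = (\<Sum>j<m. (vec_index (g s) j - inner z (\<psi> j)) *\<^sub>R \<psi> j)"
  define b where "b = proj_on m \<psi> (z - \<Psi> x)"
  define c where "c = proj_on m \<psi> (\<Psi> x) - \<Psi> x"
  have "nn_error n \<phi> m \<psi> g \<Psi> x = norm (a + b + c)"
    unfolding nn_error_def a_def b_def c_def proj_on_diff[symmetric]
    by (simp add: s_def[symmetric] pca_decoder_def[of m] proj_on_def[of m] scaleR_diff_left sum_subtractf)
  also have "\<dots> \<le> norm a + norm b + norm c"
    using norm_triangle_ineq[of "a + b" c] norm_triangle_ineq[of a b] by linarith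
  finally have "(nn_error n \<phi> m \<psi> g \<Psi> x)\<^sup>2 \<le> (norm a + norm b + norm c)\<^sup>2"
    by (rule power_mono) (simp add: nn_error_def)
  also have "\<dots> \<le> 3 * ((norm a)\<^sup>2 + (norm b)\<^sup>2 + (norm c)\<^sup>2)"
  proof -
    have "0 \<le> (norm a - norm b)\<^sup>2 + (norm b - norm c)\<^sup>2 + (norm a - norm c)\<^sup>2" by simp
    then show ?thesis by (simp add: power2_eq_square algebra_simps)
  qed
  also have "(norm a)\<^sup>2 \<le> 4 * L\<^sup>2 * \<tau>\<^sup>2"
  proof -
    have "(norm a)\<^sup>2 = (\<Sum>j<m. (vec_index (g s) j - inner z (\<psi> j))\<^sup>2)"
      unfolding a_def by (rule norm_combination[OF \<psi>])
    also have "\<dots> \<le> (\<Sum>j<m. (2 * L * \<tau> / sqrt (real m))\<^sup>2)"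
    proof (rule sum_mono)
      fix j assume "j \<in> {..<m}"
      then have "\<bar>vec_index (g s) j - inner z (\<psi> j)\<bar> \<le> 2 * L * \<tau> / sqrt (real m)"
        using approx[of j] by (simp add: s_def[symmetric] dec z_def)
      from power_mono[OF this abs_ge_zero, of 2]
      show "(vec_index (g s) j - inner z (\<psi> j))\<^sup>2 \<le> (2 * L * \<tau> / sqrt (real m))\<^sup>2" by simp
    qed
    also have "\<dots> = 4 * L\<^sup>2 * \<tau>\<^sup>2" using m by (simp add: power_divide power_mult_distrib)
    finally show ?thesis .
  qed
  also have "(norm b)\<^sup>2 \<le> L\<^sup>2 * (norm (x - proj_on n \<phi> x))\<^sup>2"
  proof -
    have "norm b \<le> norm (z - \<Psi> x)" unfolding b_def by (rule norm_proj_on_le[OF \<psi>])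
    also have "\<dots> \<le> L * norm (x - proj_on n \<phi> x)"
      using lipschitz_onD[OF lip, of "proj_on n \<phi> x" x] by (simp add: z_def dist_norm norm_minus_commute)
    finally show ?thesis using power_mono[of "norm b" _ 2] by (simp flip: power_mult_distrib)
  qed
  also have "norm c = norm (\<Psi> x - proj_on m \<psi> (\<Psi> x))" unfolding c_def by (rule norm_minus_commute)
  finally show ?thesis by (simp add: algebra_simps)
qed

lemma pca_decoder_zero [simp]: "pca_decoder m \<psi> (0\<^sub>v m) = 0"
  by (simp add: pca_decoder_def)

text \<open>
  If the code leaves the cube then \<open>1 \<le> (norm x)\<^sup>2 / M\<^sup>2\<close>. Hence \<open>u = (norm (\<Psi> x))\<^sup>2\<close> satisfies
  \<open>u \<le> s / 2 * u\<^sup>2 + (norm x)\<^sup>2 / (2 * s * M\<^sup>2)\<close> for all \<open>s > 0\<close>. For \<open>s = sqrt \<delta>\<close> both terms have expectation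
  of order \<open>sqrt \<delta>\<close>, since \<open>M\<^sup>2 * \<delta>\<close> is the second moment.
\<close>
lemma nn_error_off_cube:
  fixes \<Psi> :: "'x::real_inner \<Rightarrow> 'y::real_inner"
  assumes \<phi>: "orthonormal_family n \<phi>" and M: "0 < M" and \<delta>: "0 < \<delta>"
    and out: "pca_encoder n \<phi> x \<notin> cube n M" and g: "g (pca_encoder n \<phi> x) = 0\<^sub>v m"
  shows "(nn_error n \<phi> m \<psi> g \<Psi> x)\<^sup>2 \<le> sqrt \<delta> / 2 * norm (\<Psi> x) ^ 4 + (norm x)\<^sup>2 / (2 * sqrt \<delta> * M\<^sup>2)"
proof -
  have e: "nn_error n \<phi> m \<psi> g \<Psi> x = norm (\<Psi> x)" by (simp add: nn_error_def g)
  obtain i where i: "i < n" "\<not> (\<bar>inner x (\<phi> i)\<bar> \<le> M)"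
    using out by (auto simp: cube_def pca_encoder_def abs_le_iff)
  then have "M \<le> norm x" using abs_inner_orthonormal_le[OF \<phi> i(1), of x] by linarith
  then have "M\<^sup>2 \<le> (norm x)\<^sup>2" using M by (intro power_mono) auto
  then have one: "1 \<le> (norm x)\<^sup>2 / M\<^sup>2" using M by simp
  define s where "s = sqrt \<delta>"
  have s: "0 < s" using \<delta> by (simp add: s_def)
  define u where "u = (norm (\<Psi> x))\<^sup>2"
  have "0 \<le> (s * u - 1)\<^sup>2" by simp
  then have "2 * (s * u) \<le> s * s * u\<^sup>2 + 1" by (simp add: power2_eq_square algebra_simps)
  then have "u \<le> s / 2 * u\<^sup>2 + 1 / (2 * s)" using s by (simp add: field_simps power2_eq_square)
  also have "1 / (2 * s) \<le> 1 / (2 * s) * ((norm x)\<^sup>2 / M\<^sup>2)"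
    using one s mult_left_mono[OF one, of "1 / (2 * s)"] by simp
  finally show ?thesis by (simp add: e u_def s_def[symmetric] flip: power_mult)
qed

text \<open>
  The upper integral is controlled by any measurable majorant, whether or not \<open>f\<close> is measurable.
\<close>
lemma upper_nn_integral_le:
  assumes "G \<in> borel_measurable M" "\<And>x. x \<in> space M \<Longrightarrow> f x \<le> G x"
  shows "upper_nn_integral M f \<le> (\<integral>\<^sup>+x. G x \<partial>M)"
  unfolding upper_nn_integral_def using assms by (intro INF_lower) auto

lemma integrable_lipschitz_norm4:
  fixes \<Psi> :: "'x::{real_inner, second_countable_topology} \<Rightarrow> 'y::{real_inner, second_countable_topology}"
  assumes \<mu>: "prob_space \<mu>" "integrable \<mu> (\<lambda>x. norm x ^ 4)"
    and \<Psi>: "\<Psi> \<in> borel_measurable \<mu>" and lip: "L-lipschitz_on UNIV \<Psi>"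
  shows "integrable \<mu> (\<lambda>x. norm (\<Psi> x) ^ 4)"
proof -
  interpret prob_space \<mu> by fact
  have L: "0 \<le> L" using lip by (rule lipschitz_on_nonneg)
  have sum4: "(a + b) ^ 4 \<le> 8 * (a ^ 4 + b ^ 4)" for a b :: real
  proof -
    have sq: "(u + v)\<^sup>2 \<le> 2 * (u\<^sup>2 + v\<^sup>2)" for u v :: real
      using zero_le_power2[of "u - v"] by (simp add: power2_eq_square algebra_simps)
    have two: "(2 * u)\<^sup>2 = 4 * u\<^sup>2" for u :: real by (simp add: power_mult_distrib)
    have "(a + b) ^ 4 = ((a + b)\<^sup>2)\<^sup>2" unfolding power_mult[symmetric] by simp
    also have "\<dots> \<le> (2 * (a\<^sup>2 + b\<^sup>2))\<^sup>2" by (intro power_mono sq) simp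
    also have "\<dots> = 4 * (a\<^sup>2 + b\<^sup>2)\<^sup>2" by (rule two)
    also have "\<dots> \<le> 4 * (2 * ((a\<^sup>2)\<^sup>2 + (b\<^sup>2)\<^sup>2))" by (intro mult_left_mono sq) simp
    also have "\<dots> = 8 * (a ^ 4 + b ^ 4)" unfolding power_mult[symmetric] by simp
    finally show ?thesis .
  qed
  have bound: "norm (\<Psi> x) ^ 4 \<le> 8 * (norm (\<Psi> 0) ^ 4 + L ^ 4 * norm x ^ 4)" for x
  proof -
    have "norm (\<Psi> x - \<Psi> 0) \<le> L * norm x"
      using lipschitz_onD[OF lip UNIV_I UNIV_I, of x 0] by (simp only: dist_norm diff_0_right)
    then have "norm (\<Psi> x) \<le> norm (\<Psi> 0) + L * norm x"
      using norm_triangle_sub[of "\<Psi> x" "\<Psi> 0"] by linarith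
    then have "norm (\<Psi> x) ^ 4 \<le> (norm (\<Psi> 0) + L * norm x) ^ 4" by (intro power_mono) auto
    also have "\<dots> \<le> 8 * (norm (\<Psi> 0) ^ 4 + (L * norm x) ^ 4)" by (rule sum4)
    finally show ?thesis unfolding power_mult_distrib .
  qed
  show ?thesis
  proof (rule Bochner_Integration.integrable_bound)
    show "integrable \<mu> (\<lambda>x. 8 * (norm (\<Psi> 0) ^ 4 + L ^ 4 * norm x ^ 4))"
      using \<mu>(2) by simp
    show "(\<lambda>x. norm (\<Psi> x) ^ 4) \<in> borel_measurable \<mu>" using \<Psi> by measurable
    show "AE x in \<mu>. norm (norm (\<Psi> x) ^ 4) \<le> norm (8 * (norm (\<Psi> 0) ^ 4 + L ^ 4 * norm x ^ 4))"
    proof (rule AE_I2)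
      fix x
      have "norm (norm (\<Psi> x) ^ 4) = norm (\<Psi> x) ^ 4" by simp
      also have "\<dots> \<le> norm (8 * (norm (\<Psi> 0) ^ 4 + L ^ 4 * norm x ^ 4))"
        unfolding real_norm_def by (rule order_trans[OF bound abs_ge_self])
      finally show "norm (norm (\<Psi> x) ^ 4) \<le> norm (8 * (norm (\<Psi> 0) ^ 4 + L ^ 4 * norm x ^ 4))" .
    qed
  qed
qed

lemma projection_error_span:
  fixes \<nu> :: "'a::{real_inner, banach, second_countable_topology} measure"
  assumes "optimal_projection_space \<nu> d V"
  obtains \<phi> where "orthonormal_family d \<phi>"
    "projection_error \<nu> V = (\<integral>u. (norm (u - proj_on d \<phi> u))\<^sup>2 \<partial>\<nu>)"
proof -
  obtain \<phi> where \<phi>: "leading_eigenvectors (covariance \<nu>) d \<phi>" "V = span (\<phi> ` {..<d})"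
    using assms unfolding optimal_projection_space_def by blast
  have on: "orthonormal_family d \<phi>" by (rule leading_orthonormal[OF \<phi>(1)])
  then have "projection_error \<nu> V = (\<integral>u. (norm (u - proj_on d \<phi> u))\<^sup>2 \<partial>\<nu>)"
    unfolding projection_error_def \<phi>(2) by (simp add: orth_proj_span)
  with on that show ?thesis by blast
qed

lemma expected_error_given_data:
  fixes \<mu> :: "'x::{real_inner, banach, second_countable_topology} measure"
    and \<Psi> :: "'x \<Rightarrow> 'y::{real_inner, banach, second_countable_topology}"
  assumes \<mu>: "prob_space \<mu>" "sets \<mu> = sets borel" and \<Psi>: "\<Psi> \<in> borel_measurable \<mu>"
    and int: "integrable \<mu> (\<lambda>x. norm x ^ 4)" "integrable \<mu> (\<lambda>x. norm (\<Psi> x) ^ 4)"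
    and pos: "0 < (\<integral>x. (norm x)\<^sup>2 \<partial>\<mu>)"
    and M: "M = sqrt ((\<integral>x. (norm x)\<^sup>2 \<partial>\<mu>) / \<delta>)" and \<delta>: "0 < \<delta>"
    and lip: "L-lipschitz_on UNIV \<Psi>" and \<phi>: "orthonormal_family n \<phi>" and \<psi>: "orthonormal_family m \<psi>"
    and m: "1 \<le> m" and \<tau>: "0 < \<tau>"
    and approx: "\<And>j s. s \<in> cube n M \<Longrightarrow> j < m \<Longrightarrow>
        \<bar>vec_index (g s) j - inner (\<Psi> (pca_decoder n \<phi> s)) (\<psi> j)\<bar> \<le> 2 * L * \<tau> / sqrt (real m)"
    and zero: "\<And>s. s \<in> carrier_vec n - cube n M \<Longrightarrow> g s = 0\<^sub>v m"
  shows "(\<integral>\<^sup>+x. ennreal ((nn_error n \<phi> m \<psi> g \<Psi> x)\<^sup>2) \<partial>\<mu>)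
    \<le> ennreal (12 * L\<^sup>2 * \<tau>\<^sup>2 + ((\<integral>x. norm (\<Psi> x) ^ 4 \<partial>\<mu>) + 1) / 2 * sqrt \<delta>)
      + ennreal (3 * L\<^sup>2) * (\<integral>\<^sup>+x. ennreal ((norm (x - proj_on n \<phi> x))\<^sup>2) \<partial>\<mu>)
      + 3 * (\<integral>\<^sup>+x. ennreal ((norm (\<Psi> x - proj_on m \<psi> (\<Psi> x)))\<^sup>2) \<partial>\<mu>)"
proof -
  interpret prob_space \<mu> by fact
  have [measurable]: "(\<lambda>x. x) \<in> borel_measurable \<mu>" by (rule measurable_ident_sets[OF \<mu>(2)])
  note [measurable] = \<Psi>
  define m2 where "m2 = (\<integral>x. (norm x)\<^sup>2 \<partial>\<mu>)"
  have M2: "M\<^sup>2 = m2 / \<delta>" and M0: "0 < M" using pos \<delta> by (auto simp: M m2_def)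
  have int2: "integrable \<mu> (\<lambda>x. (norm x)\<^sup>2)"
    by (rule integrable_norm_sq[OF \<mu>(1) _ int(1)]) measurable
  define A where "A x = (norm (x - proj_on n \<phi> x))\<^sup>2" for x
  define B where "B x = (norm (\<Psi> x - proj_on m \<psi> (\<Psi> x)))\<^sup>2" for x
  have [measurable]: "A \<in> borel_measurable \<mu>" unfolding A_def proj_on_def by measurable
  have [measurable]: "B \<in> borel_measurable \<mu>" unfolding B_def proj_on_def by measurable
  have AB: "0 \<le> A x" "0 \<le> B x" for x by (auto simp: A_def B_def)
  define T where "T x = sqrt \<delta> / 2 * norm (\<Psi> x) ^ 4 + (norm x)\<^sup>2 / (2 * sqrt \<delta> * M\<^sup>2)" for x
  have T0: "0 \<le> T x" for x using \<delta> M0 by (auto simp: T_def)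
  have T_int: "integrable \<mu> T" unfolding T_def using int int2 by simp
  have [measurable]: "T \<in> borel_measurable \<mu>" using T_int by (rule borel_measurable_integrable)
  have "(\<integral>x. T x \<partial>\<mu>) = sqrt \<delta> / 2 * (\<integral>x. norm (\<Psi> x) ^ 4 \<partial>\<mu>) + m2 / (2 * sqrt \<delta> * M\<^sup>2)"
    unfolding T_def m2_def using int int2 by simp
  also have "m2 / (2 * sqrt \<delta> * M\<^sup>2) = sqrt \<delta> / 2"
  proof -
    have "m2 / (2 * sqrt \<delta> * M\<^sup>2) = \<delta> / (2 * sqrt \<delta>)"
      unfolding M2 using pos \<delta> by (simp add: m2_def)
    also have "\<dots> = (sqrt \<delta> * sqrt \<delta>) / (2 * sqrt \<delta>)" using \<delta> by simp
    also have "\<dots> = sqrt \<delta> / 2" using \<delta> by (simp del: real_sqrt_mult_self)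
    finally show ?thesis .
  qed
  finally have T_val: "(\<integral>x. T x \<partial>\<mu>) = ((\<integral>x. norm (\<Psi> x) ^ 4 \<partial>\<mu>) + 1) / 2 * sqrt \<delta>"
    by (simp add: algebra_simps add_divide_distrib)
  let ?k = "12 * L\<^sup>2 * \<tau>\<^sup>2"
  have "(nn_error n \<phi> m \<psi> g \<Psi> x)\<^sup>2 \<le> ?k + T x + 3 * L\<^sup>2 * A x + 3 * B x" for x
  proof (cases "pca_encoder n \<phi> x \<in> cube n M")
    case True
    then show ?thesis
      using nn_error_on_cube[where g = g and x = x, OF lip \<phi> \<psi> m \<tau> approx[OF True]] T0[of x]
      unfolding A_def B_def by linarith
  next
    case False
    have "g (pca_encoder n \<phi> x) = 0\<^sub>v m" using False by (intro zero) (simp add: pca_encoder_def)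
    then have "(nn_error n \<phi> m \<psi> g \<Psi> x)\<^sup>2 \<le> T x"
      unfolding T_def by (rule nn_error_off_cube[OF \<phi> M0 \<delta> False])
    moreover have "0 \<le> 3 * L\<^sup>2 * A x" "0 \<le> ?k" using AB by auto
    ultimately show ?thesis using AB(2)[of x] by linarith
  qed
  then have "(\<integral>\<^sup>+x. ennreal ((nn_error n \<phi> m \<psi> g \<Psi> x)\<^sup>2) \<partial>\<mu>)
      \<le> (\<integral>\<^sup>+x. ennreal (?k + T x + 3 * L\<^sup>2 * A x + 3 * B x) \<partial>\<mu>)"
    by (intro nn_integral_mono ennreal_leI)
  also have "\<dots> = (\<integral>\<^sup>+x. ennreal ?k + ennreal (T x) + ennreal (3 * L\<^sup>2) * ennreal (A x) + 3 * ennreal (B x) \<partial>\<mu>)"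
  proof (rule nn_integral_cong)
    fix x
    have "ennreal (a + b + c * d + 3 * e) = ennreal a + ennreal b + ennreal c * ennreal d + 3 * ennreal e"
      if "0 \<le> a" "0 \<le> b" "0 \<le> c" "0 \<le> d" "0 \<le> e" for a b c d e
      using that by (simp add: ennreal_mult')
    then show "ennreal (?k + T x + 3 * L\<^sup>2 * A x + 3 * B x)
        = ennreal ?k + ennreal (T x) + ennreal (3 * L\<^sup>2) * ennreal (A x) + 3 * ennreal (B x)"
      using T0 AB by (simp del: ennreal_plus)
  qed
  also have "\<dots> = ennreal ?k + ennreal (\<integral>x. T x \<partial>\<mu>) + ennreal (3 * L\<^sup>2) * (\<integral>\<^sup>+x. ennreal (A x) \<partial>\<mu>)
      + 3 * (\<integral>\<^sup>+x. ennreal (B x) \<partial>\<mu>)"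
    using nn_integral_eq_integral[OF T_int] T0
    by (simp add: nn_integral_add nn_integral_cmult emeasure_space_1)
  also have "ennreal ?k + ennreal (\<integral>x. T x \<partial>\<mu>) = ennreal (?k + (\<integral>x. T x \<partial>\<mu>))"
    using T0 by (intro ennreal_plus[symmetric]) auto
  finally show ?thesis unfolding T_val A_def B_def .
qed

section \<open>The expected error\<close>

text \<open>
  The size of the network comes from \<open>stacked_network_approx\<close>, the majorant of the error from
  \<open>expected_error_given_data\<close>, and the two PCA residuals from \<open>pca_excess_risk\<close>, applied to the identity
  for the inputs and to \<open>\<Psi>\<close> for the outputs.
\<close>
theorem theorem3p5:
  shows "\<exists>c :: nat \<Rightarrow> nat \<Rightarrow> real. (\<forall>dX dY. 0 \<le> c dX dY) \<and>
    (\<forall>(\<mu> :: 'x::{real_inner, banach, second_countable_topology} measure)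
      (\<Psi> :: 'x \<Rightarrow> 'y::{real_inner, banach, second_countable_topology}).
      prob_space \<mu> \<longrightarrow> sets \<mu> = sets borel \<longrightarrow>
      integrable \<mu> (\<lambda>x. norm x ^ 4) \<longrightarrow>
      0 < (\<integral>x. (norm x)\<^sup>2 \<partial>\<mu>) \<longrightarrow>
      \<Psi> \<in> borel_measurable \<mu> \<longrightarrow> (\<exists>L. L-lipschitz_on UNIV \<Psi>) \<longrightarrow>
      (\<exists>C>0. \<forall>(dX::nat) (dY::nat) (N::nat) (\<delta>::real) (\<tau>::real) (M::real) VX VY phiX phiY.
        1 \<le> dX \<longrightarrow> 1 \<le> dY \<longrightarrow> max dX dY \<le> N \<longrightarrow> 0 < \<delta> \<longrightarrow> \<delta> < 1 \<longrightarrow> 0 < \<tau> \<longrightarrow>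
        M = sqrt ((\<integral>x. (norm x)\<^sup>2 \<partial>\<mu>) / \<delta>) \<longrightarrow>
        optimal_projection_space \<mu> dX VX \<longrightarrow>
        optimal_projection_space (distr \<mu> borel \<Psi>) dY VY \<longrightarrow>
        (\<forall>xs\<in>space (Pi\<^sub>M {..<N} (\<lambda>_. \<mu>)).
           leading_eigenvectors (empirical_covariance N xs) dX (phiX xs) \<and>
           leading_eigenvectors (empirical_covariance N (\<lambda>j. \<Psi> (xs j))) dY (phiY xs)) \<longrightarrow>
        (\<exists>(t::nat) (r::nat) net.
           real t \<le> c dX dY * (max 0 (ln (M * sqrt (real dY) / \<tau>)) + 1) \<and>
           real r \<le> c dX dY * (\<tau> / (2 * M)) powr (- real dX)
                      * (max 0 (ln (M * sqrt (real dY) / \<tau>)) + 1) \<and>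
           (\<forall>xs\<in>space (Pi\<^sub>M {..<N} (\<lambda>_. \<mu>)). net xs \<in> zero_ext_nets dX dY t r M) \<and>
           upper_nn_integral (Pi\<^sub>M {..<N} (\<lambda>_. \<mu>))
             (\<lambda>xs. \<integral>\<^sup>+x. ennreal ((nn_error dX (phiX xs) dY (phiY xs) (net xs) \<Psi> x)\<^sup>2) \<partial>\<mu>)
           \<le> ennreal (C * (\<tau>\<^sup>2 + sqrt \<delta>
                + sqrt (real dX / real N) + projection_error \<mu> VX
                + sqrt (real dY / real N) + projection_error (distr \<mu> borel \<Psi>) VY)))))"
proof (intro exI[of _ net_const] conjI allI impI)
  show "0 \<le> net_const n m" for n m using net_const_ge_1[of n m] by linarith
next
  fix \<mu> :: "'x measure" and \<Psi> :: "'x \<Rightarrow> 'y"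
  assume \<mu>: "prob_space \<mu>" and sets: "sets \<mu> = sets borel"
    and X4: "integrable \<mu> (\<lambda>x. norm x ^ 4)" and pos: "0 < (\<integral>x. (norm x)\<^sup>2 \<partial>\<mu>)"
    and \<Psi>: "\<Psi> \<in> borel_measurable \<mu>" and "\<exists>L. L-lipschitz_on UNIV \<Psi>"
  then obtain L where lip: "L-lipschitz_on UNIV \<Psi>" by blast
  interpret \<mu>: prob_space \<mu> by fact
  have L: "0 \<le> L" using lip by (rule lipschitz_on_nonneg)
  note [measurable] = \<Psi>
  have id[measurable]: "(\<lambda>x. x) \<in> borel_measurable \<mu>" by (rule measurable_ident_sets[OF sets])
  have Y4: "integrable \<mu> (\<lambda>x. norm (\<Psi> x) ^ 4)" by (rule integrable_lipschitz_norm4[OF \<mu> X4 \<Psi> lip])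
  have Y2: "integrable \<mu> (\<lambda>x. (norm (\<Psi> x))\<^sup>2)" by (rule integrable_norm_sq[OF \<mu> \<Psi> Y4])
  define m2 where "m2 = (\<integral>x. (norm x)\<^sup>2 \<partial>\<mu>)"
  define y2 where "y2 = (\<integral>x. (norm (\<Psi> x))\<^sup>2 \<partial>\<mu>)"
  \<comment> \<open>The summand 1 makes the moment bounds positive, as \<open>pca_excess_risk\<close> requires, even for \<open>\<Psi> = 0\<close>.\<close>
  define mX where "mX = (\<integral>x. norm x ^ 4 \<partial>\<mu>) + 1"
  define mY where "mY = (\<integral>x. norm (\<Psi> x) ^ 4 \<partial>\<mu>) + 1"
  have mXY: "0 < mX" "0 < mY" "0 \<le> y2" "0 < m2"
    using pos by (auto simp: mX_def mY_def y2_def m2_def intro!: add_nonneg_pos)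
  define C where "C = 1 + 12 * L\<^sup>2 + mY / 2 + 3 * L\<^sup>2 + 3 + 3 * L\<^sup>2 * (2 * sqrt (2 * mX))
    + 3 * (2 * sqrt (2 * mY)) + y2 / (4 * m2)"
  have C: "0 < C" "12 * L\<^sup>2 \<le> C" "mY / 2 \<le> C" "3 * L\<^sup>2 \<le> C" "3 \<le> C"
    "3 * L\<^sup>2 * (2 * sqrt (2 * mX)) \<le> C" "3 * (2 * sqrt (2 * mY)) \<le> C" "y2 / (4 * m2) \<le> C"
  proof -
    have "0 \<le> 12 * L\<^sup>2" "0 \<le> mY / 2" "0 \<le> 3 * L\<^sup>2" "0 \<le> 3 * L\<^sup>2 * (2 * sqrt (2 * mX))"
      "0 \<le> 3 * (2 * sqrt (2 * mY))" "0 \<le> y2 / (4 * m2)" using mXY by auto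
    then show "0 < C" "12 * L\<^sup>2 \<le> C" "mY / 2 \<le> C" "3 * L\<^sup>2 \<le> C" "3 \<le> C"
      "3 * L\<^sup>2 * (2 * sqrt (2 * mX)) \<le> C" "3 * (2 * sqrt (2 * mY)) \<le> C" "y2 / (4 * m2) \<le> C"
      unfolding C_def by linarith+
  qed
  show "\<exists>C>0. \<forall>(dX::nat) (dY::nat) (N::nat) (\<delta>::real) (\<tau>::real) (M::real) VX VY phiX phiY.
        1 \<le> dX \<longrightarrow> 1 \<le> dY \<longrightarrow> max dX dY \<le> N \<longrightarrow> 0 < \<delta> \<longrightarrow> \<delta> < 1 \<longrightarrow> 0 < \<tau> \<longrightarrow>
        M = sqrt ((\<integral>x. (norm x)\<^sup>2 \<partial>\<mu>) / \<delta>) \<longrightarrow>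
        optimal_projection_space \<mu> dX VX \<longrightarrow>
        optimal_projection_space (distr \<mu> borel \<Psi>) dY VY \<longrightarrow>
        (\<forall>xs\<in>space (Pi\<^sub>M {..<N} (\<lambda>_. \<mu>)).
           leading_eigenvectors (empirical_covariance N xs) dX (phiX xs) \<and>
           leading_eigenvectors (empirical_covariance N (\<lambda>j. \<Psi> (xs j))) dY (phiY xs)) \<longrightarrow>
        (\<exists>(t::nat) (r::nat) net.
           real t \<le> net_const dX dY * (max 0 (ln (M * sqrt (real dY) / \<tau>)) + 1) \<and>
           real r \<le> net_const dX dY * (\<tau> / (2 * M)) powr (- real dX)
                      * (max 0 (ln (M * sqrt (real dY) / \<tau>)) + 1) \<and>
           (\<forall>xs\<in>space (Pi\<^sub>M {..<N} (\<lambda>_. \<mu>)). net xs \<in> zero_ext_nets dX dY t r M) \<and>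
           upper_nn_integral (Pi\<^sub>M {..<N} (\<lambda>_. \<mu>))
             (\<lambda>xs. \<integral>\<^sup>+x. ennreal ((nn_error dX (phiX xs) dY (phiY xs) (net xs) \<Psi> x)\<^sup>2) \<partial>\<mu>)
           \<le> ennreal (C * (\<tau>\<^sup>2 + sqrt \<delta>
                + sqrt (real dX / real N) + projection_error \<mu> VX
                + sqrt (real dY / real N) + projection_error (distr \<mu> borel \<Psi>) VY)))"
  proof (rule exI[of _ C], intro conjI allI impI C(1))
    fix dX dY N :: nat and \<delta> \<tau> M :: real and VX :: "'x set" and VY :: "'y set"
      and phiX :: "(nat \<Rightarrow> 'x) \<Rightarrow> nat \<Rightarrow> 'x" and phiY :: "(nat \<Rightarrow> 'x) \<Rightarrow> nat \<Rightarrow> 'y"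
    assume dX: "1 \<le> dX" and dY: "1 \<le> dY" and "max dX dY \<le> N" and \<delta>: "0 < \<delta>" "\<delta> < 1" and \<tau>: "0 < \<tau>"
      and M: "M = sqrt ((\<integral>x. (norm x)\<^sup>2 \<partial>\<mu>) / \<delta>)"
      and VX: "optimal_projection_space \<mu> dX VX"
      and VY: "optimal_projection_space (distr \<mu> borel \<Psi>) dY VY"
      and lead: "\<forall>xs\<in>space (Pi\<^sub>M {..<N} (\<lambda>_. \<mu>)).
           leading_eigenvectors (empirical_covariance N xs) dX (phiX xs) \<and>
           leading_eigenvectors (empirical_covariance N (\<lambda>j. \<Psi> (xs j))) dY (phiY xs)"
    then have N: "0 < N" by simp
    define P where "P = Pi\<^sub>M {..<N} (\<lambda>_. \<mu>)"
    interpret P: prob_space P unfolding P_def by (rule prob_space_PiM) (rule \<mu>)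
    let ?\<Lambda> = "max 0 (ln (M * sqrt (real dY) / \<tau>))"
    let ?e = "\<lambda>net xs. \<integral>\<^sup>+x. ennreal ((nn_error dX (phiX xs) dY (phiY xs) (net xs) \<Psi> x)\<^sup>2) \<partial>\<mu>"
    define RX where "RX = projection_error \<mu> VX"
    define RY where "RY = projection_error (distr \<mu> borel \<Psi>) VY"
    define B where "B = \<tau>\<^sup>2 + sqrt \<delta> + sqrt (real dX / real N) + RX + sqrt (real dY / real N) + RY"
    have R0: "0 \<le> RX" "0 \<le> RY" by (auto simp: RX_def RY_def projection_error_def)
    have M2: "M\<^sup>2 = m2 / \<delta>" and M0: "0 < M" using pos \<delta> by (auto simp: M m2_def)
    have "\<exists>(t::nat) (r::nat) net. real t \<le> net_const dX dY * (?\<Lambda> + 1) \<and>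
           real r \<le> net_const dX dY * (\<tau> / (2 * M)) powr (- real dX) * (?\<Lambda> + 1) \<and>
           (\<forall>xs\<in>space P. net xs \<in> zero_ext_nets dX dY t r M) \<and>
           upper_nn_integral P (?e net) \<le> ennreal (C * B)"
    proof (cases "\<tau> \<le> 2 * M")
      case False
      have "net_const dX dY * 1 \<le> net_const dX dY * (?\<Lambda> + 1)"
        using net_const_ge_1[of dX dY] by (intro mult_left_mono) auto
      then have "real 1 \<le> net_const dX dY * (?\<Lambda> + 1)"
        using net_const_ge_1[of dX dY] unfolding of_nat_1 mult_1_right by (rule order_trans[rotated])
      moreover have "real 0 \<le> net_const dX dY * (\<tau> / (2 * M)) powr (- real dX) * (?\<Lambda> + 1)"
        using net_const_ge_1[of dX dY] by simp
      moreover have "upper_nn_integral P (?e (\<lambda>_ _. 0\<^sub>v dY)) \<le> ennreal (C * B)"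
      proof -
        have "nn_error dX (phiX xs) dY (phiY xs) (\<lambda>_. 0\<^sub>v dY) \<Psi> x = norm (\<Psi> x)" for xs x
          by (simp add: nn_error_def)
        then have "?e (\<lambda>_ _. 0\<^sub>v dY) xs = ennreal y2" for xs
          unfolding y2_def using nn_integral_eq_integral[OF Y2] by simp
        then have "upper_nn_integral P (?e (\<lambda>_ _. 0\<^sub>v dY)) \<le> (\<integral>\<^sup>+xs. ennreal y2 \<partial>P)"
          by (intro upper_nn_integral_le) auto
        also have "\<dots> = ennreal y2" by (simp add: P.emeasure_space_1)
        also have "y2 \<le> C * B"
        proof -
          \<comment> \<open>The last summand of \<open>C\<close> is made for this case: \<open>\<tau>\<^sup>2\<close> is at least \<open>4 * m2\<close>.\<close>
          have "m2 \<le> M\<^sup>2" unfolding M2 using \<delta> mXY(4) by (simp add: pos_le_divide_eq)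
          moreover have "(2 * M)\<^sup>2 \<le> \<tau>\<^sup>2" using False M0 by (intro power_mono) auto
          ultimately have "4 * m2 \<le> \<tau>\<^sup>2" by (simp add: power_mult_distrib)
          then have "y2 / (4 * m2) * (4 * m2) \<le> C * \<tau>\<^sup>2"
            using C(1,8) mXY by (intro mult_mono) auto
          also have "C * \<tau>\<^sup>2 \<le> C * B" using C(1) R0 \<delta> unfolding B_def by (intro mult_left_mono) auto
          finally show ?thesis using mXY(4) by simp
        qed
        finally show ?thesis by (simp add: ennreal_leI)
      qed
      ultimately show ?thesis
        using zero_net[of dY dX M]
        by (intro exI[of _ 1] exI[of _ 0] exI[of _ "\<lambda>_ _. 0\<^sub>v dY"] conjI ballI)
    next
      case True
      obtain \<phi> where \<phi>: "orthonormal_family dX \<phi>" "RX = (\<integral>u. (norm (u - proj_on dX \<phi> u))\<^sup>2 \<partial>\<mu>)"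
        unfolding RX_def using projection_error_span[OF VX] by blast
      obtain \<psi> where \<psi>: "orthonormal_family dY \<psi>"
        "RY = (\<integral>u. (norm (u - proj_on dY \<psi> u))\<^sup>2 \<partial>distr \<mu> borel \<Psi>)"
        unfolding RY_def using projection_error_span[OF VY] by blast
      have RY: "RY = (\<integral>x. (norm (\<Psi> x - proj_on dY \<psi> (\<Psi> x)))\<^sup>2 \<partial>\<mu>)"
        unfolding \<psi>(2) by (rule integral_distr[OF \<Psi>]) (unfold proj_on_def, measurable)
      obtain GX where GX: "GX \<in> borel_measurable P"
        "(\<integral>\<^sup>+xs. GX xs \<partial>P) \<le> ennreal (2 * sqrt (2 * mX) * sqrt (real dX / real N))"
        "\<And>xs \<theta>. xs \<in> space P \<Longrightarrow> leading_eigenvectors (empirical_covariance N xs) dX \<theta> \<Longrightarrow>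
          (\<integral>\<^sup>+x. ennreal ((norm (x - proj_on dX \<theta> x))\<^sup>2) \<partial>\<mu>) \<le> ennreal RX + GX xs"
        using pca_excess_risk[OF \<mu> id X4 _ mXY(1) N, of dX] \<phi> by (auto simp: mX_def P_def)
      obtain GY where GY: "GY \<in> borel_measurable P"
        "(\<integral>\<^sup>+xs. GY xs \<partial>P) \<le> ennreal (2 * sqrt (2 * mY) * sqrt (real dY / real N))"
        "\<And>xs \<theta>. xs \<in> space P \<Longrightarrow> leading_eigenvectors (empirical_covariance N (\<lambda>j. \<Psi> (xs j))) dY \<theta> \<Longrightarrow>
          (\<integral>\<^sup>+x. ennreal ((norm (\<Psi> x - proj_on dY \<theta> (\<Psi> x)))\<^sup>2) \<partial>\<mu>) \<le> ennreal RY + GY xs"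
        using pca_excess_risk[OF \<mu> \<Psi> Y4 _ mXY(2) N, of dY] \<psi>(1) by (auto simp: mY_def P_def RY)
      obtain t r where tr: "real t \<le> net_const dX dY * (?\<Lambda> + 1)"
        "real r \<le> net_const dX dY * (\<tau> / (2 * M)) powr (- real dX) * (?\<Lambda> + 1)"
        and all: "\<forall>L h. 0 \<le> L \<longrightarrow> (\<forall>j<dY. \<forall>x\<in>carrier_vec dX. \<forall>y\<in>carrier_vec dX.
             \<bar>h j x - h j y\<bar> \<le> L * (\<Sum>i<dX. \<bar>vec_index x i - vec_index y i\<bar>)) \<longrightarrow>
          (\<exists>g\<in>zero_ext_nets dX dY t r M.
            (\<forall>x\<in>cube dX M. \<forall>j<dY. \<bar>vec_index (g x) j - h j x\<bar> \<le> 2 * L * \<tau> / sqrt (real dY)) \<and>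
            (\<forall>x\<in>carrier_vec dX - cube dX M. g x = 0\<^sub>v dY))"
        using stacked_network_approx[OF dX dY M0 \<tau> True] by (elim exE conjE)
      note approx = all[THEN spec, THEN spec, THEN mp, OF L, THEN mp]
      have on: "orthonormal_family dX (phiX xs)" "orthonormal_family dY (phiY xs)" if "xs \<in> space P" for xs
        using lead that leading_orthonormal unfolding P_def by blast+
      have "\<exists>g\<in>zero_ext_nets dX dY t r M.
            (\<forall>x\<in>cube dX M. \<forall>j<dY. \<bar>vec_index (g x) j - inner (\<Psi> (pca_decoder dX (phiX xs) x)) (phiY xs j)\<bar>
               \<le> 2 * L * \<tau> / sqrt (real dY)) \<and>
            (\<forall>x\<in>carrier_vec dX - cube dX M. g x = 0\<^sub>v dY)" if "xs \<in> space P" for xs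
        by (rule approx) (auto intro!: latent_map_lipschitz[OF lip on[OF that]])
      then obtain net where net: "\<And>xs. xs \<in> space P \<Longrightarrow> net xs \<in> zero_ext_nets dX dY t r M"
        "\<And>xs x j. xs \<in> space P \<Longrightarrow> x \<in> cube dX M \<Longrightarrow> j < dY \<Longrightarrow>
          \<bar>vec_index (net xs x) j - inner (\<Psi> (pca_decoder dX (phiX xs) x)) (phiY xs j)\<bar>
               \<le> 2 * L * \<tau> / sqrt (real dY)"
        "\<And>xs x. xs \<in> space P \<Longrightarrow> x \<in> carrier_vec dX - cube dX M \<Longrightarrow> net xs x = 0\<^sub>v dY"
        by metis
      define k where "k = 12 * L\<^sup>2 * \<tau>\<^sup>2 + mY / 2 * sqrt \<delta>"
      have k: "0 \<le> k" using mXY \<delta> by (simp add: k_def)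
      define G where "G xs = ennreal k + ennreal (3 * L\<^sup>2) * (ennreal RX + GX xs) + 3 * (ennreal RY + GY xs)" for xs
      have [measurable]: "G \<in> borel_measurable P" unfolding G_def using GX(1) GY(1) by measurable
      have "?e net xs \<le> G xs" if xs: "xs \<in> space P" for xs
      proof -
        have "?e net xs \<le> ennreal k
          + ennreal (3 * L\<^sup>2) * (\<integral>\<^sup>+x. ennreal ((norm (x - proj_on dX (phiX xs) x))\<^sup>2) \<partial>\<mu>)
          + 3 * (\<integral>\<^sup>+x. ennreal ((norm (\<Psi> x - proj_on dY (phiY xs) (\<Psi> x)))\<^sup>2) \<partial>\<mu>)"
          unfolding k_def mY_def
          by (rule expected_error_given_data[OF \<mu> sets \<Psi> X4 Y4 pos M \<delta>(1) lip on[OF xs] dY \<tau>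
                net(2)[OF xs] net(3)[OF xs]])
        also have "\<dots> \<le> G xs"
          unfolding G_def using lead xs
          by (intro add_mono mult_left_mono GX(3)[OF xs] GY(3)[OF xs] order_refl) (auto simp: P_def)
        finally show ?thesis .
      qed
      then have "upper_nn_integral P (?e net) \<le> (\<integral>\<^sup>+xs. G xs \<partial>P)" by (intro upper_nn_integral_le) auto
      also have "\<dots> = ennreal k + ennreal (3 * L\<^sup>2) * (ennreal RX + (\<integral>\<^sup>+xs. GX xs \<partial>P))
          + 3 * (ennreal RY + (\<integral>\<^sup>+xs. GY xs \<partial>P))"
        unfolding G_def using GX(1) GY(1)
        by (simp add: nn_integral_add nn_integral_cmult P.emeasure_space_1)
      also have "\<dots> \<le> ennreal k
          + ennreal (3 * L\<^sup>2) * (ennreal RX + ennreal (2 * sqrt (2 * mX) * sqrt (real dX / real N)))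
          + 3 * (ennreal RY + ennreal (2 * sqrt (2 * mY) * sqrt (real dY / real N)))"
        by (intro add_mono mult_left_mono GX(2) GY(2) order_refl) auto
      also have "\<dots> = ennreal (k + 3 * L\<^sup>2 * (RX + 2 * sqrt (2 * mX) * sqrt (real dX / real N))
          + 3 * (RY + 2 * sqrt (2 * mY) * sqrt (real dY / real N)))"
      proof -
        have "ennreal a + ennreal b * (ennreal c + ennreal d) + 3 * (ennreal e + ennreal f)
            = ennreal (a + b * (c + d) + 3 * (e + f))"
          if "0 \<le> a" "0 \<le> b" "0 \<le> c" "0 \<le> d" "0 \<le> e" "0 \<le> f" for a b c d e f
          using that by (simp add: ennreal_mult')
        then show ?thesis using k R0 mXY by (simp del: ennreal_plus)
      qed
      also have "\<dots> \<le> ennreal (C * B)"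
      proof (rule ennreal_leI)
        let ?sx = "sqrt (real dX / real N)" and ?sy = "sqrt (real dY / real N)"
        have "k + 3 * L\<^sup>2 * (RX + 2 * sqrt (2 * mX) * ?sx) + 3 * (RY + 2 * sqrt (2 * mY) * ?sy)
          = 12 * L\<^sup>2 * \<tau>\<^sup>2 + mY / 2 * sqrt \<delta> + 3 * L\<^sup>2 * (2 * sqrt (2 * mX)) * ?sx + 3 * L\<^sup>2 * RX
            + 3 * (2 * sqrt (2 * mY)) * ?sy + 3 * RY"
          by (simp add: k_def algebra_simps)
        also have "\<dots> \<le> C * \<tau>\<^sup>2 + C * sqrt \<delta> + C * ?sx + C * RX + C * ?sy + C * RY"
          using C R0 \<delta> by (intro add_mono mult_right_mono) auto
        also have "\<dots> = C * B" by (simp add: B_def algebra_simps)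
        finally show "k + 3 * L\<^sup>2 * (RX + 2 * sqrt (2 * mX) * ?sx) + 3 * (RY + 2 * sqrt (2 * mY) * ?sy) \<le> C * B" .
      qed
      finally have "upper_nn_integral P (?e net) \<le> ennreal (C * B)" .
      with tr net(1) show ?thesis by blast
    qed
    then show "\<exists>(t::nat) (r::nat) net.
           real t \<le> net_const dX dY * (?\<Lambda> + 1) \<and>
           real r \<le> net_const dX dY * (\<tau> / (2 * M)) powr (- real dX) * (?\<Lambda> + 1) \<and>
           (\<forall>xs\<in>space (Pi\<^sub>M {..<N} (\<lambda>_. \<mu>)). net xs \<in> zero_ext_nets dX dY t r M) \<and>
           upper_nn_integral (Pi\<^sub>M {..<N} (\<lambda>_. \<mu>)) (?e net)
           \<le> ennreal (C * (\<tau>\<^sup>2 + sqrt \<delta> + sqrt (real dX / real N) + projection_error \<mu> VX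
                + sqrt (real dY / real N) + projection_error (distr \<mu> borel \<Psi>) VY))"
      unfolding B_def P_def RX_def RY_def .
  qed
qed

end
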